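(* Let $\epsilon\in(0,1)$, $M\ge 1$, and let $V_0\in V_d(\mathbb{R}^n)$ be a $d$-varifold with compact support and $\|V_0\|(\mathbb{R}^n)\le M$. For $j\in\mathbb{N}$ let $\mathcal{T}_j^D=\{k2^{-j}\}_{k=0,1,\dots,2^j}$ be the dyadic subdivision of $[0,1]$, and for $j$ large enough that $c_3 2^{-j}\le (M+1)^{-3}\epsilon^8$ let $(V_{\epsilon,\mathcal{T}_j^D}(t))_{t\in[0,1]}$ be the time-discrete approximate mean curvature flow with respect to $\mathcal{T}_j^D$ starting from $V_0$. Then: (i) There exists a family $(V_\epsilon(t))_{t\in[0,1]}$ in $V_d(\mathbb{R}^n)$ such that for every $t\in[0,1]$: (1) $\|V_\epsilon(t)\|(\mathbb{R}^n)\le M+1$; (2) $V_{\epsilon,\mathcal{T}_j^D}(t)$ converges weakly-$*$ to $V_\epsilon(t)$ as $j\to\infty$; (3) $\Delta\big(V_{\epsilon,\mathcal{T}_j^D}(t),V_\epsilon(t)\big)\to 0$ as $j\to+\infty$. (ii) If $(\mathcal{T}_j)_{j\in\mathbb{N}}$ is any other sequence of subdivisions of $[0,1]$ with sizes $\delta(\mathcal{T}_j)\to 0$, then the time-discrete approximate mean curvature flows $(V_{\epsilon,\mathcal{T}_j}(t))_{t\in[0,1]}$ with respect to $\mathcal{T}_j$ starting from $V_0$ (defined for $j$ large) converge to the same family $(V_\epsilon(t))_{t\in[0,1]}$: for every $t\in[0,1]$, $V_{\epsilon,\mathcal{T}_j}(t)$ converges weakly-$*$ to $V_\epsilon(t)$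 and $\Delta\big(V_{\epsilon,\mathcal{T}_j}(t),V_\epsilon(t)\big)\to 0$ as $j\to+\infty$. In other words, there is a unique limit flow $(V_\epsilon(t))_{t\in[0,1]}$ starting from $V_0$ (called the approximate mean curvature flow of $V_0$).
   Context: Let $n\ge 2$, $1\le d\le n$. $G_{d,n}$ is the Grassmannian of $d$-dimensional linear subspaces of $\mathbb{R}^n$; $S\in G_{d,n}$ is identified with the orthogonal projection matrix onto $S$, the distance on $G_{d,n}$ is $\|S-T\|$ (operator norm), and $\mathbb{R}^n\times G_{d,n}$ carries the metric $|x-y|+\|S-T\|$. A $d$-varifold is a nonnegative Radon measure on $\mathbb{R}^n\times G_{d,n}$; $V_d(\mathbb{R}^n)$ is the set of $d$-varifolds; the mass measure is $\|V\|(A)=V(A\times G_{d,n})$. Weak-$*$ convergence of Radon measures means convergence of integrals of continuous compactly supported functions. The bounded Lipschitz distance of finite Radon measures on a metric space $X$ is $\Delta(\mu,\nu)=\sup\{|\int\varphi\,d\mu-\int\varphi\,d\nu|:\varphi\in C^0(X,\mathbb{R}_+),\ \max(\|\varphi\|_\infty,\mathrm{Lip}(\varphi))\le 1\}$. Push-forward: for a $C^1$ diffeomorphism $f$ of $\mathbb{R}^n$, $f_\#V(\varphi)=\int\varphi(f(x),Df(x)(S))\,J_Sf(x)\,dV(x,S)$, where $Df(x)(S)$ is the image subspace and $J_Sf(x)=\det(Y^tY)^{1/2}$, $Y=Df(x)(s_1|\dots|s_d)$ with $(s_i)$ an orthonormal basis of $S$. Kernel: $\psi\in C^\infty(\mathbb{R}^n)$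 is a fixed radially symmetric function (depending only on $n$) with $0\le\psi\le1$, $\psi=1$ on $\{|x|\le 1/2\}$, $\psi=0$ on $\{|x|\ge1\}$, $|\nabla\psi|\le3$. For $\epsilon\in(0,1)$, $\Phi_\epsilon(x)=c(\epsilon)\psi(x)(2\pi\epsilon^2)^{-n/2}\exp(-|x|^2/(2\epsilon^2))$ with $c(\epsilon)$ such that $\int\Phi_\epsilon=1$. Approximate mean curvature: $h_\epsilon(\cdot,V)=\Phi_\epsilon*\tilde h_\epsilon(\cdot,V)$, $\tilde h_\epsilon(y,V)=-\dfrac{(\delta V*\Phi_\epsilon)(y)}{(\|V\|*\Phi_\epsilon)(y)+\epsilon}$, where $(\|V\|*\Phi_\epsilon)(y)=\int\Phi_\epsilon(x-y)\,d\|V\|(x)$ and $(\delta V*\Phi_\epsilon)(y)=\int S(\nabla\Phi_\epsilon(x-y))\,dV(x,S)$. Time-discrete approximate mean curvature flow: a subdivision $\mathcal{T}=\{t_i\}_{i=0}^m$ of $[0,1]$ satisfies $0=t_0<\dots<t_m=1$; $\delta(\mathcal{T})=\max_i(t_i-t_{i-1})$. $c_3>0$ is a fixed constant depending only on $n$ such that, whenever $\|V_0\|(\mathbb{R}^n)\le M$ and $c_3\delta(\mathcal{T})\le(M+1)^{-3}\epsilon^8$, the following is well defined (all maps used are $C^1$ diffeomorphisms) with all masses $\le M+1$: $V_{\epsilon,\mathcal{T}}(0)=V_0$ and, recursively, $V_{\epsilon,\mathcal{T}}(t)=\big[\mathrm{id}+(t-t_i)h_\epsilon(\cdot,V_{\epsilon,\mathcal{T}}(t_i))\big]_\#V_{\epsilon,\mathcal{T}}(t_i)$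 for $t\in[t_i,t_{i+1}]$. *)

theory Defs
  imports "HOL-Analysis.Analysis"
begin

text \<open>
  The ambient space is \<open>real^'n\<close>, so \<open>n = CARD('n)\<close>. The dimension \<open>d\<close> of the planes is
  \<open>CARD('d)\<close> for a finite type \<open>'d\<close>, so that the matrices \<open>Y\<close> in the Jacobian are honest
  \<open>n\<close> by \<open>d\<close> matrices of type \<open>real^'d^'n\<close>.
\<close>


section \<open>Differentiability of class C^k\<close>

fun C_k :: "nat \<Rightarrow> ('a::real_normed_vector \<Rightarrow> 'b::real_normed_vector) \<Rightarrow> bool" where
  "C_k 0 f \<longleftrightarrow> continuous_on UNIV f"
| "C_k (Suc k) f \<longleftrightarrow>
     (\<forall>x. f differentiable (at x)) \<and> (\<forall>v. C_k k (\<lambda>x. frechet_derivative f (at x) v))"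

definition C_infinity :: "('a::real_normed_vector \<Rightarrow> 'b::real_normed_vector) \<Rightarrow> bool" where
  "C_infinity f \<longleftrightarrow> (\<forall>k. C_k k f)"

definition C1_diffeo :: "('a::real_normed_vector \<Rightarrow> 'a) \<Rightarrow> bool" where
  "C1_diffeo f \<longleftrightarrow> bij f \<and> C_k 1 f \<and> C_k 1 (inv f)"

definition gradient :: "('a::real_inner \<Rightarrow> real) \<Rightarrow> 'a \<Rightarrow> 'a" where
  "gradient f x = (THE D. GDERIV f x :> D)"


section \<open>The Grassmannian\<close>

definition proj_onto :: "(real^'n) set \<Rightarrow> real^'n^'n" where
  "proj_onto U = matrix (\<lambda>x. THE y. y \<in> U \<and> (\<forall>z\<in>U. orthogonal (x - y) z))"

definition plane :: "real^'n^'n \<Rightarrow> (real^'n) set" where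
  "plane S = range (\<lambda>x. S *v x)"

definition grassmannian :: "'d::finite itself \<Rightarrow> (real^'n^'n) set" where
  "grassmannian _ = proj_onto ` {U. subspace U \<and> dim U = CARD('d)}"

abbreviation plane_bundle :: "'d::finite itself \<Rightarrow> ((real^'n) \<times> (real^'n^'n)) set" where
  "plane_bundle D \<equiv> UNIV \<times> grassmannian D"

text \<open>
  The type class metric on \<open>real^'n^'n\<close> is the Euclidean norm of the entries, and the one on a
  product is the Euclidean combination. They induce the same topology as the following metric,
  but not the same Lipschitz constants.
\<close>

definition bundle_dist ::
    "(real^'n) \<times> (real^'n^'n) \<Rightarrow> (real^'n) \<times> (real^'n^'n) \<Rightarrow> real" where
  "bundle_dist p q = norm (fst p - fst q) + onorm (\<lambda>v. (snd p - snd q) *v v)"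


section \<open>Varifolds\<close>

definition bundle_borel :: "'d::finite itself \<Rightarrow> ((real^'n) \<times> (real^'n^'n)) measure" where
  "bundle_borel D = restrict_space borel (plane_bundle D)"

text \<open>
  The space \<open>\<real>\<^sup>n \<times> G\<close> is locally compact, separable and metrizable, so a Borel measure on it that is
  finite on compact sets is automatically inner and outer regular.
\<close>

definition varifold ::
    "'d::finite itself \<Rightarrow> ((real^'n) \<times> (real^'n^'n)) measure \<Rightarrow> bool" where
  "varifold D V \<longleftrightarrow> sets V = sets (bundle_borel D) \<and>
     (\<forall>K. compact K \<and> K \<subseteq> plane_bundle D \<longrightarrow> emeasure V K < \<infinity>)"

definition mass_measure :: "((real^'n) \<times> (real^'n^'n)) measure \<Rightarrow> (real^'n) measure" where
  "mass_measure V = distr V borel fst"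

definition msupport :: "'a::topological_space measure \<Rightarrow> 'a set" where
  "msupport \<mu> = {x \<in> space \<mu>. \<forall>U. open U \<and> x \<in> U \<longrightarrow> emeasure \<mu> (U \<inter> space \<mu>) > 0}"

definition weak_star_tendsto ::
    "'a::topological_space set \<Rightarrow> (nat \<Rightarrow> 'a measure) \<Rightarrow> 'a measure \<Rightarrow> bool" where
  "weak_star_tendsto X \<mu> \<nu> \<longleftrightarrow>
     (\<forall>\<phi> :: 'a \<Rightarrow> real. continuous_on X \<phi> \<and>
          (\<exists>K. compact K \<and> K \<subseteq> X \<and> (\<forall>x \<in> X - K. \<phi> x = 0)) \<longrightarrow>
        (\<lambda>j. \<integral>x. \<phi> x \<partial>\<mu> j) \<longlonglongrightarrow> (\<integral>x. \<phi> x \<partial>\<nu>))"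

definition bounded_lipschitz_dist ::
    "'a::topological_space set \<Rightarrow> ('a \<Rightarrow> 'a \<Rightarrow> real) \<Rightarrow> 'a measure \<Rightarrow> 'a measure \<Rightarrow> real" where
  "bounded_lipschitz_dist X \<rho> \<mu> \<nu> =
     Sup {\<bar>(\<integral>x. \<phi> x \<partial>\<mu>) - (\<integral>x. \<phi> x \<partial>\<nu>)\<bar> | \<phi> :: 'a \<Rightarrow> real.
       continuous_on X \<phi> \<and> (\<forall>x\<in>X. 0 \<le> \<phi> x \<and> \<phi> x \<le> 1) \<and>
       (\<forall>x\<in>X. \<forall>y\<in>X. \<bar>\<phi> x - \<phi> y\<bar> \<le> \<rho> x y)}"

abbreviation varifold_tendsto ::
    "'d::finite itself \<Rightarrow> (nat \<Rightarrow> ((real^'n) \<times> (real^'n^'n)) measure) \<Rightarrow>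
     ((real^'n) \<times> (real^'n^'n)) measure \<Rightarrow> bool" where
  "varifold_tendsto D \<equiv> weak_star_tendsto (plane_bundle D)"

abbreviation varifold_dist ::
    "'d::finite itself \<Rightarrow> ((real^'n) \<times> (real^'n^'n)) measure \<Rightarrow>
     ((real^'n) \<times> (real^'n^'n)) measure \<Rightarrow> real" where
  "varifold_dist D \<equiv> bounded_lipschitz_dist (plane_bundle D) bundle_dist"


section \<open>Push-forward of a varifold\<close>

definition orthonormal_frame :: "(real^'n) set \<Rightarrow> ('d::finite \<Rightarrow> real^'n) \<Rightarrow> bool" where
  "orthonormal_frame U s \<longleftrightarrow>
     (\<forall>i j. s i \<bullet> s j = (if i = j then 1 else 0)) \<and> span (range s) = U"

text \<open>The value does not depend on the frame chosen by \<open>SOME\<close>.\<close>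

definition tangential_jacobian ::
    "'d::finite itself \<Rightarrow> (real^'n \<Rightarrow> real^'n) \<Rightarrow> real^'n \<Rightarrow> real^'n^'n \<Rightarrow> real" where
  "tangential_jacobian _ f x S =
     (let s = (SOME s :: 'd \<Rightarrow> real^'n. orthonormal_frame (plane S) s);
          Y = (\<chi> k i. frechet_derivative f (at x) (s i) $ k) :: real^'d^'n
      in sqrt (det (transpose Y ** Y)))"

definition image_plane :: "(real^'n \<Rightarrow> real^'n) \<Rightarrow> real^'n \<Rightarrow> real^'n^'n \<Rightarrow> real^'n^'n" where
  "image_plane f x S = proj_onto (frechet_derivative f (at x) ` plane S)"

text \<open>
  The integral of \<open>\<phi>\<close> against this measure is the integral of
  \<open>\<phi> (f x, image_plane f x S) * tangential_jacobian D f x S\<close> against \<open>V\<close>.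
\<close>

definition push_forward ::
    "'d::finite itself \<Rightarrow> (real^'n \<Rightarrow> real^'n) \<Rightarrow>
     ((real^'n) \<times> (real^'n^'n)) measure \<Rightarrow> ((real^'n) \<times> (real^'n^'n)) measure" where
  "push_forward D f V =
     distr (density V (\<lambda>(x, S). ennreal (tangential_jacobian D f x S))) (bundle_borel D)
       (\<lambda>(x, S). (f x, image_plane f x S))"


section \<open>Smoothing kernel and approximate mean curvature\<close>

definition cutoff :: "(real^'n \<Rightarrow> real) \<Rightarrow> bool" where
  "cutoff \<psi> \<longleftrightarrow> C_infinity \<psi> \<and>
     (\<forall>x y. norm x = norm y \<longrightarrow> \<psi> x = \<psi> y) \<and>
     (\<forall>x. 0 \<le> \<psi> x \<and> \<psi> x \<le> 1) \<and>
     (\<forall>x. norm x \<le> 1/2 \<longrightarrow> \<psi> x = 1) \<and>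
     (\<forall>x. norm x \<ge> 1 \<longrightarrow> \<psi> x = 0) \<and>
     (\<forall>x. norm (gradient \<psi> x) \<le> 3)"

definition gaussian :: "real \<Rightarrow> real^'n \<Rightarrow> real" where
  "gaussian \<epsilon> x =
     (2 * pi * \<epsilon>\<^sup>2) powr (- real CARD('n) / 2) * exp (- (norm x)\<^sup>2 / (2 * \<epsilon>\<^sup>2))"

definition kernel_const :: "(real^'n \<Rightarrow> real) \<Rightarrow> real \<Rightarrow> real" where
  "kernel_const \<psi> \<epsilon> = 1 / (\<integral>x. \<psi> x * gaussian \<epsilon> x \<partial>lborel)"

definition kernel :: "(real^'n \<Rightarrow> real) \<Rightarrow> real \<Rightarrow> real^'n \<Rightarrow> real" where
  "kernel \<psi> \<epsilon> x = kernel_const \<psi> \<epsilon> * \<psi> x * gaussian \<epsilon> x"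

definition smoothed_mass ::
    "(real^'n \<Rightarrow> real) \<Rightarrow> real \<Rightarrow> ((real^'n) \<times> (real^'n^'n)) measure \<Rightarrow> real^'n \<Rightarrow> real" where
  "smoothed_mass \<psi> \<epsilon> V y = (\<integral>x. kernel \<psi> \<epsilon> (x - y) \<partial>mass_measure V)"

definition smoothed_first_variation ::
    "(real^'n \<Rightarrow> real) \<Rightarrow> real \<Rightarrow> ((real^'n) \<times> (real^'n^'n)) measure \<Rightarrow> real^'n \<Rightarrow> real^'n" where
  "smoothed_first_variation \<psi> \<epsilon> V y =
     (\<integral>p. snd p *v gradient (kernel \<psi> \<epsilon>) (fst p - y) \<partial>V)"

definition pre_mean_curvature ::
    "(real^'n \<Rightarrow> real) \<Rightarrow> real \<Rightarrow> ((real^'n) \<times> (real^'n^'n)) measure \<Rightarrow> real^'n \<Rightarrow> real^'n" where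
  "pre_mean_curvature \<psi> \<epsilon> V y =
     - (smoothed_first_variation \<psi> \<epsilon> V y /\<^sub>R (smoothed_mass \<psi> \<epsilon> V y + \<epsilon>))"

definition approx_mean_curvature ::
    "(real^'n \<Rightarrow> real) \<Rightarrow> real \<Rightarrow> ((real^'n) \<times> (real^'n^'n)) measure \<Rightarrow> real^'n \<Rightarrow> real^'n" where
  "approx_mean_curvature \<psi> \<epsilon> V x =
     (\<integral>y. kernel \<psi> \<epsilon> (x - y) *\<^sub>R pre_mean_curvature \<psi> \<epsilon> V y \<partial>lborel)"


section \<open>Time-discrete approximate mean curvature flow\<close>

text \<open>A subdivision \<open>0 = t\<^sub>0 < \<dots> < t\<^sub>m = 1\<close> is the list of its points; \<open>m\<close> is its length minus one.\<close>

definition subdivision :: "real list \<Rightarrow> bool" where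
  "subdivision ts \<longleftrightarrow> ts \<noteq> [] \<and> sorted_wrt (<) ts \<and> hd ts = 0 \<and> last ts = 1"

definition mesh :: "real list \<Rightarrow> real" where
  "mesh ts = Max {ts ! Suc i - ts ! i | i. Suc i < length ts}"

definition dyadic_subdivision :: "nat \<Rightarrow> real list" where
  "dyadic_subdivision j = map (\<lambda>k. real k / 2 ^ j) [0..<2 ^ j + 1]"

definition step_map ::
    "(real^'n \<Rightarrow> real) \<Rightarrow> real \<Rightarrow> real \<Rightarrow> ((real^'n) \<times> (real^'n^'n)) measure \<Rightarrow>
     real^'n \<Rightarrow> real^'n" where
  "step_map \<psi> \<epsilon> \<tau> V x = x + \<tau> *\<^sub>R approx_mean_curvature \<psi> \<epsilon> V x"

fun discrete_flow_at ::
    "'d::finite itself \<Rightarrow> (real^'n \<Rightarrow> real) \<Rightarrow> real \<Rightarrow> real list \<Rightarrow>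
     ((real^'n) \<times> (real^'n^'n)) measure \<Rightarrow> nat \<Rightarrow> ((real^'n) \<times> (real^'n^'n)) measure" where
  "discrete_flow_at D \<psi> \<epsilon> ts V0 0 = V0"
| "discrete_flow_at D \<psi> \<epsilon> ts V0 (Suc i) =
     (let V = discrete_flow_at D \<psi> \<epsilon> ts V0 i
      in push_forward D (step_map \<psi> \<epsilon> (ts ! Suc i - ts ! i) V) V)"

text \<open>
  For \<open>t > 0\<close> the index \<open>i\<close> is the one with \<open>t\<^sub>i < t \<le> t\<^sub>i\<^sub>+\<^sub>1\<close>. The recursion of the flow on the closed
  interval \<open>[t\<^sub>i, t\<^sub>i\<^sub>+\<^sub>1]\<close> adds only the push-forward by the identity at its left end point. The
  definition is total; it describes the flow when the maps involved are diffeomorphisms.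
\<close>

definition discrete_flow ::
    "'d::finite itself \<Rightarrow> (real^'n \<Rightarrow> real) \<Rightarrow> real \<Rightarrow> real list \<Rightarrow>
     ((real^'n) \<times> (real^'n^'n)) measure \<Rightarrow> real \<Rightarrow> ((real^'n) \<times> (real^'n^'n)) measure" where
  "discrete_flow D \<psi> \<epsilon> ts V0 t =
     (if t \<le> 0 then V0
      else let i = (LEAST i. t \<le> ts ! Suc i); V = discrete_flow_at D \<psi> \<epsilon> ts V0 i
           in push_forward D (step_map \<psi> \<epsilon> (t - ts ! i) V) V)"

text \<open>The defining property of the constant \<open>c\<^sub>3\<close>.\<close>

definition flow_constant :: "'d::finite itself \<Rightarrow> (real^'n \<Rightarrow> real) \<Rightarrow> real \<Rightarrow> bool" where
  "flow_constant D \<psi> c \<longleftrightarrow> 0 < c \<and>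
     (\<forall>\<epsilon> M V0 ts. 0 < \<epsilon> \<and> \<epsilon> < 1 \<and> 1 \<le> M \<and> varifold D V0 \<and>
        emeasure (mass_measure V0) UNIV \<le> ennreal M \<and>
        subdivision ts \<and> c * mesh ts \<le> \<epsilon> ^ 8 / (M + 1) ^ 3 \<longrightarrow>
        (\<forall>i t. Suc i < length ts \<and> ts ! i \<le> t \<and> t \<le> ts ! Suc i \<longrightarrow>
           C1_diffeo (step_map \<psi> \<epsilon> (t - ts ! i) (discrete_flow D \<psi> \<epsilon> ts V0 (ts ! i)))) \<and>
        (\<forall>t. 0 \<le> t \<and> t \<le> 1 \<longrightarrow>
           emeasure (mass_measure (discrete_flow D \<psi> \<epsilon> ts V0 t)) UNIV \<le> ennreal (M + 1)))"

end

theory Submission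
  imports Defs
begin

text \<open>
  Composing the steps of the time-discrete flow writes \<open>V\<^sub>\<T>(t)\<close> as the push-forward of \<open>V\<^sub>0\<close> under one
  map \<open>F\<close>; it depends only on \<open>u = (F, DF)\<close>. In this variable the scheme is the explicit Euler scheme
  \<open>u \<mapsto> u + \<tau> H u\<close> with \<open>H u = (h\<^sub>\<epsilon> \<circ> F, Dh\<^sub>\<epsilon>(F) \<circ> DF)\<close>, where \<open>h\<^sub>\<epsilon>\<close> is the approximate mean curvature of
  the push-forward of \<open>V\<^sub>0\<close> by \<open>u\<close>. Since \<open>h\<^sub>\<epsilon>\<close> is a convolution with a smooth kernel, \<open>H\<close> is bounded and
  Lipschitz for the uniform norm as long as masses and \<open>DF\<^sup>\<plusminus>\<^sup>1\<close> stay bounded, so by Gronwall the Euler polygons of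
  any two subdivisions differ by a multiple of the sum of their mesh sizes. They converge
  uniformly to some \<open>u(t)\<close>, and the limit varifold is the push-forward of \<open>V\<^sub>0\<close> by \<open>u(t)\<close>; no
  compactness theorem for measures is needed.
\<close>

text \<open>The transported varifold sees a map F only together with DF, through image planes and
  Jacobians, and a uniform estimate for F - F' says nothing about DF - DF'. This is why DF is
  carried as an unknown of its own; its equation closes because the derivative of the mean curvature
  is again a convolution. The constants have to be fixed in one order. The defining property of
  \<open>c3\<close> gives the mass bound M + 1; from it comes a bound L for the mean curvature and
  its derivative; from L comes R = exp (2 L), which controls DF and its inverse for every
  subdivision of small mesh; R and M + 1 together give the Lipschitz constant of the velocity.
  Deriving the mass bound from R would be circular. Nothing shows that an arbitrary Euler step
  preserves these bounds, so the abstract Euler argument asks for them only at the nodes of the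
  polygons actually compared. Uniqueness of the limit is a separate matter: compactly supported test
  functions determine a varifold, which is proved here using that the space of planes is
  closed.\<close>

type_synonym 'n deformation = "real^'n \<Rightarrow> (real^'n) \<times> ((real^'n) \<Rightarrow>\<^sub>L (real^'n))"

abbreviation total_mass :: "'a measure \<Rightarrow> ennreal" where
  "total_mass V \<equiv> emeasure V (space V)"

section \<open>Planes and projections\<close>

lemma orthogonal_projection_ex1:
  fixes U :: "'a::euclidean_space set"
  assumes "subspace U"
  shows "\<exists>!y. y \<in> U \<and> (\<forall>z\<in>U. orthogonal (x - y) z)"
proof -
  obtain y z where y: "y \<in> span U" and z: "\<And>w. w \<in> span U \<Longrightarrow> orthogonal z w" and x: "x = y + z"
    using orthogonal_subspace_decomp_exists[of U x] by blast
  have U: "span U = U" using assms by (simp add: span_eq_iff)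
  show ?thesis
  proof (rule ex1I[of _ y])
    show "y \<in> U \<and> (\<forall>z\<in>U. orthogonal (x - y) z)" using y z x U by auto
    fix y' assume y': "y' \<in> U \<and> (\<forall>z\<in>U. orthogonal (x - y') z)"
    have d: "y' - y \<in> U" using y' y U assms by (auto intro: subspace_diff)
    have "orthogonal (x - y') (y' - y)" "orthogonal (x - y) (y' - y)"
      using y' z d U x by auto
    then have "(y' - y) \<bullet> (y' - y) = 0"
      by (simp add: orthogonal_def inner_diff_left)
    then show "y' = y" by simp
  qed
qed

text \<open>\<open>matrix\<close> reproduces a map only when the map is linear, so the pointwise
  \<open>THE\<close> in \<open>proj_onto\<close> must be shown linear before
  \<open>proj_onto U *v x\<close> can be read as the orthogonal projection. Linearity comes from
  uniqueness of the orthogonal decomposition.\<close>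

lemma proj_onto_properties:
  fixes U :: "(real^'n) set"
  assumes U: "subspace U"
  shows proj_onto_in: "proj_onto U *v x \<in> U"
    and proj_onto_orth: "z \<in> U \<Longrightarrow> (x - proj_onto U *v x) \<bullet> z = 0"
proof -
  define p where "p = (\<lambda>x. THE y. y \<in> U \<and> (\<forall>z\<in>U. orthogonal (x - y) z))"
  have p: "p x \<in> U \<and> (\<forall>z\<in>U. orthogonal (x - p x) z)" for x
    unfolding p_def by (rule theI'[OF orthogonal_projection_ex1[OF U]])
  have peq: "y = p x" if "y \<in> U" "\<And>z. z \<in> U \<Longrightarrow> orthogonal (x - y) z" for x y
    using orthogonal_projection_ex1[OF U] p that by blast
  have "linear p"
  proof (rule linearI)
    fix a b :: "real^'n" and r :: real
    show "p (a + b) = p a + p b"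
    proof (rule peq[symmetric])
      show "p a + p b \<in> U" using p U by (simp add: subspace_add)
      show "orthogonal (a + b - (p a + p b)) z" if "z \<in> U" for z
        using p[of a] p[of b] that by (simp add: orthogonal_def inner_diff_left inner_add_left)
    qed
    show "p (r *\<^sub>R a) = r *\<^sub>R p a"
    proof (rule peq[symmetric])
      show "r *\<^sub>R p a \<in> U" using p U by (simp add: subspace_scale)
      show "orthogonal (r *\<^sub>R a - r *\<^sub>R p a) z" if "z \<in> U" for z
        using p[of a] that by (simp add: orthogonal_def inner_diff_left)
    qed
  qed
  then have "proj_onto U *v x = p x" for x
    unfolding proj_onto_def p_def[symmetric] by (simp add: matrix_vector_mul(1))
  then show "proj_onto U *v x \<in> U" "z \<in> U \<Longrightarrow> (x - proj_onto U *v x) \<bullet> z = 0"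
    using p by (auto simp: orthogonal_def)
qed

lemma proj_onto_unique:
  fixes U :: "(real^'n) set"
  assumes "subspace U" "y \<in> U" "\<And>z. z \<in> U \<Longrightarrow> (x - y) \<bullet> z = 0"
  shows "proj_onto U *v x = y"
  using orthogonal_projection_ex1[OF assms(1), of x] assms proj_onto_properties[OF assms(1)]
  unfolding orthogonal_def by blast

lemma proj_onto_ident: "subspace U \<Longrightarrow> x \<in> U \<Longrightarrow> proj_onto U *v x = x"
  by (rule proj_onto_unique) auto

lemma plane_proj_onto:
  assumes "subspace U"
  shows "plane (proj_onto U) = U"
proof
  show "plane (proj_onto U) \<subseteq> U"
    unfolding plane_def using proj_onto_in[OF assms] by blast
  show "U \<subseteq> plane (proj_onto U)"
    unfolding plane_def using proj_onto_ident[OF assms] by (metis rangeI subsetI)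
qed

lemma grassmannianD:
  assumes "S \<in> grassmannian TYPE('d::finite)"
  shows "subspace (plane S)" "dim (plane S) = CARD('d)" "proj_onto (plane S) = S"
proof -
  obtain U where "subspace U" "dim U = CARD('d)" "S = proj_onto U"
    using assms unfolding grassmannian_def by blast
  then show "subspace (plane S)" "dim (plane S) = CARD('d)" "proj_onto (plane S) = S"
    by (simp_all add: plane_proj_onto)
qed

lemma norm_proj_onto_le:
  fixes U :: "(real^'n) set"
  assumes U: "subspace U"
  shows "norm (proj_onto U *v x) \<le> norm x"
proof -
  let ?p = "proj_onto U *v x"
  have "?p \<bullet> ?p = x \<bullet> ?p"
    using proj_onto_orth[OF U proj_onto_in[OF U], of x x] by (simp add: inner_diff_left)
  then have "norm ?p * norm ?p \<le> norm x * norm ?p"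
    using norm_cauchy_schwarz[of x ?p] by (simp add: power2_norm_eq_inner[symmetric] power2_eq_square)
  then show ?thesis
    by (cases "norm ?p = 0") (auto simp: mult_le_cancel_right)
qed

lemma proj_onto_closest:
  fixes U :: "(real^'n) set"
  assumes U: "subspace U" and v: "v \<in> U"
  shows "norm (x - proj_onto U *v x) \<le> norm (x - v)"
proof -
  let ?p = "proj_onto U *v x"
  have "?p - v \<in> U" using U v proj_onto_in[OF U] by (simp add: subspace_diff)
  then have "orthogonal (x - ?p) (?p - v)"
    using proj_onto_orth[OF U] by (simp add: orthogonal_def)
  then have "(norm ((x - ?p) + (?p - v)))\<^sup>2 = (norm (x - ?p))\<^sup>2 + (norm (?p - v))\<^sup>2"
    by (rule norm_add_Pythagorean)
  then have "(norm (x - ?p))\<^sup>2 \<le> (norm (x - v))\<^sup>2" by simp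
  then show ?thesis by (rule power2_le_imp_le) simp
qed

text \<open>The gap estimate: \<open>P - P' = (P - P' P) - P' (1 - P)\<close>, and the last term is the adjoint of
  \<open>(1 - P) P'\<close>.\<close>

lemma proj_onto_diff_le:
  fixes U U' :: "(real^'n) set"
  assumes U: "subspace U" and U': "subspace U'" and "0 \<le> \<delta>"
    and 1: "\<And>v. v \<in> U \<Longrightarrow> \<exists>v'\<in>U'. norm (v - v') \<le> \<delta> * norm v"
    and 2: "\<And>v. v \<in> U' \<Longrightarrow> \<exists>v'\<in>U. norm (v - v') \<le> \<delta> * norm v"
  shows "norm ((proj_onto U - proj_onto U') *v x) \<le> 2 * \<delta> * norm x"
proof -
  let ?P = "\<lambda>x. proj_onto U *v x" and ?Q = "\<lambda>x. proj_onto U' *v x"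
  have a: "norm (?P x - ?Q (?P x)) \<le> \<delta> * norm x"
  proof -
    obtain v' where "v' \<in> U'" "norm (?P x - v') \<le> \<delta> * norm (?P x)"
      using 1[OF proj_onto_in[OF U]] by blast
    then have "norm (?P x - ?Q (?P x)) \<le> \<delta> * norm (?P x)"
      using proj_onto_closest[OF U'] order_trans by blast
    also have "\<dots> \<le> \<delta> * norm x"
      using norm_proj_onto_le[OF U] \<open>0 \<le> \<delta>\<close> by (simp add: mult_left_mono)
    finally show ?thesis .
  qed
  define z where "z = x - ?P x"
  have z: "z \<bullet> v = 0" if "v \<in> U" for v
    unfolding z_def using proj_onto_orth[OF U that] .
  have "norm z \<le> norm x"
    using proj_onto_closest[OF U subspace_0[OF U], of x] by (simp add: z_def)
  have b: "norm (?Q z) \<le> \<delta> * norm z"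
  proof -
    obtain v' where "v' \<in> U" "norm (?Q z - v') \<le> \<delta> * norm (?Q z)"
      using 2[OF proj_onto_in[OF U']] by blast
    then have n: "norm (?Q z - ?P (?Q z)) \<le> \<delta> * norm (?Q z)"
      using proj_onto_closest[OF U] order_trans by blast
    \<comment> \<open>The adjoint in concrete form: \<open>z\<close> is orthogonal to
      \<open>U\<close>, so it only sees the part of \<open>?Q z\<close> off \<open>U\<close>, and
      that part is small by hypothesis 2.\<close>
    have "?Q z \<bullet> ?Q z = z \<bullet> ?Q z"
      using proj_onto_orth[OF U' proj_onto_in[OF U'], of z z] by (simp add: inner_diff_left)
    also have "\<dots> = z \<bullet> (?Q z - ?P (?Q z))"
      using z[OF proj_onto_in[OF U]] by (simp add: inner_diff_right)
    also have "\<dots> \<le> norm z * (\<delta> * norm (?Q z))"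
      using norm_cauchy_schwarz[of z "?Q z - ?P (?Q z)"] n
      by (meson mult_left_mono norm_ge_zero order_trans)
    finally have "norm (?Q z) * norm (?Q z) \<le> (\<delta> * norm z) * norm (?Q z)"
      by (simp add: dot_square_norm power2_eq_square mult_ac)
    then show ?thesis using \<open>0 \<le> \<delta>\<close>
      by (cases "norm (?Q z) = 0") (auto simp: mult_le_cancel_right)
  qed
  have eq: "(proj_onto U - proj_onto U') *v x = (?P x - ?Q (?P x)) - ?Q z"
    unfolding z_def by (simp add: matrix_vector_mult_diff_rdistrib matrix_vector_mult_diff_distrib)
  have "norm ((proj_onto U - proj_onto U') *v x) \<le> \<delta> * norm x + \<delta> * norm z"
    unfolding eq using a b norm_triangle_ineq4[of "?P x - ?Q (?P x)" "?Q z"] by linarith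
  also have "\<dots> \<le> \<delta> * norm x + \<delta> * norm x"
    using \<open>norm z \<le> norm x\<close> \<open>0 \<le> \<delta>\<close> by (simp add: mult_left_mono)
  finally show ?thesis by simp
qed

text \<open>The gap estimate bounds operators, while the type class norm of a matrix is the
  Euclidean norm of its entries. Testing on axis vectors bounds every entry by \<open>c\<close>; the
  factor is the number of entries, crude but sufficient.\<close>

lemma norm_matrix_le:
  fixes M :: "real^'n^'m"
  assumes "\<And>v. norm (M *v v) \<le> c * norm v"
  shows "norm M \<le> (real CARD('m) * real CARD('n)) * c"
proof -
  have e: "\<bar>M $ i $ j\<bar> \<le> c" for i j
  proof -
    have "\<bar>M $ i $ j\<bar> = \<bar>(M *v axis j 1) $ i\<bar>"
      by (simp add: matrix_vector_mult_basis column_def)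
    also have "\<dots> \<le> norm (M *v axis j 1)" by (rule component_le_norm_cart)
    also have "\<dots> \<le> c" using assms[of "axis j 1"] by simp
    finally show ?thesis .
  qed
  have "norm (M $ i) \<le> real CARD('n) * c" for i
  proof -
    have "norm (M $ i) \<le> (\<Sum>j\<in>UNIV. \<bar>M $ i $ j\<bar>)" by (rule norm_le_l1_cart)
    also have "\<dots> \<le> (\<Sum>j\<in>(UNIV::'n set). c)" by (intro sum_mono e)
    finally show ?thesis by simp
  qed
  moreover have "norm M \<le> (\<Sum>i\<in>UNIV. norm (M $ i))"
    unfolding norm_vec_def by (rule L2_set_le_sum) auto
  ultimately have "norm M \<le> (\<Sum>i\<in>(UNIV::'m set). real CARD('n) * c)"
    by (meson sum_mono order_trans)
  then show ?thesis by (simp add: mult_ac)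
qed

lemma norm_matrix_vector_mult_le:
  fixes M :: "real^'n^'m"
  shows "norm (M *v v) \<le> norm M * norm v"
proof -
  have "norm ((M *v v) $ i) \<le> norm (M $ i) * norm v" for i
    by (simp add: matrix_vector_mul_component Cauchy_Schwarz_ineq2)
  then have "norm (M *v v) \<le> L2_set (\<lambda>i. norm (M $ i) * norm v) UNIV"
    unfolding norm_vec_def[of "M *v v"] by (intro L2_set_mono) auto
  then show ?thesis
    by (simp add: norm_vec_def[of M] L2_set_left_distrib)
qed

section \<open>Linear images of planes\<close>

lemma linear_blinfun: "linear (blinfun_apply A)"
  by (rule bounded_linear.linear[OF blinfun.bounded_linear_right])

text \<open>The condition \<open>bilipschitz R A\<close> keeps the Jacobians and the image planes of all the deformations
  in one compact range of parameters.\<close>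

definition bilipschitz :: "real \<Rightarrow> ('a::real_normed_vector \<Rightarrow>\<^sub>L 'b::real_normed_vector) \<Rightarrow> bool" where
  "bilipschitz R A \<longleftrightarrow> norm A \<le> R \<and> (\<forall>v. norm v \<le> R * norm (blinfun_apply A v))"

definition image_proj :: "((real^'n) \<Rightarrow>\<^sub>L (real^'n)) \<Rightarrow> real^'n^'n \<Rightarrow> real^'n^'n" where
  "image_proj A S = proj_onto (blinfun_apply A ` plane S)"

lemma bilipschitz_nonneg: "bilipschitz R A \<Longrightarrow> 0 \<le> R"
  unfolding bilipschitz_def using norm_ge_zero order_trans by blast

lemma bilipschitz_inj:
  fixes A :: "'a::euclidean_space \<Rightarrow>\<^sub>L 'b::euclidean_space"
  shows "bilipschitz R A \<Longrightarrow> inj (blinfun_apply A)"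
proof -
  assume "bilipschitz R A"
  then have "norm v \<le> R * norm (blinfun_apply A v)" for v by (simp add: bilipschitz_def)
  then have "v = 0" if "blinfun_apply A v = 0" for v
    using that by (metis mult_zero_right norm_le_zero_iff norm_zero)
  then show ?thesis by (simp add: linear_injective_0 linear_blinfun)
qed

lemma norm_blinfun_le: "norm A \<le> R \<Longrightarrow> norm (blinfun_apply A v) \<le> R * norm v"
  by (meson mult_right_mono norm_blinfun norm_ge_zero order_trans)

lemma subspace_image_blinfun: "subspace U \<Longrightarrow> subspace (blinfun_apply A ` U)"
  by (simp add: linear_blinfun linear_subspace_image)

lemma plane_image_proj:
  "S \<in> grassmannian TYPE('d::finite) \<Longrightarrow> plane (image_proj A S) = blinfun_apply A ` plane S"
  unfolding image_proj_def by (rule plane_proj_onto[OF subspace_image_blinfun[OF grassmannianD(1)]])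

lemma image_proj_in_grassmannian:
  assumes "S \<in> grassmannian TYPE('d::finite)" "inj (blinfun_apply A)"
  shows "image_proj A S \<in> grassmannian TYPE('d)"
proof -
  have "dim (blinfun_apply A ` plane S) = dim (plane S)"
    using assms(2) by (intro dim_image_eq) (auto simp: linear_blinfun inj_on_def)
  then show ?thesis
    unfolding grassmannian_def image_proj_def
    by (intro imageI) (simp add: grassmannianD[OF assms(1)] subspace_image_blinfun)
qed

lemma image_proj_compose:
  assumes "S \<in> grassmannian TYPE('d::finite)"
  shows "image_proj B (image_proj A S) = image_proj (B o\<^sub>L A) S"
  unfolding image_proj_def[of B] plane_image_proj[OF assms] image_proj_def[of "B o\<^sub>L A"]
  by (simp add: image_image)

lemma image_proj_id:
  "S \<in> grassmannian TYPE('d::finite) \<Longrightarrow> image_proj id_blinfun S = S"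
  by (simp add: image_proj_def grassmannianD)

lemma norm_proj_vec_le:
  assumes "S \<in> grassmannian TYPE('d::finite)"
  shows "norm (S *v v) \<le> norm v"
  using norm_proj_onto_le[OF grassmannianD(1)[OF assms], of v] by (simp only: grassmannianD(3)[OF assms])

lemma proj_vec_in: "S *v v \<in> plane S"
  by (simp add: plane_def)

lemma proj_vec_ident:
  assumes "S \<in> grassmannian TYPE('d::finite)" "v \<in> plane S"
  shows "S *v v = v"
  using proj_onto_ident[OF grassmannianD(1)[OF assms(1)] assms(2)]
  by (simp only: grassmannianD(3)[OF assms(1)])

text \<open>A vector \<open>A s\<close> of the first image plane is compared with
  \<open>A' (S' s)\<close> in the second. Since the length of \<open>s\<close> is at most
  \<open>R\<close> times that of \<open>A s\<close>, the one-sided gap is at most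
  \<open>R * norm (A - A') + R\<^sup>2 * norm (S - S')\<close>. The situation is symmetric, so
  \<open>proj_onto_diff_le\<close> applies and gives the factor 2; the squared dimension comes from
  \<open>norm_matrix_le\<close>.\<close>

lemma image_proj_dist_le:
  fixes A A' :: "(real^'n) \<Rightarrow>\<^sub>L (real^'n)"
  assumes A: "bilipschitz R A" "bilipschitz R A'"
    and S: "S \<in> grassmannian TYPE('d::finite)" "S' \<in> grassmannian TYPE('d)"
  shows "norm (image_proj A S - image_proj A' S') \<le>
    (real CARD('n))\<^sup>2 * (2 * (R * norm (A - A') + R\<^sup>2 * norm (S - S')))"
proof -
  have R: "0 \<le> R" using bilipschitz_nonneg[OF A(1)] .
  define \<delta> where "\<delta> = R * norm (A - A') + R\<^sup>2 * norm (S - S')"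
  have d0: "0 \<le> \<delta>" using R by (simp add: \<delta>_def)
  have key: "\<exists>v'\<in>blinfun_apply A' ` plane S'. norm (v - v') \<le> \<delta> * norm v"
    if v: "v \<in> blinfun_apply A ` plane S" and A: "bilipschitz R A" "bilipschitz R A'"
      and S: "S \<in> grassmannian TYPE('d)" "S' \<in> grassmannian TYPE('d)"
      and \<delta>: "\<delta> = R * norm (A - A') + R\<^sup>2 * norm (S - S')"
    for v and A A' :: "(real^'n) \<Rightarrow>\<^sub>L (real^'n)" and S S'
  proof -
    obtain s where s: "s \<in> plane S" "v = blinfun_apply A s" using v by blast
    have ns: "norm s \<le> R * norm v" using A(1) s by (simp add: bilipschitz_def)
    let ?v' = "blinfun_apply A' (S' *v s)"
    have e: "v - ?v' = blinfun_apply (A - A') s + blinfun_apply A' ((S - S') *v s)"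
      using proj_vec_ident[OF S(1) s(1)] s(2)
      by (simp add: blinfun.diff_left blinfun.diff_right matrix_vector_mult_diff_rdistrib)
    have "norm (v - ?v') \<le> norm (A - A') * norm s + R * (norm (S - S') * norm s)"
      unfolding e
    proof (rule norm_triangle_le[OF add_mono])
      show "norm (blinfun_apply (A - A') s) \<le> norm (A - A') * norm s" by (rule norm_blinfun)
      have "norm (blinfun_apply A' ((S - S') *v s)) \<le> R * norm ((S - S') *v s)"
        using A(2) by (intro norm_blinfun_le) (simp add: bilipschitz_def)
      also have "\<dots> \<le> R * (norm (S - S') * norm s)"
        using R norm_matrix_vector_mult_le by (intro mult_left_mono) auto
      finally show "norm (blinfun_apply A' ((S - S') *v s)) \<le> R * (norm (S - S') * norm s)" .
    qed
    also have "\<dots> = (norm (A - A') + R * norm (S - S')) * norm s" by (simp add: algebra_simps)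
    also have "\<dots> \<le> (norm (A - A') + R * norm (S - S')) * (R * norm v)"
      using ns R by (intro mult_left_mono) auto
    also have "\<dots> = \<delta> * norm v" by (simp add: \<delta> algebra_simps power2_eq_square)
    finally show ?thesis using proj_vec_in[of S' s] by blast
  qed
  have "norm ((image_proj A S - image_proj A' S') *v x) \<le> 2 * \<delta> * norm x" for x
    unfolding image_proj_def
  proof (rule proj_onto_diff_le)
    show "subspace (blinfun_apply A ` plane S)" "subspace (blinfun_apply A' ` plane S')"
      using S by (simp_all add: subspace_image_blinfun grassmannianD(1))
    show "\<exists>v'\<in>blinfun_apply A' ` plane S'. norm (v - v') \<le> \<delta> * norm v"
      if "v \<in> blinfun_apply A ` plane S" for v
      using key[OF that A S] by (simp add: \<delta>_def)
    show "\<exists>v'\<in>blinfun_apply A ` plane S. norm (v - v') \<le> \<delta> * norm v"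
      if "v \<in> blinfun_apply A' ` plane S'" for v
      using key[OF that A(2,1) S(2,1)] by (simp add: \<delta>_def norm_minus_commute)
  qed (rule d0)
  from norm_matrix_le[OF this] show ?thesis
    by (simp add: \<delta>_def power2_eq_square mult_ac)
qed

section \<open>The Jacobian of a linear map on a plane\<close>

definition gram :: "('d::finite \<Rightarrow> 'a::real_inner) \<Rightarrow> real^'d^'d" where
  "gram w = (\<chi> i j. w i \<bullet> w j)"

text \<open>The frame is picked by the same \<open>SOME\<close> expression as in
  \<open>tangential_jacobian\<close>, so the two functions agree by unfolding; frame independence is
  recovered in \<open>lin_jac_frame\<close>.\<close>

definition lin_jac :: "'d::finite itself \<Rightarrow> ((real^'n) \<Rightarrow>\<^sub>L (real^'n)) \<Rightarrow> real^'n^'n \<Rightarrow> real" where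
  "lin_jac _ A S = sqrt (det (gram
     (\<lambda>i. blinfun_apply A ((SOME s :: 'd \<Rightarrow> real^'n. orthonormal_frame (plane S) s) i))))"

lemma orthonormal_frame_exists:
  assumes "subspace U" "dim U = CARD('d::finite)"
  shows "\<exists>s :: 'd \<Rightarrow> real^'n. orthonormal_frame U s"
proof -
  obtain B where B: "pairwise orthogonal B" "\<And>x. x \<in> B \<Longrightarrow> norm x = 1"
      "independent B" "card B = dim U" "span B = U"
    using orthonormal_basis_subspace[OF assms(1)] by metis
  have "finite B" using B(3) by (simp add: independent_imp_finite)
  then obtain s where s: "bij_betw s (UNIV :: 'd set) B"
    using finite_same_card_bij[of "UNIV :: 'd set" B] B(4) assms(2) by auto
  have "s i \<bullet> s j = (if i = j then 1 else 0)" for i j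
  proof (cases "i = j")
    case True
    then show ?thesis using B(2)[of "s i"] bij_betwE[OF s] by (simp add: dot_square_norm)
  next
    case False
    then have "s i \<noteq> s j" using s by (auto simp: bij_betw_def inj_on_def)
    then show ?thesis using B(1) bij_betwE[OF s] False by (auto simp: pairwise_def orthogonal_def)
  qed
  moreover have "range s = B" using s by (simp add: bij_betw_def)
  ultimately show ?thesis using B(5) unfolding orthonormal_frame_def by blast
qed

lemma orthonormal_frame_expand:
  fixes s :: "'d::finite \<Rightarrow> real^'n"
  assumes "orthonormal_frame U s" "x \<in> U"
  shows "x = (\<Sum>i\<in>UNIV. (x \<bullet> s i) *\<^sub>R s i)"
proof (rule vector_eq_dot_span[of _ "range s"])
  show "x \<in> span (range s)" using assms by (simp add: orthonormal_frame_def)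
  show "(\<Sum>i\<in>UNIV. (x \<bullet> s i) *\<^sub>R s i) \<in> span (range s)"
    by (intro span_sum span_scale span_base) auto
  fix v assume "v \<in> range s"
  then obtain j where "v = s j" by blast
  moreover have orth: "s i \<bullet> s j = (if i = j then 1 else 0)" for i
    using assms(1) by (simp add: orthonormal_frame_def)
  have "(\<Sum>i\<in>UNIV. (x \<bullet> s i) *\<^sub>R s i) \<bullet> s j = x \<bullet> s j"
    unfolding inner_sum_left inner_scaleR_left orth by (simp add: if_distrib cong: if_cong)
  ultimately show "v \<bullet> x = v \<bullet> (\<Sum>i\<in>UNIV. (x \<bullet> s i) *\<^sub>R s i)"
    by (simp add: inner_commute)
qed

lemma orthonormal_frame_in:
  "orthonormal_frame U s \<Longrightarrow> s i \<in> U"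
  unfolding orthonormal_frame_def using span_base[of "s i" "range s"] by auto

lemma gram_orthonormal_frame: "orthonormal_frame U s \<Longrightarrow> gram s = mat 1"
  by (simp add: gram_def mat_def orthonormal_frame_def vec_eq_iff)

lemma norm_orthonormal_frame: "orthonormal_frame U s \<Longrightarrow> norm (s i) = 1"
  by (simp add: norm_eq_1 orthonormal_frame_def)

lemma gram_linear_combination:
  fixes s :: "'d::finite \<Rightarrow> 'a::real_inner" and R :: "real^'d^'d"
  assumes "\<And>i. w i = (\<Sum>k\<in>UNIV. R $ i $ k *\<^sub>R s k)"
  shows "gram w = R ** gram s ** transpose R"
proof -
  have "(\<Sum>k\<in>UNIV. R $ i $ k *\<^sub>R s k) \<bullet> (\<Sum>k\<in>UNIV. R $ j $ k *\<^sub>R s k)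
      = (\<Sum>l\<in>UNIV. (\<Sum>k\<in>UNIV. R $ i $ k * (s k \<bullet> s l)) * R $ j $ l)" for i j
    by (subst inner_sum_right) (simp add: inner_sum_left mult.commute)
  then show ?thesis
    by (simp add: gram_def matrix_matrix_mult_def transpose_def vec_eq_iff assms)
qed

text \<open>The segment \<open>N\<close> joins the identity to the Gram matrix. Before its end point
  it consists of positive definite, hence invertible, matrices, so the determinant keeps the sign it
  has at the identity, and continuity leaves only a nonnegative value at the end.\<close>

lemma det_gram_nonneg:
  fixes w :: "'d::finite \<Rightarrow> 'a::real_inner"
  shows "0 \<le> det (gram w)"
proof -
  define N where "N = (\<lambda>t::real. (1 - t) *\<^sub>R (mat 1 :: real^'d^'d) + t *\<^sub>R gram w)"
  have pos: "v \<bullet> (N t *v v) = (1 - t) * (v \<bullet> v) + t * (norm (\<Sum>i\<in>UNIV. v $ i *\<^sub>R w i))\<^sup>2" for t v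
  proof -
    have "N t *v v = (1 - t) *\<^sub>R v + t *\<^sub>R (gram w *v v)"
      by (simp add: N_def matrix_vector_mult_add_rdistrib scaleR_matrix_vector_assoc[symmetric])
    moreover have "v \<bullet> (gram w *v v) = (norm (\<Sum>i\<in>UNIV. v $ i *\<^sub>R w i))\<^sup>2"
      by (simp add: power2_norm_eq_inner inner_vec_def gram_def matrix_vector_mult_def inner_sum_left
          inner_sum_right sum_distrib_left mult_ac inner_commute)
    ultimately show ?thesis by (simp add: inner_add_right)
  qed
  have nz: "det (N t) \<noteq> 0" if t: "0 \<le> t" "t < 1" for t
  proof -
    have "v = 0" if "N t *v v = 0" for v
    proof -
      have "(1 - t) * (v \<bullet> v) \<le> 0"
        using pos[of v t] that t by (smt (verit) inner_zero_right zero_le_power2 mult_nonneg_nonneg)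
      then have "v \<bullet> v \<le> 0" using t by (simp add: mult_le_0_iff)
      then show "v = 0" using inner_gt_zero_iff[of v] by linarith
    qed
    then show ?thesis
      by (metis invertible_det_nz invertible_left_inverse matrix_left_invertible_ker)
  qed
  have cont: "continuous_on A (\<lambda>t. det (N t))" for A
    unfolding det_def N_def by (simp, intro continuous_intros)
  have N0: "N 0 = mat 1" and N1: "N 1 = gram w" by (auto simp: N_def vec_eq_iff)
  have gt: "0 < det (N t)" if t: "0 \<le> t" "t < 1" for t
  proof (rule ccontr)
    assume "\<not> 0 < det (N t)"
    then have "\<exists>x\<ge>0. x \<le> t \<and> det (N x) = 0"
      using t N0 by (intro IVT2') (auto intro: cont)
    then show False using nz t by force
  qed
  show ?thesis
  proof (rule ccontr)
    assume "\<not> 0 \<le> det (gram w)"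
    \<comment> \<open>Half of the supposedly negative end value must be taken somewhere, and not at
      1 itself, hence at a point where the determinant was shown to be positive.\<close>
    then have "\<exists>x\<ge>0. x \<le> 1 \<and> det (N x) = det (gram w) / 2"
      using N0 N1 by (intro IVT2') (auto intro: cont)
    then obtain x where x: "0 \<le> x" "x \<le> 1" "det (N x) = det (gram w) / 2" by blast
    then have "x \<noteq> 1" using N1 \<open>\<not> 0 \<le> det (gram w)\<close> by auto
    then show False using gt[of x] x \<open>\<not> 0 \<le> det (gram w)\<close> by auto
  qed
qed

lemma lin_jac_nonneg: "0 \<le> lin_jac D A S"
  by (simp add: lin_jac_def det_gram_nonneg)

text \<open>Frame independence, multiplicativity and regularity of the Jacobian all come from this identity.\<close>

lemma det_gram_image:
  fixes w :: "'d::finite \<Rightarrow> real^'n"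
  assumes S: "S \<in> grassmannian TYPE('d)" and w: "\<And>i. w i \<in> plane S"
  shows "det (gram (\<lambda>i. blinfun_apply A (w i))) = det (gram w) * (lin_jac TYPE('d) A S)\<^sup>2"
proof -
  define s where "s = (SOME s :: 'd \<Rightarrow> real^'n. orthonormal_frame (plane S) s)"
  have s: "orthonormal_frame (plane S) s"
    unfolding s_def by (rule someI_ex[OF orthonormal_frame_exists[OF grassmannianD(1,2)[OF S]]])
  define R :: "real^'d^'d" where "R = (\<chi> i k. w i \<bullet> s k)"
  have e: "w i = (\<Sum>k\<in>UNIV. R $ i $ k *\<^sub>R s k)" for i
    using orthonormal_frame_expand[OF s w] by (simp add: R_def)
  have "blinfun_apply A (w i) = (\<Sum>k\<in>UNIV. R $ i $ k *\<^sub>R blinfun_apply A (s k))" for i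
    by (subst e) (simp add: blinfun.sum_right blinfun.scaleR_right)
  then have 1: "gram (\<lambda>i. blinfun_apply A (w i)) = R ** gram (\<lambda>i. blinfun_apply A (s i)) ** transpose R"
    by (rule gram_linear_combination)
  have 2: "gram w = R ** mat 1 ** transpose R"
    using gram_linear_combination[of w R s] e gram_orthonormal_frame[OF s] by simp
  have "(lin_jac TYPE('d) A S)\<^sup>2 = det (gram (\<lambda>i. blinfun_apply A (s i)))"
    by (simp add: lin_jac_def s_def det_gram_nonneg)
  then show ?thesis unfolding 1 2 by (simp add: det_mul)
qed

lemma lin_jac_frame:
  fixes S :: "real^'n^'n" and s :: "'d::finite \<Rightarrow> real^'n"
  assumes "S \<in> grassmannian TYPE('d)" "orthonormal_frame (plane S) s"
  shows "(lin_jac TYPE('d) A S)\<^sup>2 = det (gram (\<lambda>i. blinfun_apply A (s i)))"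
  using det_gram_image[OF assms(1), of s A] orthonormal_frame_in[OF assms(2)]
  by (simp add: gram_orthonormal_frame[OF assms(2)])

text \<open>The images under \<open>A\<close> of an orthonormal frame of \<open>S\<close> lie in the
  image plane without being orthonormal; the Gram factor that \<open>det_gram_image\<close> produces
  for them is exactly the squared Jacobian of \<open>A\<close>.\<close>

lemma lin_jac_compose:
  fixes S :: "real^'n^'n"
  assumes S: "S \<in> grassmannian TYPE('d::finite)" and A: "inj (blinfun_apply A)"
  shows "lin_jac TYPE('d) (B o\<^sub>L A) S = lin_jac TYPE('d) B (image_proj A S) * lin_jac TYPE('d) A S"
proof -
  obtain s :: "'d \<Rightarrow> real^'n" where s: "orthonormal_frame (plane S) s"
    using orthonormal_frame_exists[OF grassmannianD(1,2)[OF S]] by blast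
  have "(lin_jac TYPE('d) (B o\<^sub>L A) S)\<^sup>2
      = det (gram (\<lambda>i. blinfun_apply B (blinfun_apply A (s i))))"
    using lin_jac_frame[OF S s] by simp
  also have "\<dots> = det (gram (\<lambda>i. blinfun_apply A (s i))) * (lin_jac TYPE('d) B (image_proj A S))\<^sup>2"
    by (rule det_gram_image[OF image_proj_in_grassmannian[OF S A]])
      (use orthonormal_frame_in[OF s] in \<open>simp add: plane_image_proj[OF S]\<close>)
  also have "\<dots> = (lin_jac TYPE('d) B (image_proj A S) * lin_jac TYPE('d) A S)\<^sup>2"
    by (simp add: lin_jac_frame[OF S s, symmetric] power_mult_distrib)
  finally show ?thesis by (simp add: lin_jac_nonneg)
qed

lemma lin_jac_id:
  fixes S :: "real^'n^'n"
  assumes S: "S \<in> grassmannian TYPE('d::finite)"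
  shows "lin_jac TYPE('d) id_blinfun S = 1"
proof -
  obtain s :: "'d \<Rightarrow> real^'n" where s: "orthonormal_frame (plane S) s"
    using orthonormal_frame_exists[OF grassmannianD(1,2)[OF S]] by blast
  have "(lin_jac TYPE('d) id_blinfun S)\<^sup>2 = 1"
    using lin_jac_frame[OF S s, of id_blinfun] gram_orthonormal_frame[OF s] by simp
  then show ?thesis using lin_jac_nonneg[of "TYPE('d)" id_blinfun S] by (simp add: power2_eq_1_iff)
qed

lemma tangential_jacobian_eq:
  fixes A :: "(real^'n) \<Rightarrow>\<^sub>L (real^'n)"
  assumes "(f has_derivative blinfun_apply A) (at x)"
  shows "tangential_jacobian TYPE('d::finite) f x S = lin_jac TYPE('d) A S"
proof -
  have "transpose (\<chi> k i. blinfun_apply A (s i) $ k) ** (\<chi> k i. blinfun_apply A (s i) $ k)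
      = gram (\<lambda>i. blinfun_apply A (s i))" for s :: "'d \<Rightarrow> real^'n"
    by (simp add: gram_def transpose_def matrix_matrix_mult_def vec_eq_iff inner_vec_def)
  then show ?thesis
    unfolding tangential_jacobian_def lin_jac_def Let_def frechet_derivative_at[OF assms, symmetric]
    by simp
qed

lemma image_plane_eq:
  fixes A :: "(real^'n) \<Rightarrow>\<^sub>L (real^'n)"
  assumes "(f has_derivative blinfun_apply A) (at x)"
  shows "image_plane f x S = image_proj A S"
  unfolding image_plane_def image_proj_def frechet_derivative_at[OF assms, symmetric] ..

section \<open>Lipschitz bounds for determinants and Jacobians\<close>

lemma det_lipschitz:
  fixes M N :: "real^'d::finite^'d"
  assumes "0 < b" and M: "\<And>i j. \<bar>M $ i $ j\<bar> \<le> b" and N: "\<And>i j. \<bar>N $ i $ j\<bar> \<le> b"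
    and e: "\<And>i j. \<bar>M $ i $ j - N $ i $ j\<bar> \<le> e"
  shows "\<bar>det M - det N\<bar> \<le>
    real (card {p. p permutes (UNIV :: 'd set)}) * (b ^ CARD('d) * (real CARD('d) * (e / b)))"
proof -
  have "\<bar>(\<Prod>i\<in>UNIV. M $ i $ p i) - (\<Prod>i\<in>UNIV. N $ i $ p i)\<bar>
      \<le> b ^ CARD('d) * (real CARD('d) * (e / b))" for p
  proof -
    \<comment> \<open>Dividing by \<open>b\<close> brings all factors into the unit interval, where
      \<open>norm_prod_diff\<close> bounds a difference of products by the sum of the
      differences.\<close>
    have *: "(\<Prod>i\<in>UNIV. L $ i $ p i) = b ^ CARD('d) * (\<Prod>i\<in>UNIV. L $ i $ p i / b)"
      for L :: "real^'d^'d"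
      using \<open>0 < b\<close> by (simp add: prod_dividef)
    have "norm ((\<Prod>i\<in>UNIV. M $ i $ p i / b) - (\<Prod>i\<in>UNIV. N $ i $ p i / b))
        \<le> (\<Sum>i\<in>UNIV. norm (M $ i $ p i / b - N $ i $ p i / b))"
      using M N \<open>0 < b\<close> by (intro norm_prod_diff) auto
    also have "\<dots> \<le> (\<Sum>i\<in>(UNIV::'d set). e / b)"
      using e \<open>0 < b\<close> by (intro sum_mono) (simp add: diff_divide_distrib[symmetric] divide_right_mono)
    finally have "b ^ CARD('d) * \<bar>(\<Prod>i\<in>UNIV. M $ i $ p i / b) - (\<Prod>i\<in>UNIV. N $ i $ p i / b)\<bar>
        \<le> b ^ CARD('d) * (real CARD('d) * (e / b))"
      using \<open>0 < b\<close> by (intro mult_left_mono) auto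
    then show ?thesis
      unfolding *[of M] *[of N] using \<open>0 < b\<close> by (simp add: right_diff_distrib[symmetric] abs_mult)
  qed
  then have "\<bar>of_int (sign p) * (\<Prod>i\<in>UNIV. M $ i $ p i) - of_int (sign p) * (\<Prod>i\<in>UNIV. N $ i $ p i)\<bar>
      \<le> b ^ CARD('d) * (real CARD('d) * (e / b))" for p :: "'d \<Rightarrow> 'd"
    by (simp add: sign_def abs_minus_commute)
  then have "\<bar>det M - det N\<bar>
      \<le> (\<Sum>p | p permutes (UNIV :: 'd set). b ^ CARD('d) * (real CARD('d) * (e / b)))"
    unfolding det_def sum_subtractf[symmetric] by (intro order_trans[OF sum_abs sum_mono])
  then show ?thesis by simp
qed

lemma det_gram_lipschitz:
  obtains C where "0 \<le> C"
    "\<And>(v :: 'd::finite \<Rightarrow> 'a::real_inner) w e. (\<And>i. norm (v i) \<le> b) \<Longrightarrow> (\<And>i. norm (w i) \<le> b) \<Longrightarrow>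
       (\<And>i. norm (v i - w i) \<le> e) \<Longrightarrow> \<bar>det (gram v) - det (gram w)\<bar> \<le> C * e"
proof
  \<comment> \<open>\<open>b\<^sup>2\<close> bounds the Gram entries; adding 1 keeps the bound
    positive when \<open>b\<close> is 0, as the division in \<open>det_lipschitz\<close> requires.
    The absolute value in \<open>C\<close> makes it nonnegative for every real
    \<open>b\<close>.\<close>
  define c where "c = b\<^sup>2 + 1"
  have c: "0 < c" by (simp add: c_def add_pos_nonneg add.commute)
  define C where "C = real (card {p. p permutes (UNIV :: 'd set)}) * (c ^ CARD('d) * (real CARD('d) * (2 * \<bar>b\<bar> / c)))"
  show "0 \<le> C" using c by (simp add: C_def)
  fix v w :: "'d \<Rightarrow> 'a" and e
  assume v: "\<And>i. norm (v i) \<le> b" and w: "\<And>i. norm (w i) \<le> b" and e: "\<And>i. norm (v i - w i) \<le> e"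
  have b: "0 \<le> b" using v norm_ge_zero order_trans by blast
  have g: "\<bar>gram u $ i $ j\<bar> \<le> c" if "\<And>i. norm (u i) \<le> b" for u :: "'d \<Rightarrow> 'a" and i j
  proof -
    have "\<bar>u i \<bullet> u j\<bar> \<le> b * b"
      using Cauchy_Schwarz_ineq2[of "u i" "u j"] mult_mono[OF that[of i] that[of j] b norm_ge_zero] by linarith
    then show ?thesis by (simp add: gram_def c_def power2_eq_square)
  qed
  have d: "\<bar>gram v $ i $ j - gram w $ i $ j\<bar> \<le> 2 * \<bar>b\<bar> * e" for i j
  proof -
    have "v i \<bullet> v j - w i \<bullet> w j = (v i - w i) \<bullet> v j + w i \<bullet> (v j - w j)"
      by (simp add: inner_diff_left inner_diff_right)
    moreover have "\<bar>(v i - w i) \<bullet> v j\<bar> \<le> e * b"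
      using Cauchy_Schwarz_ineq2[of "v i - w i" "v j"] mult_mono[OF e[of i] v[of j] order_trans[OF norm_ge_zero e[of i]] norm_ge_zero]
      by linarith
    moreover have "\<bar>w i \<bullet> (v j - w j)\<bar> \<le> b * e"
      using Cauchy_Schwarz_ineq2[of "w i" "v j - w j"] mult_mono[OF w[of i] e[of j] b norm_ge_zero] by linarith
    moreover have "2 * \<bar>b\<bar> * e = e * b + b * e" using b by simp
    ultimately show ?thesis unfolding gram_def by (simp only: vec_lambda_beta)
  qed
  from det_lipschitz[OF c g[OF v] g[OF w] d] show "\<bar>det (gram v) - det (gram w)\<bar> \<le> C * e"
    by (simp add: C_def mult_ac)
qed

lemma lin_jac_bounded:
  obtains C where "0 \<le> C"
    "\<And>A (S :: real^'n^'n). norm A \<le> R \<Longrightarrow> S \<in> grassmannian TYPE('d::finite) \<Longrightarrow> lin_jac TYPE('d) A S \<le> C"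
proof -
  obtain C where C: "0 \<le> C"
    "\<And>(v :: 'd \<Rightarrow> real^'n) w e. (\<And>i. norm (v i) \<le> R) \<Longrightarrow> (\<And>i. norm (w i) \<le> R) \<Longrightarrow>
       (\<And>i. norm (v i - w i) \<le> e) \<Longrightarrow> \<bar>det (gram v) - det (gram w)\<bar> \<le> C * e"
    using det_gram_lipschitz by blast
  show ?thesis
  proof (rule that[of "sqrt (C * \<bar>R\<bar>)"])
    fix A :: "(real^'n) \<Rightarrow>\<^sub>L (real^'n)" and S :: "real^'n^'n" assume A: "norm A \<le> R" and S: "S \<in> grassmannian TYPE('d)"
    have R: "0 \<le> R" using A norm_ge_zero order_trans by blast
    obtain s :: "'d \<Rightarrow> real^'n" where s: "orthonormal_frame (plane S) s"
      using orthonormal_frame_exists[OF grassmannianD(1,2)[OF S]] by blast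
    have n: "norm (blinfun_apply A (s i)) \<le> R" for i
      using norm_blinfun_le[OF A, of "s i"] norm_orthonormal_frame[OF s] by simp
    \<comment> \<open>Comparison with the zero family turns the Lipschitz estimate into a bound. Its
      Gram determinant vanishes because the index type has at least one row.\<close>
    have "det (gram (\<lambda>i::'d. 0 :: real^'n)) = 0"
      by (rule det_zero_row(2)[of undefined]) (simp add: gram_def row_def vec_eq_iff)
    then have "\<bar>det (gram (\<lambda>i. blinfun_apply A (s i)))\<bar> \<le> C * R"
      using C(2)[of "\<lambda>i. blinfun_apply A (s i)" "\<lambda>i. 0" R] n R by simp
    then show "lin_jac TYPE('d) A S \<le> sqrt (C * \<bar>R\<bar>)"
      using lin_jac_frame[OF S s, of A] R by (intro real_le_rsqrt) simp
  qed (use C in simp)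
qed

text \<open>Testing both maps on the preimage under \<open>A\<close> of an orthonormal frame of \<open>A S\<close> makes the
  Jacobian of \<open>A\<close> cancel, so no lower bound for Gram determinants is needed.\<close>

lemma lin_jac_lipschitz:
  obtains C where "0 \<le> C"
    "\<And>A A' (S :: real^'n^'n). bilipschitz R A \<Longrightarrow> bilipschitz R A' \<Longrightarrow> S \<in> grassmannian TYPE('d::finite) \<Longrightarrow>
      \<bar>lin_jac TYPE('d) A S - lin_jac TYPE('d) A' S\<bar> \<le> C * norm (A - A')"
proof -
  obtain C where C: "0 \<le> C"
    \<comment> \<open>One radius for both families compared below: the frame \<open>t\<close> of
      unit vectors, and the vectors \<open>A' u\<close> of length at most
      \<open>R\<^sup>2\<close>.\<close>
    "\<And>(v :: 'd \<Rightarrow> real^'n) w e. (\<And>i. norm (v i) \<le> 1 + R\<^sup>2) \<Longrightarrow> (\<And>i. norm (w i) \<le> 1 + R\<^sup>2) \<Longrightarrow>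
       (\<And>i. norm (v i - w i) \<le> e) \<Longrightarrow> \<bar>det (gram v) - det (gram w)\<bar> \<le> C * e"
    using det_gram_lipschitz by blast
  obtain K where K: "0 \<le> K"
    "\<And>A (S :: real^'n^'n). norm A \<le> R \<Longrightarrow> S \<in> grassmannian TYPE('d) \<Longrightarrow> lin_jac TYPE('d) A S \<le> K"
    using lin_jac_bounded by blast
  show ?thesis
  proof (rule that[of "K * (C * \<bar>R\<bar>)"])
    show "0 \<le> K * (C * \<bar>R\<bar>)" using K(1) C(1) by simp
    fix A A' :: "(real^'n) \<Rightarrow>\<^sub>L (real^'n)" and S :: "real^'n^'n"
    assume A: "bilipschitz R A" and A': "bilipschitz R A'" and S: "S \<in> grassmannian TYPE('d)"
    have R: "0 \<le> R" using bilipschitz_nonneg[OF A] .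
    have nA: "norm A \<le> R" "norm A' \<le> R" using A A' by (auto simp: bilipschitz_def)
    have T: "image_proj A S \<in> grassmannian TYPE('d)"
      by (rule image_proj_in_grassmannian[OF S bilipschitz_inj[OF A]])
    obtain t :: "'d \<Rightarrow> real^'n" where t: "orthonormal_frame (plane (image_proj A S)) t"
      using orthonormal_frame_exists[OF grassmannianD(1,2)[OF T]] by blast
    have "\<exists>u\<in>plane S. t i = blinfun_apply A u" for i
      using orthonormal_frame_in[OF t, of i] plane_image_proj[OF S, of A] by auto
    then obtain u where u: "\<And>i. u i \<in> plane S" "\<And>i. t i = blinfun_apply A (u i)" by metis
    have nu: "norm (u i) \<le> R" for i
      using A norm_orthonormal_frame[OF t, of i] u(2)[of i] unfolding bilipschitz_def
      by (metis mult.right_neutral)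
    let ?J = "lin_jac TYPE('d) A S" and ?J' = "lin_jac TYPE('d) A' S"
    have eq: "t = (\<lambda>i. blinfun_apply A (u i))" using u(2) by blast
    have 1: "det (gram u) * ?J\<^sup>2 = 1"
      using det_gram_image[OF S u(1), of A "\<lambda>i. i"] gram_orthonormal_frame[OF t] eq by simp
    \<comment> \<open>By fact 1, \<open>q\<close> is the squared ratio of the two Jacobians,
      obtained without a division; it is close to 1 because \<open>A' u\<close> is close to the
      orthonormal frame \<open>A u\<close>.\<close>
    define q where "q = det (gram (\<lambda>i. blinfun_apply A' (u i)))"
    have q: "q = det (gram u) * ?J'\<^sup>2" unfolding q_def by (rule det_gram_image[OF S u(1)])
    have "\<bar>q - det (gram t)\<bar> \<le> C * (R * norm (A - A'))"
      unfolding q_def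
    proof (rule C(2))
      fix i
      have "norm (blinfun_apply A' (u i)) \<le> R * R"
        using norm_blinfun_le[OF nA(2), of "u i"] mult_left_mono[OF nu[of i] R] by linarith
      then show "norm (blinfun_apply A' (u i)) \<le> 1 + R\<^sup>2" by (simp add: power2_eq_square)
      show "norm (t i) \<le> 1 + R\<^sup>2" using norm_orthonormal_frame[OF t, of i] by simp
      have "norm (blinfun_apply (A' - A) (u i)) \<le> norm (A' - A) * R"
        using norm_blinfun[of "A' - A" "u i"] mult_left_mono[OF nu[of i], of "norm (A' - A)"] by simp
      then show "norm (blinfun_apply A' (u i) - t i) \<le> R * norm (A - A')"
        by (simp add: eq blinfun.diff_left norm_minus_commute mult.commute)
    qed
    then have q1: "\<bar>q - 1\<bar> \<le> C * (R * norm (A - A'))"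
      using gram_orthonormal_frame[OF t] by simp
    have q0: "0 \<le> q" by (simp add: q_def det_gram_nonneg)
    have "?J'\<^sup>2 = (det (gram u) * ?J\<^sup>2) * ?J'\<^sup>2" by (simp add: 1)
    also have "\<dots> = ?J\<^sup>2 * q" unfolding q by (simp only: mult_ac)
    also have "\<dots> = (?J * sqrt q)\<^sup>2" using q0 by (simp add: power_mult_distrib)
    finally have sq: "?J'\<^sup>2 = (?J * sqrt q)\<^sup>2" .
    have "?J' = ?J * sqrt q"
      by (rule power2_eq_imp_eq[OF sq]) (simp_all add: lin_jac_nonneg q0)
    then have "?J - ?J' = ?J * (1 - sqrt q)" by (simp add: right_diff_distrib)
    then have "\<bar>?J - ?J'\<bar> = ?J * \<bar>sqrt q - 1\<bar>"
      using lin_jac_nonneg[of "TYPE('d)" A S] by (simp add: abs_mult abs_minus_commute)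
    also have "\<dots> \<le> ?J * \<bar>q - 1\<bar>"
    proof (rule mult_left_mono[OF _ lin_jac_nonneg])
      have "0 \<le> q" by (simp add: q_def det_gram_nonneg)
      \<comment> \<open>The second factor is at least 1, so near 1 the square root costs nothing,
        although it is not Lipschitz at 0.\<close>
      then have "\<bar>q - 1\<bar> = \<bar>sqrt q - 1\<bar> * (sqrt q + 1)"
        using abs_mult[of "sqrt q - 1" "sqrt q + 1"] by (simp add: algebra_simps)
      moreover have "\<bar>sqrt q - 1\<bar> * 1 \<le> \<bar>sqrt q - 1\<bar> * (sqrt q + 1)"
        using \<open>0 \<le> q\<close> by (intro mult_left_mono) auto
      ultimately show "\<bar>sqrt q - 1\<bar> \<le> \<bar>q - 1\<bar>" by simp
    qed
    also have "\<dots> \<le> K * (C * (R * norm (A - A')))"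
      using K(2)[OF nA(1) S] q1 K(1) by (intro mult_mono) auto
    finally show "\<bar>?J - ?J'\<bar> \<le> K * (C * \<bar>R\<bar>) * norm (A - A')" using R by (simp add: mult_ac)
  qed
qed

lemma tendsto_det_gram:
  assumes "\<And>i. ((\<lambda>p. f i p) \<longlongrightarrow> w i) F"
  shows "((\<lambda>p. det (gram (\<lambda>i. f i p))) \<longlongrightarrow> det (gram w)) F"
  unfolding det_def gram_def vec_lambda_beta by (intro tendsto_intros assms)

text \<open>Here the plane moves, so no fixed frame serves all nearby planes. The vectors
  \<open>S s\<close>, with \<open>s\<close> a frame of \<open>S0\<close>, always lie in
  \<open>S\<close> and have Gram determinant close to 1, so \<open>det_gram_image\<close> writes the
  squared Jacobian near \<open>S0\<close> as a quotient of two functions that converge at the base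
  point.\<close>

lemma lin_jac_continuous:
  "continuous_on (UNIV \<times> grassmannian TYPE('d::finite))
    (\<lambda>(A, S :: real^'n^'n). lin_jac TYPE('d) A S)"
proof (unfold continuous_on_def, safe)
  fix A0 :: "(real^'n) \<Rightarrow>\<^sub>L (real^'n)" and S0 :: "real^'n^'n"
  assume S0: "S0 \<in> grassmannian TYPE('d)"
  obtain s :: "'d \<Rightarrow> real^'n" where s: "orthonormal_frame (plane S0) s"
    using orthonormal_frame_exists[OF grassmannianD(1,2)[OF S0]] by blast
  let ?F = "at (A0, S0) within UNIV \<times> grassmannian TYPE('d)"
  let ?num = "\<lambda>p :: ((real^'n) \<Rightarrow>\<^sub>L (real^'n)) \<times> (real^'n^'n). det (gram (\<lambda>i. blinfun_apply (fst p) (snd p *v s i)))"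
  let ?den = "\<lambda>p :: ((real^'n) \<Rightarrow>\<^sub>L (real^'n)) \<times> (real^'n^'n). det (gram (\<lambda>i. snd p *v s i))"
  have tS: "((\<lambda>p. snd p *v v) \<longlongrightarrow> S0 *v v) ?F" for v
    unfolding matrix_vector_mult_def by (intro vec_tendstoI) (auto intro!: tendsto_eq_intros)
  have tA: "((\<lambda>p. blinfun_apply (fst p) (snd p *v v)) \<longlongrightarrow> blinfun_apply A0 (S0 *v v)) ?F" for v
    by (intro blinfun.tendsto tS) (auto intro!: tendsto_eq_intros)
  have den: "(?den \<longlongrightarrow> ?den (A0, S0)) ?F"
    using tendsto_det_gram[of "\<lambda>i p. snd p *v s i", OF tS] by simp
  have num: "(?num \<longlongrightarrow> ?num (A0, S0)) ?F"
    using tendsto_det_gram[of "\<lambda>i p. blinfun_apply (fst p) (snd p *v s i)", OF tA] by simp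
  have "(\<lambda>i. S0 *v s i) = s" using proj_vec_ident[OF S0 orthonormal_frame_in[OF s]] by auto
  then have d0: "?den (A0, S0) = 1" using gram_orthonormal_frame[OF s] by simp
  have eq: "lin_jac TYPE('d) (fst p) (snd p) = sqrt (?num p / ?den p)"
    if "?den p \<noteq> 0" "snd p \<in> grassmannian TYPE('d)" for p
  proof (rule real_sqrt_unique[symmetric, OF _ lin_jac_nonneg])
    show "(lin_jac TYPE('d) (fst p) (snd p))\<^sup>2 = ?num p / ?den p"
      using det_gram_image[OF that(2), of "\<lambda>i. snd p *v s i" "fst p", OF proj_vec_in] that(1) by simp
  qed
  have "\<forall>\<^sub>F p in ?F. ?den p \<noteq> 0"
    using tendsto_imp_eventually_ne[OF den, of 0] d0 by simp
  moreover have "\<forall>\<^sub>F p in ?F. snd p \<in> grassmannian TYPE('d)"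
    unfolding eventually_at_filter by (rule always_eventually) auto
  ultimately have ev: "\<forall>\<^sub>F p in ?F. sqrt (?num p / ?den p) = lin_jac TYPE('d) (fst p) (snd p)"
    by eventually_elim (rule eq[symmetric])
  have "((\<lambda>p. sqrt (?num p / ?den p)) \<longlongrightarrow> sqrt (?num (A0, S0) / ?den (A0, S0))) ?F"
    using d0 by (intro tendsto_real_sqrt tendsto_divide num den) auto
  then have "((\<lambda>p. lin_jac TYPE('d) (fst p) (snd p)) \<longlongrightarrow> lin_jac TYPE('d) (fst (A0, S0)) (snd (A0, S0))) ?F"
    using Lim_transform_eventually[OF _ ev] eq[of "(A0, S0)"] d0 S0 by auto
  then show "((\<lambda>(A, S). lin_jac TYPE('d) A S) \<longlongrightarrow> lin_jac TYPE('d) A0 S0) ?F"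
    by (simp add: case_prod_beta')
qed

section \<open>Transport of varifolds along deformations\<close>

lemma space_bundle_borel: "space (bundle_borel D) = plane_bundle D"
  by (simp add: bundle_borel_def space_restrict_space)

lemma space_plane_bundle: "sets V = sets (bundle_borel D) \<Longrightarrow> space V = plane_bundle D"
  by (drule sets_eq_imp_space_eq) (simp add: space_bundle_borel)

lemma bundle_measurable_continuous:
  fixes f :: "(real^'n) \<times> (real^'n^'n) \<Rightarrow> 'b::topological_space"
  shows "continuous_on (plane_bundle D) f \<Longrightarrow> f \<in> borel_measurable (bundle_borel D)"
  unfolding bundle_borel_def by (rule borel_measurable_continuous_on_restrict)

lemma emeasure_mass_measure:
  assumes "sets V = sets (bundle_borel D)"
  shows "emeasure (mass_measure V) UNIV = total_mass V"
proof -
  have "continuous_on (plane_bundle D) fst" by (intro continuous_intros)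
  then have "fst \<in> borel_measurable V"
    using bundle_measurable_continuous measurable_cong_sets[OF assms refl] by blast
  then show ?thesis unfolding mass_measure_def by (subst emeasure_distr) auto
qed

lemma norm_integral_le_const:
  fixes g :: "'a \<Rightarrow> 'b::{banach, second_countable_topology}"
  assumes m: "total_mass V \<le> ennreal m" "0 \<le> m" and g: "\<And>x. x \<in> space V \<Longrightarrow> norm (g x) \<le> c" and c: "0 \<le> c"
  shows "norm (\<integral>x. g x \<partial>V) \<le> m * c"
proof (cases "integrable V g")
  case True
  interpret finite_measure V
    by (rule finite_measureI) (use m in \<open>auto simp: top_unique dest: order_trans\<close>)
  have "norm (\<integral>x. g x \<partial>V) \<le> (\<integral>x. norm (g x) \<partial>V)" by (rule integral_norm_bound)
  also have "\<dots> \<le> (\<integral>x. c \<partial>V)" using True g by (intro integral_mono) auto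
  also have "\<dots> \<le> m * c"
  proof -
    have "measure V (space V) \<le> m"
      using m unfolding emeasure_eq_measure by simp
    then show ?thesis using c by (simp add: mult_right_mono)
  qed
  finally show ?thesis .
next
  case False
  \<comment> \<open>A non-integrable function has Bochner integral 0 by convention, so the bound
    persists.\<close>
  then show ?thesis using m(2) c by (simp add: not_integrable_integral_eq)
qed

definition admissible :: "real \<Rightarrow> 'n::finite deformation \<Rightarrow> bool" where
  "admissible R u \<longleftrightarrow> continuous_on UNIV u \<and> (\<forall>x. bilipschitz R (snd (u x)))"

definition bundle_map ::
    "'n::finite deformation \<Rightarrow> (real^'n) \<times> (real^'n^'n) \<Rightarrow> (real^'n) \<times> (real^'n^'n)" where
  "bundle_map u p = (fst (u (fst p)), image_proj (snd (u (fst p))) (snd p))"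

definition bundle_jac ::
    "'d::finite itself \<Rightarrow> 'n::finite deformation \<Rightarrow> (real^'n) \<times> (real^'n^'n) \<Rightarrow> real" where
  "bundle_jac D u p = lin_jac D (snd (u (fst p))) (snd p)"

text \<open>A deformation is recorded as \<open>u x = (F x, DF x)\<close>; keeping the derivative as an independent
  component makes the time-discrete flow an Euler scheme in a linear space.\<close>

definition transport ::
    "'d::finite itself \<Rightarrow> ((real^'n) \<times> (real^'n^'n)) measure \<Rightarrow>
     'n::finite deformation \<Rightarrow> ((real^'n) \<times> (real^'n^'n)) measure" where
  "transport D V u = distr (density V (\<lambda>p. ennreal (bundle_jac D u p))) (bundle_borel D) (bundle_map u)"

lemma push_forward_eq_transport:
  assumes "\<And>x. (f has_derivative blinfun_apply (A x)) (at x)"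
  shows "push_forward TYPE('d::finite) f V = transport TYPE('d) V (\<lambda>x. (f x, A x))"
proof -
  have "(\<lambda>(x, S). ennreal (tangential_jacobian TYPE('d) f x S)) = (\<lambda>p. ennreal (bundle_jac TYPE('d) (\<lambda>x. (f x, A x)) p))"
    "(\<lambda>(x, S). (f x, image_plane f x S)) = bundle_map (\<lambda>x. (f x, A x))"
    by (auto simp: fun_eq_iff bundle_map_def bundle_jac_def tangential_jacobian_eq[OF assms] image_plane_eq[OF assms])
  then show ?thesis unfolding push_forward_def transport_def by simp
qed

lemma bundle_map_in:
  "admissible R u \<Longrightarrow> p \<in> plane_bundle TYPE('d::finite) \<Longrightarrow> bundle_map u p \<in> plane_bundle TYPE('d)"
  by (auto simp: bundle_map_def admissible_def intro!: image_proj_in_grassmannian bilipschitz_inj)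

lemma continuous_on_fst_arg:
  assumes "continuous_on UNIV u"
  shows "continuous_on X (\<lambda>p. u (fst p))"
  by (rule continuous_on_compose2[OF assms]) (auto intro: continuous_intros)

lemma bundle_jac_continuous:
  assumes "admissible R u"
  shows "continuous_on (plane_bundle TYPE('d::finite)) (bundle_jac TYPE('d) u)"
proof -
  have 1: "continuous_on (plane_bundle TYPE('d)) (\<lambda>p. (snd (u (fst p)), snd p))"
    using assms unfolding admissible_def by (auto intro!: continuous_intros continuous_on_fst_arg)
  have 2: "(\<lambda>p. (snd (u (fst p)), snd p)) ` plane_bundle TYPE('d) \<subseteq> UNIV \<times> grassmannian TYPE('d)"
    by auto
  from continuous_on_compose2[OF lin_jac_continuous 1 2]
  show ?thesis by (simp add: bundle_jac_def[abs_def])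
qed

lemma bundle_map_continuous:
  fixes u :: "'n::finite deformation"
  assumes u: "admissible R u"
  shows "continuous_on (plane_bundle TYPE('d::finite)) (bundle_map u)"
proof -
  have cu: "continuous_on (plane_bundle TYPE('d)) (\<lambda>p. u (fst p))"
    using u unfolding admissible_def by (auto intro!: continuous_on_fst_arg)
  have "continuous_on (plane_bundle TYPE('d)) (\<lambda>p. image_proj (snd (u (fst p))) (snd p))"
    unfolding continuous_on_def
  proof
    fix q :: "(real^'n) \<times> (real^'n^'n)" assume q: "q \<in> plane_bundle TYPE('d)"
    let ?F = "at q within plane_bundle TYPE('d)"
    let ?b = "\<lambda>p. (real CARD('n))\<^sup>2 * (2 * (R * norm (snd (u (fst p)) - snd (u (fst q))) + R\<^sup>2 * norm (snd p - snd q)))"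
    have "((\<lambda>p. u (fst p)) \<longlongrightarrow> u (fst q)) ?F" using cu q by (auto simp: continuous_on_def)
    then have "(?b \<longlongrightarrow> (real CARD('n))\<^sup>2 * (2 * (R * norm (snd (u (fst q)) - snd (u (fst q))) + R\<^sup>2 * norm (snd q - snd q)))) ?F"
      by (intro tendsto_intros)
    then have lim: "(?b \<longlongrightarrow> 0) ?F" by simp
    have "norm (image_proj (snd (u (fst p))) (snd p) - image_proj (snd (u (fst q))) (snd q)) \<le> ?b p"
      if "p \<in> plane_bundle TYPE('d)" for p
      using u q that by (intro image_proj_dist_le[where 'd = 'd]) (auto simp: admissible_def)
    then have "\<forall>\<^sub>F p in ?F. norm (image_proj (snd (u (fst p))) (snd p) - image_proj (snd (u (fst q))) (snd q)) \<le> ?b p"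
      unfolding eventually_at_filter by (intro always_eventually) blast
    then have "((\<lambda>p. image_proj (snd (u (fst p))) (snd p) - image_proj (snd (u (fst q))) (snd q)) \<longlongrightarrow> 0) ?F"
      by (rule Lim_null_comparison[OF _ lim])
    then show "((\<lambda>p. image_proj (snd (u (fst p))) (snd p)) \<longlongrightarrow> image_proj (snd (u (fst q))) (snd q)) ?F"
      by (rule LIM_zero_cancel)
  qed
  then have "continuous_on (plane_bundle TYPE('d)) (\<lambda>p. (fst (u (fst p)), image_proj (snd (u (fst p))) (snd p)))"
    using cu by (intro continuous_intros)
  then show ?thesis by (simp add: bundle_map_def[abs_def])
qed

lemma bundle_jac_measurable:
  "admissible R u \<Longrightarrow> bundle_jac TYPE('d::finite) u \<in> borel_measurable (bundle_borel TYPE('d))"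
  by (intro bundle_measurable_continuous bundle_jac_continuous)

lemma bundle_map_measurable:
  assumes "admissible R u"
  shows "bundle_map u \<in> measurable (bundle_borel TYPE('d::finite)) (bundle_borel TYPE('d))"
  unfolding bundle_borel_def[of "TYPE('d)"]
proof (rule measurable_restrict_space2)
  show "bundle_map u \<in> borel_measurable (restrict_space borel (plane_bundle TYPE('d)))"
    using bundle_measurable_continuous[OF bundle_map_continuous[OF assms]] by (simp add: bundle_borel_def)
  show "bundle_map u \<in> space (restrict_space borel (plane_bundle TYPE('d))) \<rightarrow> plane_bundle TYPE('d)"
    using bundle_map_in[OF assms] by (auto simp: space_restrict_space)
qed

lemma sets_transport [simp]: "sets (transport D V u) = sets (bundle_borel D)"
  by (simp add: transport_def)

lemma bundle_jac_nonneg: "0 \<le> bundle_jac D u p"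
  by (simp add: bundle_jac_def lin_jac_nonneg)

lemma bundle_jac_bounded:
  obtains C where "0 \<le> C"
    "\<And>u p. admissible R u \<Longrightarrow> p \<in> plane_bundle TYPE('d::finite) \<Longrightarrow> bundle_jac TYPE('d) (u :: real^'n \<Rightarrow> _) p \<le> C"
  by (rule lin_jac_bounded[of R, where 'd = 'd and 'n = 'n])
    (auto simp: bundle_jac_def admissible_def bilipschitz_def)

lemma integral_transport:
  fixes f :: "(real^'n) \<times> (real^'n^'n) \<Rightarrow> 'b::{banach, second_countable_topology}"
  assumes V: "sets V = sets (bundle_borel TYPE('d::finite))" and u: "admissible R u"
    and f: "f \<in> borel_measurable (bundle_borel TYPE('d))"
  shows "(\<integral>p. f p \<partial>transport TYPE('d) V u) = (\<integral>p. bundle_jac TYPE('d) u p *\<^sub>R f (bundle_map u p) \<partial>V)"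
proof -
  have J: "bundle_jac TYPE('d) u \<in> borel_measurable V"
    using bundle_jac_measurable[OF u] measurable_cong_sets[OF V refl] by blast
  have g: "bundle_map u \<in> measurable V (bundle_borel TYPE('d))"
    using bundle_map_measurable[OF u] measurable_cong_sets[OF V refl] by blast
  have "(\<integral>p. f p \<partial>transport TYPE('d) V u)
      = (\<integral>p. f (bundle_map u p) \<partial>density V (\<lambda>p. ennreal (bundle_jac TYPE('d) u p)))"
    unfolding transport_def by (rule integral_distr) (use g f in auto)
  also have "\<dots> = (\<integral>p. bundle_jac TYPE('d) u p *\<^sub>R f (bundle_map u p) \<partial>V)"
    by (rule integral_density[OF measurable_compose[OF g f] J]) (intro AE_I2 bundle_jac_nonneg)
  finally show ?thesis .
qed

lemma emeasure_transport:
  assumes V: "sets V = sets (bundle_borel TYPE('d::finite))" and u: "admissible R u"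
  shows "total_mass (transport TYPE('d) V u) = (\<integral>\<^sup>+p. ennreal (bundle_jac TYPE('d) u p) \<partial>V)"
proof -
  have J: "bundle_jac TYPE('d) u \<in> borel_measurable V"
    using bundle_jac_measurable[OF u] measurable_cong_sets[OF V refl] by blast
  have g: "bundle_map u \<in> measurable V (bundle_borel TYPE('d))"
    using bundle_map_measurable[OF u] measurable_cong_sets[OF V refl] by blast
  have "bundle_map u -` space (bundle_borel TYPE('d)) \<inter> space V = space V"
    using measurable_space[OF g] by auto
  then show ?thesis
    unfolding transport_def using g J by (simp add: emeasure_distr emeasure_density cong: nn_integral_cong)
qed

text \<open>\<open>density_distr\<close> moves the second density inside the first image measure;
  the two Jacobians then multiply by \<open>lin_jac_compose\<close>, and the planes compose by
  \<open>image_proj_compose\<close>. This is the chain rule that lets a chain of push-forwards be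
  read as one transport of the initial varifold.\<close>

lemma transport_transport:
  assumes V: "sets V = sets (bundle_borel TYPE('d::finite))" and u: "admissible R u" and w: "admissible R' w"
  shows "transport TYPE('d) (transport TYPE('d) V u) w
    = transport TYPE('d) V (\<lambda>x. (fst (w (fst (u x))), snd (w (fst (u x))) o\<^sub>L snd (u x)))"
    (is "_ = transport _ V ?w")
proof -
  let ?N = "bundle_borel TYPE('d)"
  let ?J = "\<lambda>p. ennreal (bundle_jac TYPE('d) u p)" and ?J' = "\<lambda>p. ennreal (bundle_jac TYPE('d) w p)"
  have "bundle_jac TYPE('d) u \<in> borel_measurable V"
    using bundle_jac_measurable[OF u] measurable_cong_sets[OF V refl] by blast
  then have J: "?J \<in> borel_measurable V" by auto
  have J': "?J' \<in> borel_measurable ?N" using bundle_jac_measurable[OF w, where 'd = 'd] by auto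
  have g: "bundle_map u \<in> measurable V ?N"
    using bundle_map_measurable[OF u] measurable_cong_sets[OF V refl] by blast
  have g': "bundle_map w \<in> measurable ?N ?N" by (rule bundle_map_measurable[OF w])
  have J'g: "(\<lambda>p. ?J' (bundle_map u p)) \<in> borel_measurable V"
    using measurable_compose[OF g J'] .
  have sp: "space V = plane_bundle TYPE('d)"
    by (rule space_plane_bundle[OF V])
  have "transport TYPE('d) (transport TYPE('d) V u) w
      = distr (distr (density (density V ?J) (\<lambda>p. ?J' (bundle_map u p))) ?N (bundle_map u)) ?N (bundle_map w)"
    unfolding transport_def by (subst density_distr) (use g J' in auto)
  also have "\<dots> = distr (density V (\<lambda>p. ?J p * ?J' (bundle_map u p))) ?N (bundle_map w \<circ> bundle_map u)"
    using g g' J J'g by (simp add: density_density_eq distr_distr)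
  also have "\<dots> = distr (density V (\<lambda>p. ennreal (bundle_jac TYPE('d) ?w p))) ?N (bundle_map ?w)"
  proof (rule distr_cong)
    have eq: "?J p * ?J' (bundle_map u p) = ennreal (bundle_jac TYPE('d) ?w p)" if "p \<in> space V" for p
    proof -
      have "inj (blinfun_apply (snd (u (fst p))))" using u bilipschitz_inj unfolding admissible_def by blast
      moreover have "snd p \<in> grassmannian TYPE('d)" using that by (auto simp: sp)
      ultimately have "bundle_jac TYPE('d) u p * bundle_jac TYPE('d) w (bundle_map u p) = bundle_jac TYPE('d) ?w p"
        by (simp add: bundle_jac_def bundle_map_def lin_jac_compose)
      then show ?thesis by (simp add: bundle_jac_nonneg ennreal_mult[symmetric])
    qed
    show "density V (\<lambda>p. ?J p * ?J' (bundle_map u p)) = density V (\<lambda>p. ennreal (bundle_jac TYPE('d) ?w p))"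
    proof (rule density_cong)
      show "(\<lambda>p. ?J p * ?J' (bundle_map u p)) \<in> borel_measurable V" using J J'g by auto
      then show "(\<lambda>p. ennreal (bundle_jac TYPE('d) ?w p)) \<in> borel_measurable V"
        by (rule measurable_cong[THEN iffD1, rotated]) (rule eq)
      show "AE p in V. ?J p * ?J' (bundle_map u p) = ennreal (bundle_jac TYPE('d) ?w p)"
        by (rule AE_I2) (rule eq)
    qed
    fix p assume "p \<in> space (density V (\<lambda>p. ?J p * ?J' (bundle_map u p)))"
    then show "(bundle_map w \<circ> bundle_map u) p = bundle_map ?w p"
      using image_proj_compose[where 'd = 'd] by (auto simp: sp bundle_map_def)
  qed simp
  finally show ?thesis unfolding transport_def .
qed

section \<open>Lipschitz dependence of transported integrals on the deformation\<close>

lemma norm_fst_le': "norm (fst p) \<le> norm p" and norm_snd_le': "norm (snd p) \<le> norm p"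
  by (cases p; simp add: norm_fst_le norm_snd_le)+

text \<open>The domain on which the velocity is bounded and Lipschitz. The mass bound is a condition
  of its own, since the constant \<open>R\<close> will be \<open>exp (2 * L)\<close> with
  \<open>L\<close> computed from \<open>m\<close>.\<close>

definition deformations ::
    "'d::finite itself \<Rightarrow> ((real^'n) \<times> (real^'n^'n)) measure \<Rightarrow> real \<Rightarrow> real \<Rightarrow>
     'n::finite deformation set" where
  "deformations D V0 R m = {u. admissible R u \<and>
     total_mass (transport D V0 u) \<le> ennreal m}"

lemma deformationsD:
  assumes "u \<in> deformations D V0 R m"
  shows "admissible R u" "total_mass (transport D V0 u) \<le> ennreal m"
  using assms by (auto simp: deformations_def)

text \<open>One constant serves as sup bound and as Lipschitz constant. The plane component is
  measured in the Euclidean matrix norm, which dominates the operator norm in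
  \<open>bundle_dist\<close>; so the test functions of the bounded Lipschitz distance belong to this
  class with constant 1.\<close>

definition bundle_lipschitz ::
    "'d::finite itself \<Rightarrow> real \<Rightarrow> ((real^'n) \<times> (real^'n^'n) \<Rightarrow> 'b::real_normed_vector) \<Rightarrow> bool" where
  "bundle_lipschitz D b f \<longleftrightarrow> 0 \<le> b \<and> continuous_on (plane_bundle D) f \<and>
    (\<forall>p\<in>plane_bundle D. norm (f p) \<le> b) \<and>
    (\<forall>p\<in>plane_bundle D. \<forall>q\<in>plane_bundle D.
       norm (f p - f q) \<le> b * (norm (fst p - fst q) + norm (snd p - snd q)))"

text \<open>Both integrals are pulled back to \<open>V\<close>, where the integrands are a Jacobian
  times \<open>f\<close> along the bundle map. In \<open>L + K * (1 + P)\<close>, \<open>L\<close>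
  and \<open>K\<close> are the Lipschitz constant and the bound of the Jacobian and \<open>P\<close>
  is the Lipschitz constant of the image plane. The constant is chosen before \<open>V\<close>,
  \<open>m\<close> and \<open>f\<close>, so one choice covers all kernels and test functions used
  later.\<close>

lemma integral_transport_lipschitz:
  obtains C where "0 \<le> C"
    "\<And>V m u u' (f :: (real^'n) \<times> (real^'n^'n) \<Rightarrow> 'b::{banach, second_countable_topology}) b \<eta>.
       sets V = sets (bundle_borel TYPE('d::finite)) \<Longrightarrow> total_mass V \<le> ennreal m \<Longrightarrow> 0 \<le> m \<Longrightarrow>
       admissible R u \<Longrightarrow> admissible R u' \<Longrightarrow> bundle_lipschitz TYPE('d) b f \<Longrightarrow> (\<And>x. norm (u x - u' x) \<le> \<eta>) \<Longrightarrow>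
       norm ((\<integral>p. f p \<partial>transport TYPE('d) V u) - (\<integral>p. f p \<partial>transport TYPE('d) V u')) \<le> m * (C * b * \<eta>)"
proof -
  obtain L where L: "0 \<le> L"
    "\<And>A A' (S :: real^'n^'n). bilipschitz R A \<Longrightarrow> bilipschitz R A' \<Longrightarrow> S \<in> grassmannian TYPE('d) \<Longrightarrow>
      \<bar>lin_jac TYPE('d) A S - lin_jac TYPE('d) A' S\<bar> \<le> L * norm (A - A')"
    using lin_jac_lipschitz[of R] by blast
  obtain K where K: "0 \<le> K"
    "\<And>u p. admissible R u \<Longrightarrow> p \<in> plane_bundle TYPE('d) \<Longrightarrow> bundle_jac TYPE('d) (u :: real^'n \<Rightarrow> _) p \<le> K"
    using bundle_jac_bounded[of R] by blast
  \<comment> \<open>\<open>image_proj_dist_le\<close> for one plane and two linear maps: the term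
    with \<open>S - S'\<close> vanishes.\<close>
  define P where "P = (real CARD('n))\<^sup>2 * (2 * \<bar>R\<bar>)"
  have P: "0 \<le> P" by (simp add: P_def)
  show ?thesis
  proof (rule that[of "L + K * (1 + P)"])
    show "0 \<le> L + K * (1 + P)" using L(1) K(1) P by simp
    fix V :: "((real^'n) \<times> (real^'n^'n)) measure" and m
      and u u' :: "'n::finite deformation"
      and f :: "(real^'n) \<times> (real^'n^'n) \<Rightarrow> 'b" and b \<eta>
    assume V: "sets V = sets (bundle_borel TYPE('d))" "total_mass V \<le> ennreal m" "0 \<le> m"
      and u: "admissible R u" and u': "admissible R u'" and lip: "bundle_lipschitz TYPE('d) b f"
      and \<eta>: "\<And>x. norm (u x - u' x) \<le> \<eta>"
    have b: "\<And>p. p \<in> plane_bundle TYPE('d) \<Longrightarrow> norm (f p) \<le> b" "0 \<le> b"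
      and l: "\<And>p q. p \<in> plane_bundle TYPE('d) \<Longrightarrow> q \<in> plane_bundle TYPE('d) \<Longrightarrow>
          norm (f p - f q) \<le> b * (norm (fst p - fst q) + norm (snd p - snd q))"
      and f: "f \<in> borel_measurable (bundle_borel TYPE('d))"
      using lip bundle_measurable_continuous unfolding bundle_lipschitz_def by blast+
    have \<eta>0: "0 \<le> \<eta>" using \<eta> norm_ge_zero order_trans by blast
    have sp: "space V = plane_bundle TYPE('d)"
      by (rule space_plane_bundle[OF V(1)])
    let ?g = "\<lambda>u p. bundle_jac TYPE('d) u p *\<^sub>R f (bundle_map u p)"
    have int: "integrable V (?g u)" if u: "admissible R u" for u :: "'n::finite deformation"
    proof (rule integrableI_bounded_set[where A = "space V" and B = "K * b"])
      have "bundle_jac TYPE('d) u \<in> borel_measurable V"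
        using bundle_jac_measurable[OF u] measurable_cong_sets[OF V(1) refl] by blast
      moreover have "(\<lambda>p. f (bundle_map u p)) \<in> borel_measurable V"
        using measurable_compose[OF bundle_map_measurable[OF u] f] measurable_cong_sets[OF V(1) refl] by blast
      ultimately show "?g u \<in> borel_measurable V" by auto
      show "total_mass V < \<infinity>" using V(2) by (simp add: order_le_less_trans)
      show "AE p in V. p \<in> space V \<longrightarrow> norm (?g u p) \<le> K * b"
      proof (intro AE_I2 impI)
        fix p assume "p \<in> space V"
        then have p: "p \<in> plane_bundle TYPE('d)" by (simp add: sp)
        show "norm (?g u p) \<le> K * b"
          using mult_mono[OF K(2)[OF u p] b(1)[OF bundle_map_in[OF u p]] K(1) norm_ge_zero]
          by (simp add: bundle_jac_nonneg)
      qed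
    qed auto
    have pt: "norm (?g u p - ?g u' p) \<le> (L + K * (1 + P)) * b * \<eta>"
      if p: "p \<in> plane_bundle TYPE('d)" for p :: "(real^'n) \<times> (real^'n^'n)"
    proof -
      let ?q = "bundle_map u p" and ?q' = "bundle_map u' p"
      have q: "?q \<in> plane_bundle TYPE('d)" "?q' \<in> plane_bundle TYPE('d)" using bundle_map_in p u u' by blast+
      have bl: "bilipschitz R (snd (u (fst p)))" "bilipschitz R (snd (u' (fst p)))" using u u' by (auto simp: admissible_def)
      have d2: "norm (snd (u (fst p)) - snd (u' (fst p))) \<le> \<eta>"
        using norm_snd_le'[of "u (fst p) - u' (fst p)"] \<eta>[of "fst p"] by simp
      have d1: "norm (fst (u (fst p)) - fst (u' (fst p))) \<le> \<eta>"
        using norm_fst_le'[of "u (fst p) - u' (fst p)"] \<eta>[of "fst p"] by simp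
      have J: "\<bar>bundle_jac TYPE('d) u p - bundle_jac TYPE('d) u' p\<bar> \<le> L * \<eta>"
        using L(2)[OF bl, of "snd p"] mult_left_mono[OF d2 L(1)] p by (auto simp: bundle_jac_def)
      have "norm (snd ?q - snd ?q') \<le> P * norm (snd (u (fst p)) - snd (u' (fst p)))"
        using image_proj_dist_le[OF bl, of "snd p" "snd p", where 'd = 'd] p bilipschitz_nonneg[OF bl(1)]
        by (auto simp: bundle_map_def P_def)
      then have dq: "norm (fst ?q - fst ?q') + norm (snd ?q - snd ?q') \<le> (1 + P) * \<eta>"
        using d1 mult_left_mono[OF d2 P] by (simp add: bundle_map_def distrib_right)
      have fq: "norm (f ?q - f ?q') \<le> b * ((1 + P) * \<eta>)"
        using l[OF q] mult_left_mono[OF dq b(2)] by linarith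
      have "?g u p - ?g u' p = (bundle_jac TYPE('d) u p - bundle_jac TYPE('d) u' p) *\<^sub>R f ?q
          + bundle_jac TYPE('d) u' p *\<^sub>R (f ?q - f ?q')"
        by (simp add: algebra_simps)
      then have "norm (?g u p - ?g u' p) \<le> \<bar>bundle_jac TYPE('d) u p - bundle_jac TYPE('d) u' p\<bar> * norm (f ?q)
          + bundle_jac TYPE('d) u' p * norm (f ?q - f ?q')"
        using norm_triangle_ineq[of "(bundle_jac TYPE('d) u p - bundle_jac TYPE('d) u' p) *\<^sub>R f ?q" "bundle_jac TYPE('d) u' p *\<^sub>R (f ?q - f ?q')"]
        by (simp add: bundle_jac_nonneg)
      also have "\<dots> \<le> (L * \<eta>) * b + K * (b * ((1 + P) * \<eta>))"
        using J b(1)[OF q(1)] fq K(2)[OF u' p] K(1) L(1) \<eta>0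
        by (intro add_mono mult_mono) (auto simp: bundle_jac_nonneg)
      also have "\<dots> = (L + K * (1 + P)) * b * \<eta>" by (simp add: algebra_simps)
      finally show ?thesis .
    qed
    have "(\<integral>p. f p \<partial>transport TYPE('d) V u) - (\<integral>p. f p \<partial>transport TYPE('d) V u')
        = (\<integral>p. ?g u p - ?g u' p \<partial>V)"
      unfolding integral_transport[OF V(1) u f] integral_transport[OF V(1) u' f]
      by (rule Bochner_Integration.integral_diff[symmetric]) (use int u u' in auto)
    then show "norm ((\<integral>p. f p \<partial>transport TYPE('d) V u) - (\<integral>p. f p \<partial>transport TYPE('d) V u'))
        \<le> m * ((L + K * (1 + P)) * b * \<eta>)"
      using norm_integral_le_const[OF V(2,3), of "\<lambda>p. ?g u p - ?g u' p" "(L + K * (1 + P)) * b * \<eta>"]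
        pt sp L(1) K(1) P b \<eta>0 by (simp add: add_nonneg_nonneg)
  qed
qed

section \<open>The mollifier\<close>

lemma C_k_Suc_D: "C_k (Suc k) f \<Longrightarrow> C_k k f"
proof (induction k arbitrary: f)
  case 0
  then show ?case
    by (auto simp: continuous_on_eq_continuous_at intro: differentiable_imp_continuous_within)
next
  case (Suc k)
  then show ?case by (metis C_k.simps(2))
qed

lemma C_k_SucI:
  assumes "\<And>x. (f has_derivative D x) (at x)" "\<And>v. C_k k (\<lambda>x. D x v)"
  shows "C_k (Suc k) f"
proof -
  have "frechet_derivative f (at x) = D x" for x
    using frechet_derivative_at[OF assms(1)] by simp
  then show ?thesis using assms by (auto simp: differentiable_def)
qed

lemma C_k_SucE:
  assumes "C_k (Suc k) f"
  obtains D where "\<And>x. (f has_derivative D x) (at x)" "\<And>v. C_k k (\<lambda>x. D x v)"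
  using assms that[of "\<lambda>x. frechet_derivative f (at x)"] by (auto simp: frechet_derivative_works[symmetric])

lemma C_k_const: "C_k k (\<lambda>x. c)"
proof (induction k arbitrary: c)
  case (Suc k)
  show ?case by (rule C_k_SucI[where D = "\<lambda>x v. 0"]) (auto intro: Suc)
qed simp

lemma C_k_add: "C_k k f \<Longrightarrow> C_k k g \<Longrightarrow> C_k k (\<lambda>x. f x + g x)"
proof (induction k arbitrary: f g)
  case 0
  then show ?case by (simp add: continuous_on_add)
next
  case (Suc k)
  obtain D where D: "\<And>x. (f has_derivative D x) (at x)" "\<And>v. C_k k (\<lambda>x. D x v)"
    using C_k_SucE[OF Suc.prems(1)] by blast
  obtain E where E: "\<And>x. (g has_derivative E x) (at x)" "\<And>v. C_k k (\<lambda>x. E x v)"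
    using C_k_SucE[OF Suc.prems(2)] by blast
  show ?case
    by (rule C_k_SucI[OF has_derivative_add[OF D(1) E(1)]]) (intro Suc.IH D E)
qed

lemma C_k_mult:
  fixes f g :: "'a::real_normed_vector \<Rightarrow> real"
  shows "C_k k f \<Longrightarrow> C_k k g \<Longrightarrow> C_k k (\<lambda>x. f x * g x)"
proof (induction k arbitrary: f g)
  case 0
  then show ?case by (simp add: continuous_on_mult)
next
  case (Suc k)
  obtain D where D: "\<And>x. (f has_derivative D x) (at x)" "\<And>v. C_k k (\<lambda>x. D x v)"
    using C_k_SucE[OF Suc.prems(1)] by blast
  obtain E where E: "\<And>x. (g has_derivative E x) (at x)" "\<And>v. C_k k (\<lambda>x. E x v)"
    using C_k_SucE[OF Suc.prems(2)] by blast
  show ?case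
    by (rule C_k_SucI[OF has_derivative_mult[OF D(1) E(1)]])
      (intro C_k_add Suc.IH D E C_k_Suc_D[OF Suc.prems(1)] C_k_Suc_D[OF Suc.prems(2)])
qed

lemma C_k_inner: "C_k k (\<lambda>x. x \<bullet> v)"
proof (cases k)
  case (Suc k')
  show ?thesis unfolding Suc
    by (rule C_k_SucI[where D = "\<lambda>x w. w \<bullet> v"]) (auto intro!: C_k_const derivative_eq_intros)
qed (simp add: continuous_intros)

text \<open>The derivative is the same function times a linear one, so the class reproduces itself
  and the induction closes.\<close>

lemma C_k_exp_norm: "C_k k (\<lambda>x :: 'a::real_inner. exp (a * (norm x)\<^sup>2))"
proof (induction k)
  case 0
  show ?case by (auto intro!: continuous_intros)
next
  case (Suc k)
  show ?case
  proof (rule C_k_SucI)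
    show "((\<lambda>x. exp (a * (norm x)\<^sup>2)) has_derivative (\<lambda>v. exp (a * (norm x)\<^sup>2) * ((2 * a) * (x \<bullet> v)))) (at x)" for x :: 'a
      unfolding power2_norm_eq_inner
      by (auto intro!: derivative_eq_intros simp: fun_eq_iff inner_commute)
    show "C_k k (\<lambda>x :: 'a. exp (a * (norm x)\<^sup>2) * ((2 * a) * (x \<bullet> v)))" for v
      by (intro C_k_mult Suc C_k_const C_k_inner)
  qed
qed

lemma C_k_kernel:
  assumes "cutoff \<psi>"
  shows "C_k k (kernel \<psi> \<epsilon>)"
proof -
  have e: "kernel \<psi> \<epsilon> = (\<lambda>x. kernel_const \<psi> \<epsilon> * \<psi> x * ((2 * pi * \<epsilon>\<^sup>2) powr (- real CARD('a) / 2) * exp (- 1 / (2 * \<epsilon>\<^sup>2) * (norm x)\<^sup>2)))"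
    by (auto simp: kernel_def[abs_def] gaussian_def fun_eq_iff)
  have "C_k k \<psi>" using assms by (simp add: cutoff_def C_infinity_def)
  then show ?thesis unfolding e by (intro C_k_mult C_k_const C_k_exp_norm)
qed

lemma continuous_compact_support_bounded:
  fixes f :: "'a::euclidean_space \<Rightarrow> 'b::real_normed_vector"
  assumes "continuous_on UNIV f" "\<And>x. 1 < norm x \<Longrightarrow> f x = 0"
  obtains B where "0 \<le> B" "\<And>x. norm (f x) \<le> B"
proof -
  have "compact (f ` cball 0 1)"
    using assms(1) by (intro compact_continuous_image) (auto intro: continuous_on_subset)
  then have "bounded (f ` cball 0 1)" by (rule compact_imp_bounded)
  then obtain B where B: "0 < B" "\<forall>y\<in>f ` cball 0 1. norm y \<le> B"
    unfolding bounded_pos by blast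
  have "norm (f x) \<le> B" for x
    using B assms(2)[of x] by (cases "1 < norm x") auto
  then show ?thesis using that[of B] B(1) by auto
qed

lemma has_derivative_zero_outside:
  fixes f :: "'a::real_normed_vector \<Rightarrow> 'b::real_normed_vector"
  assumes "(f has_derivative D) (at x)" "\<And>x. 1 < norm x \<Longrightarrow> f x = 0" "1 < norm x"
  shows "D v = 0"
proof -
  have "open {x :: 'a. 1 < norm x}" by (intro open_Collect_less continuous_intros)
  then have "((\<lambda>x. 0) has_derivative D) (at x)"
    by (rule has_derivative_transform_within_open[OF assms(1)]) (use assms in auto)
  then have "D = (\<lambda>v. 0)" using has_derivative_unique has_derivative_const by blast
  then show ?thesis by simp
qed

text \<open>Each derivative along a basis vector is continuous and vanishes outside the unit ball,
  hence is bounded; summing over the basis bounds the operator norm of the derivative, and the mean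
  value inequality applies.\<close>

lemma C1_compact_support_lipschitz:
  fixes f :: "'a::euclidean_space \<Rightarrow> real"
  assumes f: "C_k (Suc 0) f" and supp: "\<And>x. 1 < norm x \<Longrightarrow> f x = 0"
  obtains B where "0 \<le> B" "\<And>x. \<bar>f x\<bar> \<le> B" "\<And>x y. \<bar>f x - f y\<bar> \<le> B * norm (x - y)"
proof -
  obtain D where D: "\<And>x. (f has_derivative D x) (at x)" "\<And>v. C_k 0 (\<lambda>x. D x v)"
    using C_k_SucE[OF f] by blast
  obtain b where b: "0 \<le> b" "\<And>x. norm (f x) \<le> b"
    using continuous_compact_support_bounded[of f] C_k_Suc_D[OF f] supp by auto
  have "\<exists>c. \<forall>x. norm (D x i) \<le> c" for i
  proof -
    have "continuous_on UNIV (\<lambda>x. D x i)" using D(2) by simp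
    moreover have "D x i = 0" if "1 < norm x" for x
      by (rule has_derivative_zero_outside[OF D(1) supp that])
    ultimately show ?thesis using continuous_compact_support_bounded[of "\<lambda>x. D x i"] by metis
  qed
  then obtain c where c: "\<And>i x. norm (D x i) \<le> c i" by metis
  define L where "L = (\<Sum>i\<in>Basis. c i)"
  have "norm (D x v) \<le> L * norm v" for x v
  proof -
    have lin: "linear (D x)" using D(1) has_derivative_linear by blast
    have "D x v = (\<Sum>i\<in>Basis. (v \<bullet> i) * D x i)"
      by (subst euclidean_representation[of v, symmetric]) (simp add: linear_sum[OF lin] linear_scale[OF lin])
    also have "norm \<dots> \<le> (\<Sum>i\<in>Basis. norm v * c i)"
    proof (rule sum_norm_le)
      fix i :: 'a assume i: "i \<in> Basis"
      show "norm ((v \<bullet> i) * D x i) \<le> norm v * c i"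
        using mult_mono[OF Basis_le_norm[OF i] c[of x i] norm_ge_zero norm_ge_zero] by (simp add: abs_mult)
    qed
    finally show ?thesis by (simp add: L_def sum_distrib_left mult.commute)
  qed
  moreover have "0 \<le> L"
    unfolding L_def by (rule sum_nonneg) (rule order_trans[OF norm_ge_zero c[of 0]])
  ultimately have on: "onorm (D x) \<le> L" for x by (intro onorm_bound)
  have lip: "norm (f x - f y) \<le> L * norm (x - y)" for x y
    by (rule differentiable_bound[of UNIV f D]) (use D(1) on in auto)
  show ?thesis
  proof (rule that[of "max b L"])
    show "\<bar>f x - f y\<bar> \<le> max b L * norm (x - y)" for x y
      using lip[of x y] mult_right_mono[of L "max b L" "norm (x - y)"] by simp
  qed (use b in \<open>auto simp: le_max_iff_disj\<close>)
qed

text \<open>The Riesz vector built from the values of \<open>D\<close> on the basis is the only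
  vector representing \<open>D\<close>, which is what pins down the \<open>THE\<close> in
  \<open>gradient\<close>.\<close>

lemma has_derivative_gradient:
  fixes f :: "'a::euclidean_space \<Rightarrow> real"
  assumes "(f has_derivative D) (at x)"
  shows "(f has_derivative (\<lambda>h. h \<bullet> gradient f x)) (at x)" "D v = v \<bullet> gradient f x"
proof -
  define g where "g = (\<Sum>i\<in>Basis. D i *\<^sub>R i)"
  have lin: "linear D" using assms has_derivative_linear by blast
  have eq: "D = (\<lambda>h. h \<bullet> g)"
  proof
    fix h
    have "D h = (\<Sum>i\<in>Basis. (h \<bullet> i) * D i)"
      by (subst euclidean_representation[of h, symmetric]) (simp add: linear_sum[OF lin] linear_scale[OF lin])
    then show "D h = h \<bullet> g" by (simp add: g_def inner_sum_right mult.commute)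
  qed
  have "gradient f x = g"
    unfolding gradient_def
  proof (rule the_equality)
    show "GDERIV f x :> g" using assms eq by (simp add: gderiv_def)
    fix g' assume "GDERIV f x :> g'"
    then have "(\<lambda>h. h \<bullet> g') = D" using assms has_derivative_unique unfolding gderiv_def by blast
    then have "h \<bullet> g' = h \<bullet> g" for h using eq fun_cong[of "\<lambda>h. h \<bullet> g'" D h] by simp
    then have "(g' - g) \<bullet> (g' - g) = 0" using \<open>\<And>h. h \<bullet> g' = h \<bullet> g\<close>[of "g' - g"] by (simp add: inner_diff_right)
    then show "g' = g" by simp
  qed
  then show "(f has_derivative (\<lambda>h. h \<bullet> gradient f x)) (at x)" "D v = v \<bullet> gradient f x"
    using assms eq by auto
qed

lemma euclidean_norm_bound:
  fixes g :: "'a::euclidean_space"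
  assumes "\<And>i. i \<in> Basis \<Longrightarrow> \<bar>i \<bullet> g\<bar> \<le> c i"
  shows "norm g \<le> (\<Sum>i\<in>Basis. c i)"
proof -
  have "norm g \<le> (\<Sum>i\<in>Basis. \<bar>g \<bullet> i\<bar>)" by (rule norm_le_l1)
  also have "\<dots> \<le> (\<Sum>i\<in>Basis. c i)" using assms by (intro sum_mono) (simp add: inner_commute)
  finally show ?thesis .
qed

text \<open>The first-order lemma is applied to \<open>K\<close> and again to each partial
  derivative of \<open>K\<close>. The second application makes the gradient Lipschitz, which the
  derivative of a convolution relies on.\<close>

lemma C2_compact_support:
  fixes K :: "'a::euclidean_space \<Rightarrow> real"
  assumes K: "C_k (Suc (Suc 0)) K" and supp: "\<And>x. 1 < norm x \<Longrightarrow> K x = 0"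
  obtains B where "0 \<le> B" "\<And>x. \<bar>K x\<bar> \<le> B" "\<And>x y. \<bar>K x - K y\<bar> \<le> B * norm (x - y)"
    "\<And>x. norm (gradient K x) \<le> B" "\<And>x y. norm (gradient K x - gradient K y) \<le> B * norm (x - y)"
    "\<And>x. 1 < norm x \<Longrightarrow> gradient K x = 0"
    "\<And>x. (K has_derivative (\<lambda>h. h \<bullet> gradient K x)) (at x)"
proof -
  obtain D where D: "\<And>x. (K has_derivative D x) (at x)" "\<And>v. C_k (Suc 0) (\<lambda>x. D x v)"
    using C_k_SucE[OF K] by blast
  have Dg: "D x v = v \<bullet> gradient K x" for x v by (rule has_derivative_gradient(2)[OF D(1)])
  obtain b where b: "0 \<le> b" "\<And>x. \<bar>K x\<bar> \<le> b" "\<And>x y. \<bar>K x - K y\<bar> \<le> b * norm (x - y)"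
    using C1_compact_support_lipschitz[OF C_k_Suc_D[OF K] supp] by blast
  have z: "D x v = 0" if "1 < norm x" for x v
    by (rule has_derivative_zero_outside[OF D(1) supp that])
  have "\<exists>c\<ge>0. (\<forall>x. \<bar>D x i\<bar> \<le> c) \<and> (\<forall>x y. \<bar>D x i - D y i\<bar> \<le> c * norm (x - y))" for i
    using C1_compact_support_lipschitz[OF D(2)[of i]] z by metis
  then obtain c where c: "\<And>i. 0 \<le> c i" "\<And>i x. \<bar>D x i\<bar> \<le> c i" "\<And>i x y. \<bar>D x i - D y i\<bar> \<le> c i * norm (x - y)"
    by metis
  define C where "C = (\<Sum>i\<in>Basis. c i)"
  have C: "0 \<le> C" unfolding C_def by (intro sum_nonneg c)
  have g1: "norm (gradient K x) \<le> C" for x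
    unfolding C_def by (rule euclidean_norm_bound) (use c(2)[of x] in \<open>simp add: Dg\<close>)
  have g2: "norm (gradient K x - gradient K y) \<le> C * norm (x - y)" for x y
    unfolding C_def sum_distrib_right
    by (rule euclidean_norm_bound) (use c(3)[of x _ y] in \<open>simp add: Dg inner_diff_right\<close>)
  show ?thesis
  proof (rule that[of "max b C"])
    show "\<bar>K x - K y\<bar> \<le> max b C * norm (x - y)" for x y
      using b(3)[of x y] mult_right_mono[of b "max b C" "norm (x - y)"] by simp
    show "norm (gradient K x - gradient K y) \<le> max b C * norm (x - y)" for x y
      using g2[of x y] mult_right_mono[of C "max b C" "norm (x - y)"] by simp
    show "(K has_derivative (\<lambda>h. h \<bullet> gradient K x)) (at x)" for x
      by (rule has_derivative_gradient(1)[OF D(1)])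
    show "gradient K x = 0" if "1 < norm x" for x
      using z[OF that, of "gradient K x"] by (simp add: Dg)
  qed (use b C g1 in \<open>auto simp: le_max_iff_disj\<close>)
qed

text \<open>Subtracting the linear part leaves a function whose derivative at \<open>z\<close> is
  \<open>g z - g x\<close>, of size at most \<open>B * norm (x' - x)\<close> on the ball around
  \<open>x\<close> through \<open>x'\<close>; the mean value inequality on that ball yields the
  square.\<close>

lemma gradient_remainder:
  fixes K :: "'a::euclidean_space \<Rightarrow> real"
  assumes g: "\<And>x y. norm (g x - g y) \<le> B * norm (x - y)" and B: "0 \<le> B"
    and d: "\<And>x. (K has_derivative (\<lambda>h. h \<bullet> g x)) (at x)"
  shows "\<bar>K x' - K x - (x' - x) \<bullet> g x\<bar> \<le> B * (norm (x' - x))\<^sup>2"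
proof -
  let ?S = "cball x (norm (x' - x))" and ?f = "\<lambda>z. K z - z \<bullet> g x"
  have "norm (?f x' - ?f x) \<le> (B * norm (x' - x)) * norm (x' - x)"
  proof (rule differentiable_bound[where S = ?S and f' = "\<lambda>z h. h \<bullet> g z - h \<bullet> g x"])
    show "(?f has_derivative (\<lambda>h. h \<bullet> g z - h \<bullet> g x)) (at z within ?S)" for z
      by (rule has_derivative_at_withinI) (auto intro!: derivative_eq_intros d)
    show "onorm (\<lambda>h. h \<bullet> g z - h \<bullet> g x) \<le> B * norm (x' - x)" if "z \<in> ?S" for z
    proof (rule onorm_bound)
      have "B * norm (z - x) \<le> B * norm (x' - x)"
        using that B by (intro mult_left_mono) (auto simp: dist_norm norm_minus_commute)
      then have gz: "norm (g z - g x) \<le> B * norm (x' - x)" using g[of z x] by linarith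
      show "norm (h \<bullet> g z - h \<bullet> g x) \<le> B * norm (x' - x) * norm h" for h
        using Cauchy_Schwarz_ineq2[of h "g z - g x"] mult_left_mono[OF gz, of "norm h"]
        by (simp add: inner_diff_right mult_ac)
    qed (use B in simp)
  qed (auto simp: dist_norm norm_minus_commute)
  then show ?thesis by (simp add: inner_diff_left power2_eq_square algebra_simps)
qed

section \<open>Convolution with the mollifier\<close>

abbreviation ball_mass :: "'a::euclidean_space itself \<Rightarrow> real" where
  "ball_mass _ \<equiv> measure lborel (cball (0::'a) 1)"

lemma measure_cball: "measure lborel (cball (x::'a::euclidean_space) 1) = ball_mass TYPE('a)"
  by (simp add: content_cball)

text \<open>Two centres are allowed so that a difference of convolutions at two points, however far
  apart, is covered by one bound; the factor 2 counts the balls.\<close>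

lemma lborel_integral_two_balls:
  fixes f :: "'a::euclidean_space \<Rightarrow> 'b::{banach, second_countable_topology}"
  assumes f: "continuous_on UNIV f"
    and supp: "\<And>y. y \<notin> cball x 1 \<Longrightarrow> y \<notin> cball x' 1 \<Longrightarrow> f y = 0"
    and c: "\<And>y. norm (f y) \<le> c"
  shows "integrable lborel f" "norm (\<integral>y. f y \<partial>lborel) \<le> 2 * ball_mass TYPE('a) * c"
proof -
  have c0: "0 \<le> c" using c norm_ge_zero order_trans by blast
  let ?g = "\<lambda>y. c * indicator (cball x 1) y + c * indicator (cball x' 1) y :: real"
  have ind: "integrable lborel (indicator (cball z 1) :: 'a \<Rightarrow> real)" for z
    by (rule integrable_real_indicator[OF _ emeasure_lborel_cball_finite]) simp
  then have ig: "integrable lborel ?g"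
    by (intro Bochner_Integration.integrable_add integrable_mult_right)
  have n: "norm (f y) \<le> ?g y" for y
    using supp[of y] c[of y] c0 by (auto simp: indicator_def)
  show int: "integrable lborel f"
    by (rule Bochner_Integration.integrable_bound[OF ig])
      (use n f in \<open>auto intro!: borel_measurable_continuous_onI AE_I2 intro: order_trans[OF _ abs_ge_self]\<close>)
  have "norm (\<integral>y. f y \<partial>lborel) \<le> (\<integral>y. ?g y \<partial>lborel)"
    by (rule Bochner_Integration.integral_norm_bound_integral[OF int ig]) (rule n)
  also have "\<dots> = c * ball_mass TYPE('a) + c * ball_mass TYPE('a)"
  proof -
    have I: "(\<integral>y. indicator (cball z 1) y \<partial>lborel) = ball_mass TYPE('a)" for z :: 'a
      using measure_cball[of z] by simp
    show ?thesis
      by (subst Bochner_Integration.integral_add; (intro integrable_mult_right ind)?)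
        (simp only: Bochner_Integration.integral_mult_right_zero I)
  qed
  finally show "norm (\<integral>y. f y \<partial>lborel) \<le> 2 * ball_mass TYPE('a) * c" by (simp add: mult_ac)
qed

definition conv :: "('a::euclidean_space \<Rightarrow> real) \<Rightarrow> ('a \<Rightarrow> 'b::{banach, second_countable_topology}) \<Rightarrow> 'a \<Rightarrow> 'b" where
  "conv k w x = (\<integral>y. k (x - y) *\<^sub>R w y \<partial>lborel)"

context
  fixes k :: "'a::euclidean_space \<Rightarrow> real" and b :: real
  assumes k: "continuous_on UNIV k" "\<And>x. 1 < norm x \<Longrightarrow> k x = 0" "\<And>x. \<bar>k x\<bar> \<le> b"
begin

lemma conv_integrand_continuous:
  fixes w :: "'a \<Rightarrow> 'b::{banach, second_countable_topology}"
  assumes "continuous_on UNIV w"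
  shows "continuous_on UNIV (\<lambda>y. k (x - y) *\<^sub>R w y)"
  by (intro continuous_intros assms continuous_on_compose2[OF k(1)]) auto

lemma conv_bound:
  fixes w :: "'a \<Rightarrow> 'b::{banach, second_countable_topology}"
  assumes w: "continuous_on UNIV w" "\<And>y. norm (w y) \<le> W"
  shows "integrable lborel (\<lambda>y. k (x - y) *\<^sub>R w y)"
    and "norm (conv k w x) \<le> 2 * ball_mass TYPE('a) * (b * W)"
proof -
  have b: "0 \<le> b" using k(3) abs_ge_zero order_trans by blast
  have 1: "k (x - y) *\<^sub>R w y = 0" if "y \<notin> cball x 1" for y
    using k(2)[of "x - y"] that by (auto simp: dist_norm not_le)
  have 2: "norm (k (x - y) *\<^sub>R w y) \<le> b * W" for y
    using mult_mono[OF k(3) w(2) b norm_ge_zero] by simp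
  show "integrable lborel (\<lambda>y. k (x - y) *\<^sub>R w y)" "norm (conv k w x) \<le> 2 * ball_mass TYPE('a) * (b * W)"
    unfolding conv_def using lborel_integral_two_balls[OF conv_integrand_continuous[OF w(1)] 1 2] by auto
qed

text \<open>All regularity comes from the kernel: of \<open>w\<close> only continuity and a bound
  are used. This is why uniform bounds on mass suffice for derivative bounds on the mean
  curvature.\<close>

lemma conv_lipschitz:
  fixes w :: "'a \<Rightarrow> 'b::{banach, second_countable_topology}"
  assumes w: "continuous_on UNIV w" "\<And>y. norm (w y) \<le> W"
    and l: "\<And>x y. \<bar>k x - k y\<bar> \<le> l * norm (x - y)" "0 \<le> l"
  shows "norm (conv k w x - conv k w x') \<le> 2 * ball_mass TYPE('a) * (l * norm (x - x') * W)"
proof -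
  have "conv k w x - conv k w x' = (\<integral>y. k (x - y) *\<^sub>R w y - k (x' - y) *\<^sub>R w y \<partial>lborel)"
    unfolding conv_def by (rule Bochner_Integration.integral_diff[symmetric]) (rule conv_bound(1)[OF w])+
  also have "norm \<dots> \<le> 2 * ball_mass TYPE('a) * (l * norm (x - x') * W)"
  proof (rule lborel_integral_two_balls(2))
    show "continuous_on UNIV (\<lambda>y. k (x - y) *\<^sub>R w y - k (x' - y) *\<^sub>R w y)"
      by (intro continuous_on_diff conv_integrand_continuous w)
    show "k (x - y) *\<^sub>R w y - k (x' - y) *\<^sub>R w y = 0" if "y \<notin> cball x 1" "y \<notin> cball x' 1" for y
      using k(2)[of "x - y"] k(2)[of "x' - y"] that by (auto simp: dist_norm not_le)
    show "norm (k (x - y) *\<^sub>R w y - k (x' - y) *\<^sub>R w y) \<le> l * norm (x - x') * W" for y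
      using mult_mono[OF l(1)[of "x - y" "x' - y"] w(2)[of y]] l(2)
      by (simp add: scaleR_left_diff_distrib[symmetric])
  qed
  finally show ?thesis .
qed

lemma conv_diff_right:
  fixes w w' :: "'a \<Rightarrow> 'b::{banach, second_countable_topology}"
  assumes w: "continuous_on UNIV w" "\<And>y. norm (w y) \<le> W"
    and w': "continuous_on UNIV w'" "\<And>y. norm (w' y) \<le> W"
    and e: "\<And>y. norm (w y - w' y) \<le> e"
  shows "norm (conv k w x - conv k w' x) \<le> 2 * ball_mass TYPE('a) * (b * e)"
proof -
  have "conv k w x - conv k w' x = conv k (\<lambda>y. w y - w' y) x"
    unfolding conv_def scaleR_diff_right
    by (rule Bochner_Integration.integral_diff[symmetric]) (rule conv_bound(1)[OF w] conv_bound(1)[OF w'])+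
  then show ?thesis using conv_bound(2)[of "\<lambda>y. w y - w' y" e x] w w' e by (simp add: continuous_on_diff)
qed

end

section \<open>Regularity of a convolution with the mollifier\<close>

definition kernel_bounds :: "real \<Rightarrow> ('a::euclidean_space \<Rightarrow> real) \<Rightarrow> bool" where
  "kernel_bounds B K \<longleftrightarrow> 0 \<le> B \<and> (\<forall>x. 0 \<le> K x \<and> K x \<le> B) \<and> (\<forall>x y. \<bar>K x - K y\<bar> \<le> B * norm (x - y)) \<and>
    (\<forall>x. norm (gradient K x) \<le> B) \<and> (\<forall>x y. norm (gradient K x - gradient K y) \<le> B * norm (x - y)) \<and>
    (\<forall>x. 1 < norm x \<longrightarrow> K x = 0 \<and> gradient K x = 0) \<and>
    (\<forall>x. (K has_derivative (\<lambda>h. h \<bullet> gradient K x)) (at x))"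

lemma kernel_bounds_exist:
  fixes \<psi> :: "real^'n \<Rightarrow> real"
  assumes "cutoff \<psi>"
  obtains B where "kernel_bounds B (kernel \<psi> \<epsilon>)"
proof -
  have p: "0 \<le> \<psi> x" for x using assms unfolding cutoff_def by blast
  have 0: "0 \<le> kernel \<psi> \<epsilon> x" for x
    unfolding kernel_def kernel_const_def gaussian_def
    by (intro mult_nonneg_nonneg divide_nonneg_nonneg Bochner_Integration.integral_nonneg p) auto
  have "\<psi> x = 0" if "1 \<le> norm x" for x using assms that unfolding cutoff_def by blast
  then have supp: "kernel \<psi> \<epsilon> x = 0" if "1 < norm x" for x
    using that by (simp add: kernel_def)
  obtain B where B: "0 \<le> B" "\<And>x. \<bar>kernel \<psi> \<epsilon> x\<bar> \<le> B"
    "\<And>x y. \<bar>kernel \<psi> \<epsilon> x - kernel \<psi> \<epsilon> y\<bar> \<le> B * norm (x - y)"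
    "\<And>x. norm (gradient (kernel \<psi> \<epsilon>) x) \<le> B"
    "\<And>x y. norm (gradient (kernel \<psi> \<epsilon>) x - gradient (kernel \<psi> \<epsilon>) y) \<le> B * norm (x - y)"
    "\<And>x. 1 < norm x \<Longrightarrow> gradient (kernel \<psi> \<epsilon>) x = 0"
    "\<And>x. (kernel \<psi> \<epsilon> has_derivative (\<lambda>h. h \<bullet> gradient (kernel \<psi> \<epsilon>) x)) (at x)"
    using C2_compact_support[OF C_k_kernel[OF assms] supp] by metis
  have "kernel_bounds B (kernel \<psi> \<epsilon>)"
    unfolding kernel_bounds_def using B 0 supp abs_le_D1[OF B(2)] by simp
  then show ?thesis using that by blast
qed

lemma lipschitz_imp_continuous_on:
  fixes f :: "'a::real_normed_vector \<Rightarrow> 'b::real_normed_vector"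
  assumes "\<And>x y. norm (f x - f y) \<le> B * norm (x - y)" "0 \<le> B"
  shows "continuous_on S f"
  by (rule lipschitz_on_continuous_on[of B]) (use assms in \<open>auto simp: lipschitz_on_def dist_norm\<close>)

text \<open>The derivative is put on the kernel, one direction \<open>h\<close> at a time.
  \<open>Blinfun\<close> returns this map only when it is bounded linear, which
  \<open>conv_deriv_bounded_linear\<close> supplies for bounded continuous \<open>w\<close>.\<close>

definition conv_deriv ::
    "('a::euclidean_space \<Rightarrow> real) \<Rightarrow> ('a \<Rightarrow> 'b::euclidean_space) \<Rightarrow> 'a \<Rightarrow> 'a \<Rightarrow>\<^sub>L 'b" where
  "conv_deriv K w x = Blinfun (\<lambda>h. conv (\<lambda>z. h \<bullet> gradient K z) w x)"

context
  fixes K :: "'a::euclidean_space \<Rightarrow> real" and B :: real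
  assumes K: "kernel_bounds B K"
begin

lemma kernel_boundsD:
  "0 \<le> B" "0 \<le> K x" "\<bar>K x\<bar> \<le> B" "\<bar>K x - K y\<bar> \<le> B * norm (x - y)" "norm (gradient K x) \<le> B"
  "norm (gradient K x - gradient K y) \<le> B * norm (x - y)"
  "1 < norm x \<Longrightarrow> K x = 0" "1 < norm x \<Longrightarrow> gradient K x = 0"
  "(K has_derivative (\<lambda>h. h \<bullet> gradient K x)) (at x)"
  using K unfolding kernel_bounds_def by auto

lemma kernel_continuous: "continuous_on S K" "continuous_on S (gradient K)"
  using lipschitz_imp_continuous_on[of K B S] lipschitz_imp_continuous_on[of "gradient K" B S] kernel_boundsD
  by auto

text \<open>These are the hypotheses of the convolution lemmas in their order, so that the
  directional derivative of \<open>K\<close> can itself be used as a kernel. The bounds are linear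
  in \<open>norm h\<close>, which turns pointwise estimates into operator norm estimates.\<close>

lemma directional_kernel:
  "continuous_on UNIV (\<lambda>z. h \<bullet> gradient K z)" "1 < norm x \<Longrightarrow> h \<bullet> gradient K x = 0"
  "\<bar>h \<bullet> gradient K x\<bar> \<le> norm h * B" "\<bar>h \<bullet> gradient K x - h \<bullet> gradient K y\<bar> \<le> (norm h * B) * norm (x - y)"
proof -
  show "continuous_on UNIV (\<lambda>z. h \<bullet> gradient K z)" by (intro continuous_intros kernel_continuous)
  show "1 < norm x \<Longrightarrow> h \<bullet> gradient K x = 0" by (simp add: kernel_boundsD)
  show "\<bar>h \<bullet> gradient K x\<bar> \<le> norm h * B"
    using Cauchy_Schwarz_ineq2[of h "gradient K x"] mult_left_mono[OF kernel_boundsD(5)[of x], of "norm h"] by simp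
  show "\<bar>h \<bullet> gradient K x - h \<bullet> gradient K y\<bar> \<le> (norm h * B) * norm (x - y)"
    using Cauchy_Schwarz_ineq2[of h "gradient K x - gradient K y"]
      mult_left_mono[OF kernel_boundsD(6)[of x y], of "norm h"] by (simp add: inner_diff_right mult_ac)
qed

context
  fixes w :: "'a \<Rightarrow> 'b::euclidean_space" and W :: real
  assumes w: "continuous_on UNIV w" "\<And>y. norm (w y) \<le> W"
begin

lemma conv_deriv_bounded_linear: "bounded_linear (\<lambda>h. conv (\<lambda>z. h \<bullet> gradient K z) w x)"
proof (rule bounded_linear_intro)
  have int: "integrable lborel (\<lambda>y. (h \<bullet> gradient K (x - y)) *\<^sub>R w y)" for h
    by (rule conv_bound(1)[OF directional_kernel(1-3)[where h = h] w])
  show "conv (\<lambda>z. (h + h') \<bullet> gradient K z) w x = conv (\<lambda>z. h \<bullet> gradient K z) w x + conv (\<lambda>z. h' \<bullet> gradient K z) w x" for h h'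
    unfolding conv_def inner_add_left scaleR_left_distrib
    by (rule Bochner_Integration.integral_add) (rule int)+
  show "conv (\<lambda>z. (r *\<^sub>R h) \<bullet> gradient K z) w x = r *\<^sub>R conv (\<lambda>z. h \<bullet> gradient K z) w x" for r h
    unfolding conv_def inner_scaleR_left scaleR_scaleR[symmetric] by (rule integral_scaleR_right)
  show "norm (conv (\<lambda>z. h \<bullet> gradient K z) w x) \<le> norm h * (2 * ball_mass TYPE('a) * (B * W))" for h
    using conv_bound(2)[OF directional_kernel(1-3)[where h = h] w, where x = x] by (simp add: mult_ac)
qed

lemma conv_deriv_apply: "blinfun_apply (conv_deriv K w x) h = conv (\<lambda>z. h \<bullet> gradient K z) w x"
  unfolding conv_deriv_def by (subst bounded_linear_Blinfun_apply[OF conv_deriv_bounded_linear]) simp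

lemma norm_conv_le: "norm (conv K w x) \<le> 2 * ball_mass TYPE('a) * (B * W)"
  using conv_bound(2)[OF kernel_continuous(1) kernel_boundsD(7,3) w] .

lemma norm_conv_deriv_le: "norm (conv_deriv K w x) \<le> 2 * ball_mass TYPE('a) * (B * W)"
proof (rule norm_blinfun_bound)
  show "0 \<le> 2 * ball_mass TYPE('a) * (B * W)"
    using kernel_boundsD(1) order_trans[OF norm_ge_zero w(2)] by simp
  show "norm (blinfun_apply (conv_deriv K w x) h) \<le> 2 * ball_mass TYPE('a) * (B * W) * norm h" for h
    using conv_bound(2)[OF directional_kernel(1-3)[where h = h] w, where x = x] by (simp add: conv_deriv_apply mult_ac)
qed

lemma conv_diff_le: "norm (conv K w x - conv K w x') \<le> 2 * ball_mass TYPE('a) * (B * W) * norm (x - x')"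
  using conv_lipschitz[OF kernel_continuous(1) kernel_boundsD(7,3) w kernel_boundsD(4,1), where x = x and x' = x']
  by (simp add: mult_ac)

lemma conv_deriv_diff_le:
  "norm (conv_deriv K w x - conv_deriv K w x') \<le> 2 * ball_mass TYPE('a) * (B * W) * norm (x - x')"
proof (rule norm_blinfun_bound)
  show "0 \<le> 2 * ball_mass TYPE('a) * (B * W) * norm (x - x')"
    using kernel_boundsD(1) order_trans[OF norm_ge_zero w(2)] by simp
  show "norm (blinfun_apply (conv_deriv K w x - conv_deriv K w x') h) \<le> 2 * ball_mass TYPE('a) * (B * W) * norm (x - x') * norm h" for h
    using conv_lipschitz[OF directional_kernel(1-3)[where h = h] w directional_kernel(4)[where h = h], where x = x and x' = x'] kernel_boundsD(1)
    by (simp add: conv_deriv_apply blinfun.diff_left mult_ac)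
qed

text \<open>The Taylor remainder of the kernel is quadratic uniformly in the integration variable
  and is supported in two unit balls, so integrating it gives an error of order
  \<open>(norm (x' - x))\<^sup>2\<close>; no limit has to be exchanged with the integral.\<close>

lemma conv_has_derivative: "(conv K w has_derivative blinfun_apply (conv_deriv K w x)) (at x)"
proof (rule has_derivativeI_sandwich[of 1])
  let ?C = "2 * ball_mass TYPE('a) * (B * W)"
  show "bounded_linear (blinfun_apply (conv_deriv K w x))" by (rule blinfun.bounded_linear_right)
  show "((\<lambda>y. ?C * norm (y - x)) \<longlongrightarrow> 0) (at x)"
    by (auto intro!: tendsto_eq_intros)
  fix x' assume "x' \<noteq> x"
  let ?r = "\<lambda>z. K (x' - x + z) - K z - (x' - x) \<bullet> gradient K z"
  have W: "0 \<le> W" using order_trans[OF norm_ge_zero w(2)] .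
  have ia: "integrable lborel (\<lambda>y. K (z - y) *\<^sub>R w y)" for z
    by (rule conv_bound(1)[OF kernel_continuous(1) kernel_boundsD(7,3) w])
  have ic: "integrable lborel (\<lambda>y. ((x' - x) \<bullet> gradient K (x - y)) *\<^sub>R w y)"
    by (rule conv_bound(1)[OF directional_kernel(1-3)[where h = "x' - x"] w])
  have "conv K w x' - conv K w x - blinfun_apply (conv_deriv K w x) (x' - x)
      = (\<integral>y. K (x' - y) *\<^sub>R w y - K (x - y) *\<^sub>R w y - ((x' - x) \<bullet> gradient K (x - y)) *\<^sub>R w y \<partial>lborel)"
    unfolding conv_deriv_apply conv_def
    by (simp only: Bochner_Integration.integral_diff[OF ia ia]
        Bochner_Integration.integral_diff[OF Bochner_Integration.integrable_diff[OF ia ia] ic])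
  also have "norm \<dots> \<le> 2 * ball_mass TYPE('a) * (B * (norm (x' - x))\<^sup>2 * W)"
  proof (rule lborel_integral_two_balls(2))
    show "continuous_on UNIV (\<lambda>y. K (x' - y) *\<^sub>R w y - K (x - y) *\<^sub>R w y - ((x' - x) \<bullet> gradient K (x - y)) *\<^sub>R w y)"
      by (intro continuous_on_diff conv_integrand_continuous[OF kernel_continuous(1) kernel_boundsD(7,3) w(1)]
          conv_integrand_continuous[OF directional_kernel(1-3)[where h = "x' - x"] w(1)])
    show "K (x' - y) *\<^sub>R w y - K (x - y) *\<^sub>R w y - ((x' - x) \<bullet> gradient K (x - y)) *\<^sub>R w y = 0"
      if "y \<notin> cball x' 1" "y \<notin> cball x 1" for y
      using kernel_boundsD(7)[of "x - y"] kernel_boundsD(7)[of "x' - y"] kernel_boundsD(8)[of "x - y"] that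
      by (auto simp: dist_norm not_le)
    show "norm (K (x' - y) *\<^sub>R w y - K (x - y) *\<^sub>R w y - ((x' - x) \<bullet> gradient K (x - y)) *\<^sub>R w y)
        \<le> B * (norm (x' - x))\<^sup>2 * W" for y
    proof -
      have "\<bar>K (x' - y) - K (x - y) - (x' - x) \<bullet> gradient K (x - y)\<bar> \<le> B * (norm (x' - x))\<^sup>2"
        using gradient_remainder[OF kernel_boundsD(6,1,9), of "x' - y" "x - y"] by simp
      from mult_mono[OF this w(2)[of y]] show ?thesis
        using kernel_boundsD(1) by (simp add: scaleR_left_diff_distrib[symmetric])
    qed
  qed
  finally have "norm (conv K w x' - conv K w x - blinfun_apply (conv_deriv K w x) (x' - x)) \<le> (?C * norm (x' - x)) * norm (x' - x)"
    by (simp add: power2_eq_square mult_ac)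
  then show "norm (conv K w x' - conv K w x - blinfun_apply (conv_deriv K w x) (x' - x)) / norm (x' - x) \<le> ?C * norm (x' - x)"
    using \<open>x' \<noteq> x\<close> by (simp add: divide_le_eq)
qed simp

end

lemma conv_deriv_diff_right:
  fixes w w' :: "'a \<Rightarrow> 'b::euclidean_space"
  assumes w: "continuous_on UNIV w" "\<And>y. norm (w y) \<le> W"
    and w': "continuous_on UNIV w'" "\<And>y. norm (w' y) \<le> W"
    and e: "\<And>y. norm (w y - w' y) \<le> e"
  shows "norm (conv_deriv K w x - conv_deriv K w' x) \<le> 2 * ball_mass TYPE('a) * (B * e)"
proof (rule norm_blinfun_bound)
  show "0 \<le> 2 * ball_mass TYPE('a) * (B * e)"
    using kernel_boundsD(1) order_trans[OF norm_ge_zero e] by simp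
  show "norm (blinfun_apply (conv_deriv K w x - conv_deriv K w' x) h) \<le> 2 * ball_mass TYPE('a) * (B * e) * norm h" for h
    using conv_diff_right[OF directional_kernel(1-3)[where h = h] w w' e, where x = x]
    by (simp add: conv_deriv_apply[OF w] conv_deriv_apply[OF w'] blinfun.diff_left mult_ac)
qed

end

section \<open>The approximate mean curvature\<close>

context
  fixes \<psi> :: "real^'n \<Rightarrow> real" and \<epsilon> B :: real
  assumes K: "kernel_bounds B (kernel \<psi> \<epsilon>)" and \<epsilon>: "0 < \<epsilon>"
begin

text \<open>With \<open>gradient_test\<close>, this places the integrands of the smoothed mass and
  of the smoothed first variation in the class handled by
  \<open>integral_transport_lipschitz\<close>, with a constant independent of
  \<open>y\<close>.\<close>

lemma kernel_test:
  "bundle_lipschitz TYPE('d::finite) B (\<lambda>p. kernel \<psi> \<epsilon> (fst p - y))"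
  unfolding bundle_lipschitz_def
proof (intro conjI ballI)
  show "0 \<le> B" by (rule kernel_boundsD(1)[OF K])
  show "continuous_on (plane_bundle TYPE('d)) (\<lambda>p. kernel \<psi> \<epsilon> (fst p - y))"
    by (rule continuous_on_compose2[OF kernel_continuous(1)[OF K, of UNIV]]) (auto intro!: continuous_intros)
  show "norm (kernel \<psi> \<epsilon> (fst p - y)) \<le> B" for p :: "(real^'n) \<times> (real^'n^'n)"
    using kernel_boundsD(3)[OF K] by simp
  show "norm (kernel \<psi> \<epsilon> (fst p - y) - kernel \<psi> \<epsilon> (fst q - y)) \<le> B * (norm (fst p - fst q) + norm (snd p - snd q))"
    for p q :: "(real^'n) \<times> (real^'n^'n)"
    using kernel_boundsD(4)[OF K, of "fst p - y" "fst q - y"] kernel_boundsD(1)[OF K]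
      mult_left_mono[of "norm (fst p - fst q)" "norm (fst p - fst q) + norm (snd p - snd q)" B] by simp
qed

lemma gradient_test:
  "bundle_lipschitz TYPE('d::finite) B (\<lambda>p. snd p *v gradient (kernel \<psi> \<epsilon>) (fst p - y))"
  unfolding bundle_lipschitz_def
proof (intro conjI ballI)
  let ?g = "gradient (kernel \<psi> \<epsilon>)"
  show "0 \<le> B" by (rule kernel_boundsD(1)[OF K])
  have g: "continuous_on (plane_bundle TYPE('d)) (\<lambda>p. ?g (fst p - y))"
    by (rule continuous_on_compose2[OF kernel_continuous(2)[OF K, of UNIV]]) (auto intro!: continuous_intros)
  show "continuous_on (plane_bundle TYPE('d)) (\<lambda>p. snd p *v ?g (fst p - y))"
    unfolding matrix_vector_mult_def by (intro continuous_intros g)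
  show "norm (snd p *v ?g (fst p - y)) \<le> B" if "p \<in> plane_bundle TYPE('d)" for p
    using norm_proj_vec_le[of "snd p" "?g (fst p - y)", where 'd = 'd] kernel_boundsD(5)[OF K, of "fst p - y"] that
    by (auto intro: order_trans)
  show "norm (snd p *v ?g (fst p - y) - snd q *v ?g (fst q - y)) \<le> B * (norm (fst p - fst q) + norm (snd p - snd q))"
    if p: "p \<in> plane_bundle TYPE('d)" for p q
  proof -
    have "snd p *v ?g (fst p - y) - snd q *v ?g (fst q - y)
        = snd p *v (?g (fst p - y) - ?g (fst q - y)) + (snd p - snd q) *v ?g (fst q - y)"
      by (simp add: matrix_vector_mult_diff_rdistrib matrix_vector_mult_diff_distrib)
    also have "norm \<dots> \<le> B * norm (fst p - fst q) + norm (snd p - snd q) * B"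
    proof (rule norm_triangle_le[OF add_mono])
      have "norm (snd p *v (?g (fst p - y) - ?g (fst q - y))) \<le> norm (?g (fst p - y) - ?g (fst q - y))"
        using norm_proj_vec_le[of "snd p", where 'd = 'd] p by auto
      also have "\<dots> \<le> B * norm (fst p - fst q)" using kernel_boundsD(6)[OF K, of "fst p - y" "fst q - y"] by simp
      finally show "norm (snd p *v (?g (fst p - y) - ?g (fst q - y))) \<le> B * norm (fst p - fst q)" .
      show "norm ((snd p - snd q) *v ?g (fst q - y)) \<le> norm (snd p - snd q) * B"
        using norm_matrix_vector_mult_le[of "snd p - snd q" "?g (fst q - y)"]
          mult_left_mono[OF kernel_boundsD(5)[OF K, of "fst q - y"], of "norm (snd p - snd q)"] by simp
    qed
    finally show ?thesis by (simp add: distrib_left mult.commute)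
  qed
qed

lemma gradient_test_shift:
  assumes "p \<in> plane_bundle TYPE('d::finite)"
  shows "norm (snd p *v gradient (kernel \<psi> \<epsilon>) (fst p - y) - snd p *v gradient (kernel \<psi> \<epsilon>) (fst p - y')) \<le> B * norm (y - y')"
proof -
  have "norm (snd p *v (gradient (kernel \<psi> \<epsilon>) (fst p - y) - gradient (kernel \<psi> \<epsilon>) (fst p - y')))
      \<le> norm (gradient (kernel \<psi> \<epsilon>) (fst p - y) - gradient (kernel \<psi> \<epsilon>) (fst p - y'))"
    using norm_proj_vec_le[of "snd p", where 'd = 'd] assms by auto
  also have "\<dots> \<le> B * norm (y - y')"
    using kernel_boundsD(6)[OF K, of "fst p - y" "fst p - y'"] by (simp add: norm_minus_commute)
  finally show ?thesis by (simp add: matrix_vector_mult_diff_distrib)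
qed

lemma bundle_lipschitz_integrable:
  fixes f :: "(real^'n) \<times> (real^'n^'n) \<Rightarrow> 'b::{banach, second_countable_topology}"
  assumes f: "bundle_lipschitz TYPE('d::finite) b f"
    and V: "sets V = sets (bundle_borel TYPE('d))" "total_mass V \<le> ennreal m"
  shows "integrable V f"
proof (rule integrableI_bounded_set[where A = "space V" and B = b])
  show "f \<in> borel_measurable V"
    using f bundle_measurable_continuous measurable_cong_sets[OF V(1) refl] unfolding bundle_lipschitz_def by blast
  show "total_mass V < \<infinity>" using V(2) by (simp add: order_le_less_trans)
  have "space V = plane_bundle TYPE('d)"
    by (rule space_plane_bundle[OF V(1)])
  then show "AE p in V. p \<in> space V \<longrightarrow> norm (f p) \<le> b"
    using f unfolding bundle_lipschitz_def by (intro AE_I2) blast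
qed auto

context
  fixes V :: "((real^'n) \<times> (real^'n^'n)) measure" and m :: real
  assumes V: "sets V = sets (bundle_borel TYPE('d::finite))" "total_mass V \<le> ennreal m" and m: "0 \<le> m"
begin

lemma smoothed_mass_eq: "smoothed_mass \<psi> \<epsilon> V y = (\<integral>p. kernel \<psi> \<epsilon> (fst p - y) \<partial>V)"
  unfolding smoothed_mass_def mass_measure_def
proof (rule integral_distr)
  have "continuous_on (plane_bundle TYPE('d)) fst" by (intro continuous_intros)
  then show "fst \<in> borel_measurable V"
    using bundle_measurable_continuous measurable_cong_sets[OF V(1) refl] by blast
  have "continuous_on UNIV (\<lambda>x. kernel \<psi> \<epsilon> (x - y))"
    by (rule continuous_on_compose2[OF kernel_continuous(1)[OF K, of UNIV]]) (auto intro!: continuous_intros)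
  then show "(\<lambda>x. kernel \<psi> \<epsilon> (x - y)) \<in> borel_measurable borel" by (rule borel_measurable_continuous_onI)
qed

lemma space_V: "space V = plane_bundle TYPE('d)"
  by (rule space_plane_bundle[OF V(1)])

lemma smoothed_mass_nonneg: "0 \<le> smoothed_mass \<psi> \<epsilon> V y"
  unfolding smoothed_mass_eq using kernel_boundsD(2)[OF K] by (simp add: Bochner_Integration.integral_nonneg)

lemma smoothed_mass_lipschitz: "norm (smoothed_mass \<psi> \<epsilon> V y - smoothed_mass \<psi> \<epsilon> V y') \<le> (m * B) * norm (y - y')"
proof -
  have "smoothed_mass \<psi> \<epsilon> V y - smoothed_mass \<psi> \<epsilon> V y'
      = (\<integral>p. kernel \<psi> \<epsilon> (fst p - y) - kernel \<psi> \<epsilon> (fst p - y') \<partial>V)"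
    unfolding smoothed_mass_eq
    by (rule Bochner_Integration.integral_diff[symmetric]) (rule bundle_lipschitz_integrable[OF kernel_test V])+
  also have "norm \<dots> \<le> m * (B * norm (y - y'))"
  proof (rule norm_integral_le_const[OF V(2) m])
    show "norm (kernel \<psi> \<epsilon> (fst p - y) - kernel \<psi> \<epsilon> (fst p - y')) \<le> B * norm (y - y')" for p :: "(real^'n) \<times> (real^'n^'n)"
      using kernel_boundsD(4)[OF K, of "fst p - y" "fst p - y'"] by (simp add: norm_minus_commute)
  qed (use kernel_boundsD(1)[OF K] in simp)
  finally show ?thesis by simp
qed

lemma smoothed_first_variation_bound: "norm (smoothed_first_variation \<psi> \<epsilon> V y) \<le> m * B"
  unfolding smoothed_first_variation_def
  by (rule norm_integral_le_const[OF V(2) m])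
    (use gradient_test[of y, where 'd = 'd] kernel_boundsD(1)[OF K] in \<open>auto simp: bundle_lipschitz_def space_V\<close>)

lemma smoothed_first_variation_lipschitz:
  "norm (smoothed_first_variation \<psi> \<epsilon> V y - smoothed_first_variation \<psi> \<epsilon> V y') \<le> (m * B) * norm (y - y')"
proof -
  let ?f = "\<lambda>y p. snd p *v gradient (kernel \<psi> \<epsilon>) (fst p - y)"
  have "smoothed_first_variation \<psi> \<epsilon> V y - smoothed_first_variation \<psi> \<epsilon> V y' = (\<integral>p. ?f y p - ?f y' p \<partial>V)"
    unfolding smoothed_first_variation_def
    by (rule Bochner_Integration.integral_diff[symmetric]) (rule bundle_lipschitz_integrable[OF gradient_test V])+
  also have "norm \<dots> \<le> m * (B * norm (y - y'))"
    by (rule norm_integral_le_const[OF V(2) m])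
      (use gradient_test_shift[where 'd = 'd] kernel_boundsD(1)[OF K] in \<open>auto simp: space_V\<close>)
  finally show ?thesis by simp
qed

lemma pre_mean_curvature_continuous: "continuous_on UNIV (pre_mean_curvature \<psi> \<epsilon> V)"
proof -
  have mB: "0 \<le> m * B" using m kernel_boundsD(1)[OF K] by simp
  have "smoothed_mass \<psi> \<epsilon> V y + \<epsilon> \<noteq> 0" for y using smoothed_mass_nonneg[of y] \<epsilon> by simp
  then show ?thesis unfolding pre_mean_curvature_def[abs_def]
    by (intro continuous_intros lipschitz_imp_continuous_on[OF smoothed_mass_lipschitz mB]
        lipschitz_imp_continuous_on[OF smoothed_first_variation_lipschitz mB]) auto
qed

text \<open>The \<epsilon> added in the denominator gives this bound even where the varifold has no
  mass nearby.\<close>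

lemma pre_mean_curvature_bound: "norm (pre_mean_curvature \<psi> \<epsilon> V y) \<le> m * B / \<epsilon>"
proof -
  have "norm (pre_mean_curvature \<psi> \<epsilon> V y) = norm (smoothed_first_variation \<psi> \<epsilon> V y) / (smoothed_mass \<psi> \<epsilon> V y + \<epsilon>)"
    using smoothed_mass_nonneg[of y] \<epsilon> by (simp add: pre_mean_curvature_def divide_inverse mult.commute)
  also have "\<dots> \<le> m * B / \<epsilon>"
    using smoothed_mass_nonneg[of y] \<epsilon> smoothed_first_variation_bound[of y] m kernel_boundsD(1)[OF K] by (intro frac_le) auto
  finally show ?thesis .
qed

end

text \<open>Change the numerator first, then the denominator. Both denominators are at least
  \<epsilon>, which produces \<open>1 / \<epsilon>\<close> for the first change and
  \<open>c / \<epsilon>\<^sup>2\<close> for the second.\<close>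

lemma quotient_diff_le:
  fixes v v' :: "'b::real_normed_vector"
  assumes "0 \<le> a" "0 \<le> a'" "norm v' \<le> c" "norm (v - v') \<le> e" "\<bar>a - a'\<bar> \<le> e"
  shows "norm (v /\<^sub>R (a + \<epsilon>) - v' /\<^sub>R (a' + \<epsilon>)) \<le> (1 / \<epsilon> + c / \<epsilon>\<^sup>2) * e"
proof -
  have p: "0 < a + \<epsilon>" "0 < a' + \<epsilon>" using assms \<epsilon> by auto
  have inv: "inverse (a + \<epsilon>) - inverse (a' + \<epsilon>) = (a' - a) / ((a + \<epsilon>) * (a' + \<epsilon>))"
    using p by (simp add: field_simps)
  have eq: "v /\<^sub>R (a + \<epsilon>) - v' /\<^sub>R (a' + \<epsilon>)
      = (v - v') /\<^sub>R (a + \<epsilon>) + ((a' - a) / ((a + \<epsilon>) * (a' + \<epsilon>))) *\<^sub>R v'"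
    unfolding inv[symmetric] by (simp only: scaleR_left_diff_distrib scaleR_right_diff_distrib) simp
  have 1: "norm ((v - v') /\<^sub>R (a + \<epsilon>)) \<le> e / \<epsilon>"
  proof -
    have "norm ((v - v') /\<^sub>R (a + \<epsilon>)) = norm (v - v') / (a + \<epsilon>)" using p by (simp add: divide_inverse mult.commute)
    also have "\<dots> \<le> e / \<epsilon>" using assms \<epsilon> order_trans[OF norm_ge_zero assms(4)] by (intro frac_le) auto
    finally show ?thesis .
  qed
  have 2: "norm (((a' - a) / ((a + \<epsilon>) * (a' + \<epsilon>))) *\<^sub>R v') \<le> e / \<epsilon>\<^sup>2 * c"
  proof -
    have "\<bar>a' - a\<bar> / ((a + \<epsilon>) * (a' + \<epsilon>)) \<le> e / (\<epsilon> * \<epsilon>)"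
      using assms \<epsilon> by (intro frac_le mult_mono) (auto simp: abs_minus_commute)
    then have "\<bar>a' - a\<bar> / ((a + \<epsilon>) * (a' + \<epsilon>)) * norm v' \<le> e / (\<epsilon> * \<epsilon>) * c"
      using assms p \<epsilon> order_trans[OF abs_ge_zero assms(5)] by (intro mult_mono) auto
    then show ?thesis using p by (simp add: abs_mult power2_eq_square)
  qed
  show ?thesis unfolding eq
    using norm_triangle_le[OF add_mono[OF 1 2]] by (simp add: algebra_simps)
qed

lemma pre_mean_curvature_stable:
  assumes V0: "sets V0 = sets (bundle_borel TYPE('d::finite))" "total_mass V0 \<le> ennreal m0" "0 \<le> m0"
    and m: "0 \<le> m"
  obtains L where "0 \<le> L"
    "\<And>u u' \<eta> y. u \<in> deformations TYPE('d) V0 R m \<Longrightarrow> u' \<in> deformations TYPE('d) V0 R m \<Longrightarrow> (\<And>x. norm (u x - u' x) \<le> \<eta>) \<Longrightarrow>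
      norm (pre_mean_curvature \<psi> \<epsilon> (transport TYPE('d) V0 u) y - pre_mean_curvature \<psi> \<epsilon> (transport TYPE('d) V0 u') y) \<le> L * \<eta>"
proof -
  note B = kernel_boundsD(1)[OF K]
  \<comment> \<open>An obtained fact is monomorphic in the value type, so the scalar mass and the
    vector-valued first variation need separate instances.\<close>
  obtain C1 where C1: "0 \<le> C1"
    "\<And>V m u u' (f :: (real^'n) \<times> (real^'n^'n) \<Rightarrow> real) b \<eta>.
       sets V = sets (bundle_borel TYPE('d)) \<Longrightarrow> total_mass V \<le> ennreal m \<Longrightarrow> 0 \<le> m \<Longrightarrow>
       admissible R u \<Longrightarrow> admissible R u' \<Longrightarrow> bundle_lipschitz TYPE('d) b f \<Longrightarrow> (\<And>x. norm (u x - u' x) \<le> \<eta>) \<Longrightarrow>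
       norm ((\<integral>p. f p \<partial>transport TYPE('d) V u) - (\<integral>p. f p \<partial>transport TYPE('d) V u')) \<le> m * (C1 * b * \<eta>)"
    by (rule integral_transport_lipschitz[of R, where 'd = 'd and 'n = 'n and 'b = real]) blast
  obtain C2 where C2: "0 \<le> C2"
    "\<And>V m u u' (f :: (real^'n) \<times> (real^'n^'n) \<Rightarrow> real^'n) b \<eta>.
       sets V = sets (bundle_borel TYPE('d)) \<Longrightarrow> total_mass V \<le> ennreal m \<Longrightarrow> 0 \<le> m \<Longrightarrow>
       admissible R u \<Longrightarrow> admissible R u' \<Longrightarrow> bundle_lipschitz TYPE('d) b f \<Longrightarrow> (\<And>x. norm (u x - u' x) \<le> \<eta>) \<Longrightarrow>
       norm ((\<integral>p. f p \<partial>transport TYPE('d) V u) - (\<integral>p. f p \<partial>transport TYPE('d) V u')) \<le> m * (C2 * b * \<eta>)"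
    by (rule integral_transport_lipschitz[of R, where 'd = 'd and 'n = 'n and 'b = "real^'n"]) blast
  define C where "C = m0 * ((C1 + C2) * B)"
  have C: "0 \<le> C" using V0(3) C1(1) C2(1) B by (simp add: C_def)
  show ?thesis
  proof (rule that[of "(1 / \<epsilon> + m * B / \<epsilon>\<^sup>2) * C"])
    show "0 \<le> (1 / \<epsilon> + m * B / \<epsilon>\<^sup>2) * C" using C \<epsilon> m B by simp
    fix u u' \<eta> y
    assume uu: "u \<in> deformations TYPE('d) V0 R m" "u' \<in> deformations TYPE('d) V0 R m"
      and \<eta>: "\<And>x. norm (u x - u' x) \<le> \<eta>"
    note u = uu(1)[THEN deformationsD(1)] and u' = uu(2)[THEN deformationsD(1)]
      and mass = uu(1)[THEN deformationsD(2)] uu(2)[THEN deformationsD(2)]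
    let ?V = "transport TYPE('d) V0 u" and ?V' = "transport TYPE('d) V0 u'"
    have \<eta>0: "0 \<le> \<eta>" using order_trans[OF norm_ge_zero \<eta>] .
    have nn: "0 \<le> m0 * (B * \<eta>)" using V0(3) B \<eta>0 by simp
    have "(m0 * (B * \<eta>)) * C1 \<le> (m0 * (B * \<eta>)) * (C1 + C2)"
      "(m0 * (B * \<eta>)) * C2 \<le> (m0 * (B * \<eta>)) * (C1 + C2)"
      by (rule mult_left_mono[OF _ nn]; use C1(1) C2(1) in simp)+
    then have c1: "m0 * (C1 * B * \<eta>) \<le> C * \<eta>" and c2: "m0 * (C2 * B * \<eta>) \<le> C * \<eta>"
      unfolding C_def by (simp_all only: mult_ac)
    have 1: "\<bar>smoothed_mass \<psi> \<epsilon> ?V y - smoothed_mass \<psi> \<epsilon> ?V' y\<bar> \<le> C * \<eta>"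
    proof -
      have "norm ((\<integral>p. kernel \<psi> \<epsilon> (fst p - y) \<partial>?V) - (\<integral>p. kernel \<psi> \<epsilon> (fst p - y) \<partial>?V')) \<le> m0 * (C1 * B * \<eta>)"
        by (rule C1(2)[OF V0 u u' kernel_test \<eta>])
      then show ?thesis using c1
        by (simp add: smoothed_mass_eq[OF sets_transport mass(1) m] smoothed_mass_eq[OF sets_transport mass(2) m])
    qed
    have 2: "norm (smoothed_first_variation \<psi> \<epsilon> ?V y - smoothed_first_variation \<psi> \<epsilon> ?V' y) \<le> C * \<eta>"
    proof -
      have "norm (smoothed_first_variation \<psi> \<epsilon> ?V y - smoothed_first_variation \<psi> \<epsilon> ?V' y) \<le> m0 * (C2 * B * \<eta>)"
        unfolding smoothed_first_variation_def
        by (rule C2(2)[OF V0 u u' gradient_test \<eta>])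
      then show ?thesis using c2 by simp
    qed
    have "norm (pre_mean_curvature \<psi> \<epsilon> ?V y - pre_mean_curvature \<psi> \<epsilon> ?V' y)
        = norm (smoothed_first_variation \<psi> \<epsilon> ?V y /\<^sub>R (smoothed_mass \<psi> \<epsilon> ?V y + \<epsilon>)
          - smoothed_first_variation \<psi> \<epsilon> ?V' y /\<^sub>R (smoothed_mass \<psi> \<epsilon> ?V' y + \<epsilon>))"
      unfolding pre_mean_curvature_def by (simp add: norm_minus_commute)
    also have "\<dots> \<le> (1 / \<epsilon> + (m * B) / \<epsilon>\<^sup>2) * (C * \<eta>)"
      by (rule quotient_diff_le[OF smoothed_mass_nonneg[OF sets_transport mass(1) m]
            smoothed_mass_nonneg[OF sets_transport mass(2) m]
            smoothed_first_variation_bound[OF sets_transport mass(2) m] 2 1])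
    finally show "norm (pre_mean_curvature \<psi> \<epsilon> ?V y - pre_mean_curvature \<psi> \<epsilon> ?V' y) \<le> (1 / \<epsilon> + m * B / \<epsilon>\<^sup>2) * C * \<eta>"
      by (simp add: mult.assoc)
  qed
qed

end

lemma approx_mean_curvature_conv:
  "approx_mean_curvature \<psi> \<epsilon> V = conv (kernel \<psi> \<epsilon>) (pre_mean_curvature \<psi> \<epsilon> V)"
  by (simp add: fun_eq_iff approx_mean_curvature_def conv_def)

definition curvature_deriv ::
    "(real^'n \<Rightarrow> real) \<Rightarrow> real \<Rightarrow> ((real^'n) \<times> (real^'n^'n)) measure \<Rightarrow> real^'n \<Rightarrow> (real^'n) \<Rightarrow>\<^sub>L (real^'n)" where
  "curvature_deriv \<psi> \<epsilon> V = conv_deriv (kernel \<psi> \<epsilon>) (pre_mean_curvature \<psi> \<epsilon> V)"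

text \<open>The point is uniformity: the varifold enters only through its mass being at most
  \<open>m\<close>, so a single \<open>L\<close> serves every node of every subdivision.\<close>

definition curvature_bound ::
    "'d::finite itself \<Rightarrow> (real^'n \<Rightarrow> real) \<Rightarrow> real \<Rightarrow> real \<Rightarrow> real \<Rightarrow> bool" where
  "curvature_bound D \<psi> \<epsilon> m L \<longleftrightarrow> 0 \<le> L \<and>
    (\<forall>V. sets V = sets (bundle_borel D) \<and> total_mass V \<le> ennreal m \<longrightarrow>
      (\<forall>x. (approx_mean_curvature \<psi> \<epsilon> V has_derivative blinfun_apply (curvature_deriv \<psi> \<epsilon> V x)) (at x) \<and>
        norm (approx_mean_curvature \<psi> \<epsilon> V x) \<le> L \<and> norm (curvature_deriv \<psi> \<epsilon> V x) \<le> L) \<and>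
      (\<forall>x y. norm (approx_mean_curvature \<psi> \<epsilon> V x - approx_mean_curvature \<psi> \<epsilon> V y) \<le> L * norm (x - y) \<and>
        norm (curvature_deriv \<psi> \<epsilon> V x - curvature_deriv \<psi> \<epsilon> V y) \<le> L * norm (x - y)))"

lemma curvature_boundD:
  assumes "curvature_bound TYPE('d::finite) \<psi> \<epsilon> m L"
    and "sets V = sets (bundle_borel TYPE('d))" "total_mass V \<le> ennreal m"
  shows "(approx_mean_curvature \<psi> \<epsilon> V has_derivative blinfun_apply (curvature_deriv \<psi> \<epsilon> V x)) (at x)"
    "norm (approx_mean_curvature \<psi> \<epsilon> V x) \<le> L" "norm (curvature_deriv \<psi> \<epsilon> V x) \<le> L"
    "norm (approx_mean_curvature \<psi> \<epsilon> V x - approx_mean_curvature \<psi> \<epsilon> V y) \<le> L * norm (x - y)"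
    "norm (curvature_deriv \<psi> \<epsilon> V x - curvature_deriv \<psi> \<epsilon> V y) \<le> L * norm (x - y)"
  using assms unfolding curvature_bound_def by blast+

lemma curvature_bound_exists:
  fixes \<psi> :: "real^'n \<Rightarrow> real"
  assumes \<psi>: "cutoff \<psi>" and \<epsilon>: "0 < \<epsilon>" and m: "0 \<le> m"
  obtains L where "curvature_bound TYPE('d::finite) \<psi> \<epsilon> m L"
proof -
  obtain B where K: "kernel_bounds B (kernel \<psi> \<epsilon>)" using kernel_bounds_exist[OF \<psi>] .
  have w: "continuous_on UNIV (pre_mean_curvature \<psi> \<epsilon> V)" "norm (pre_mean_curvature \<psi> \<epsilon> V y) \<le> m * B / \<epsilon>"
    if "sets V = sets (bundle_borel TYPE('d))" "total_mass V \<le> ennreal m" for V y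
    using pre_mean_curvature_continuous[OF K \<epsilon> that m] pre_mean_curvature_bound[OF K \<epsilon> that m] by auto
  have "0 \<le> 2 * ball_mass TYPE(real^'n) * (B * (m * B / \<epsilon>))"
    using m \<epsilon> kernel_boundsD(1)[OF K] by simp
  then have "curvature_bound TYPE('d) \<psi> \<epsilon> m (2 * ball_mass TYPE(real^'n) * (B * (m * B / \<epsilon>)))"
    unfolding curvature_bound_def approx_mean_curvature_conv curvature_deriv_def
    using conv_has_derivative[OF K w] norm_conv_le[OF K w] norm_conv_deriv_le[OF K w] conv_diff_le[OF K w]
      conv_deriv_diff_le[OF K w] by blast
  then show ?thesis by (rule that)
qed

lemma curvature_stability:
  fixes \<psi> :: "real^'n \<Rightarrow> real"
  assumes \<psi>: "cutoff \<psi>" and \<epsilon>: "0 < \<epsilon>" and m: "0 \<le> m"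
    and V0: "sets V0 = sets (bundle_borel TYPE('d::finite))" "total_mass V0 \<le> ennreal m0" "0 \<le> m0"
  obtains L where "0 \<le> L"
    "\<And>u u' \<eta> x. u \<in> deformations TYPE('d) V0 R m \<Longrightarrow> u' \<in> deformations TYPE('d) V0 R m \<Longrightarrow> (\<And>x. norm (u x - u' x) \<le> \<eta>) \<Longrightarrow>
      norm (approx_mean_curvature \<psi> \<epsilon> (transport TYPE('d) V0 u) x - approx_mean_curvature \<psi> \<epsilon> (transport TYPE('d) V0 u') x) \<le> L * \<eta>
      \<and> norm (curvature_deriv \<psi> \<epsilon> (transport TYPE('d) V0 u) x - curvature_deriv \<psi> \<epsilon> (transport TYPE('d) V0 u') x) \<le> L * \<eta>"
proof -
  obtain B where K: "kernel_bounds B (kernel \<psi> \<epsilon>)" using kernel_bounds_exist[OF \<psi>] .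
  obtain L where L: "0 \<le> L"
    "\<And>u u' \<eta> y. u \<in> deformations TYPE('d) V0 R m \<Longrightarrow> u' \<in> deformations TYPE('d) V0 R m \<Longrightarrow> (\<And>x. norm (u x - u' x) \<le> \<eta>) \<Longrightarrow>
      norm (pre_mean_curvature \<psi> \<epsilon> (transport TYPE('d) V0 u) y - pre_mean_curvature \<psi> \<epsilon> (transport TYPE('d) V0 u') y) \<le> L * \<eta>"
    by (rule pre_mean_curvature_stable[OF K \<epsilon> V0 m, of R]) blast
  show ?thesis
  proof (rule that[of "2 * ball_mass TYPE(real^'n) * (B * L)"])
    show "0 \<le> 2 * ball_mass TYPE(real^'n) * (B * L)" using L(1) kernel_boundsD(1)[OF K] by simp
    fix u u' \<eta> x
    assume u: "u \<in> deformations TYPE('d) V0 R m" "u' \<in> deformations TYPE('d) V0 R m"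
      and \<eta>: "\<And>x. norm (u x - u' x) \<le> \<eta>"
    note mass = u(1)[THEN deformationsD(2)] u(2)[THEN deformationsD(2)]
    note w = pre_mean_curvature_continuous[OF K \<epsilon> sets_transport mass(1) m] pre_mean_curvature_bound[OF K \<epsilon> sets_transport mass(1) m]
    note w' = pre_mean_curvature_continuous[OF K \<epsilon> sets_transport mass(2) m] pre_mean_curvature_bound[OF K \<epsilon> sets_transport mass(2) m]
    note e = L(2)[OF u \<eta>]
    show "norm (approx_mean_curvature \<psi> \<epsilon> (transport TYPE('d) V0 u) x - approx_mean_curvature \<psi> \<epsilon> (transport TYPE('d) V0 u') x) \<le> 2 * ball_mass TYPE(real^'n) * (B * L) * \<eta>
      \<and> norm (curvature_deriv \<psi> \<epsilon> (transport TYPE('d) V0 u) x - curvature_deriv \<psi> \<epsilon> (transport TYPE('d) V0 u') x) \<le> 2 * ball_mass TYPE(real^'n) * (B * L) * \<eta>"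
      unfolding approx_mean_curvature_conv curvature_deriv_def
      using conv_diff_right[OF kernel_continuous(1)[OF K] kernel_boundsD(7,3)[OF K] w w' e, of x]
        conv_deriv_diff_right[OF K w w' e, of x] by (simp add: mult.assoc)
  qed
qed

text \<open>The velocity of the deformation \<open>u = (F, DF)\<close>: the equation for \<open>DF\<close> is the linearised one.\<close>

definition flow_field ::
    "'d::finite itself \<Rightarrow> (real^'n \<Rightarrow> real) \<Rightarrow> real \<Rightarrow> ((real^'n) \<times> (real^'n^'n)) measure \<Rightarrow>
     'n::finite deformation \<Rightarrow> 'n::finite deformation" where
  "flow_field D \<psi> \<epsilon> V0 u x =
     (approx_mean_curvature \<psi> \<epsilon> (transport D V0 u) (fst (u x)),
      curvature_deriv \<psi> \<epsilon> (transport D V0 u) (fst (u x)) o\<^sub>L snd (u x))"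

lemma flow_field_lipschitz:
  fixes \<psi> :: "real^'n \<Rightarrow> real"
  assumes \<psi>: "cutoff \<psi>" and \<epsilon>: "0 < \<epsilon>" and m: "0 \<le> m" and R: "0 \<le> R"
    and V0: "sets V0 = sets (bundle_borel TYPE('d::finite))" "total_mass V0 \<le> ennreal m0" "0 \<le> m0"
  obtains L where "0 \<le> L"
    "\<And>u x. u \<in> deformations TYPE('d) V0 R m \<Longrightarrow> norm (flow_field TYPE('d) \<psi> \<epsilon> V0 u x) \<le> L"
    "\<And>u u' \<eta> x. u \<in> deformations TYPE('d) V0 R m \<Longrightarrow> u' \<in> deformations TYPE('d) V0 R m \<Longrightarrow> (\<And>x. norm (u x - u' x) \<le> \<eta>) \<Longrightarrow>
      norm (flow_field TYPE('d) \<psi> \<epsilon> V0 u x - flow_field TYPE('d) \<psi> \<epsilon> V0 u' x) \<le> L * \<eta>"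
proof -
  obtain L where cb: "curvature_bound TYPE('d) \<psi> \<epsilon> m L" by (rule curvature_bound_exists[OF \<psi> \<epsilon> m])
  then have L: "0 \<le> L" by (simp add: curvature_bound_def)
  obtain C where C: "0 \<le> C"
    "\<And>u u' \<eta> x. u \<in> deformations TYPE('d) V0 R m \<Longrightarrow> u' \<in> deformations TYPE('d) V0 R m \<Longrightarrow> (\<And>x. norm (u x - u' x) \<le> \<eta>) \<Longrightarrow>
      norm (approx_mean_curvature \<psi> \<epsilon> (transport TYPE('d) V0 u) x - approx_mean_curvature \<psi> \<epsilon> (transport TYPE('d) V0 u') x) \<le> C * \<eta>
      \<and> norm (curvature_deriv \<psi> \<epsilon> (transport TYPE('d) V0 u) x - curvature_deriv \<psi> \<epsilon> (transport TYPE('d) V0 u') x) \<le> C * \<eta>"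
    by (rule curvature_stability[OF \<psi> \<epsilon> m V0, of R]) blast
  show ?thesis
  \<comment> \<open>\<open>L\<close> pays for moving the evaluation point and \<open>C\<close> for
    changing the varifold. The first summand is for the position, the second for the composition
    with DF; \<open>L * R\<close> is added so that the same number also bounds the velocity
    itself.\<close>
  proof (rule that[of "(L + C) + ((L + C) * R + L) + L * R"])
    let ?H = "flow_field TYPE('d) \<psi> \<epsilon> V0"
    show "0 \<le> (L + C) + ((L + C) * R + L) + L * R" using L C(1) R by simp
    fix u :: "'n::finite deformation" and x
    assume u: "u \<in> deformations TYPE('d) V0 R m"
    then have um: "total_mass (transport TYPE('d) V0 u) \<le> ennreal m"
      and ua: "admissible R u" by (auto simp: deformations_def)
    have nu: "norm (snd (u x)) \<le> R" for x using ua by (simp add: admissible_def bilipschitz_def)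
    note reg = curvature_boundD(2-5)[OF cb sets_transport um]
    have "norm (?H u x) \<le> L + L * R"
      unfolding flow_field_def
      by (intro norm_Pair_le[THEN order_trans] add_mono reg norm_blinfun_compose[THEN order_trans] mult_mono nu L) auto
    also have "\<dots> \<le> (L + C) + ((L + C) * R + L) + L * R" using L C(1) R by (simp add: algebra_simps)
    finally show "norm (?H u x) \<le> (L + C) + ((L + C) * R + L) + L * R" .
    fix u' :: "'n::finite deformation" and \<eta>
    assume u': "u' \<in> deformations TYPE('d) V0 R m" and \<eta>: "\<And>x. norm (u x - u' x) \<le> \<eta>"
    from u' have um': "total_mass (transport TYPE('d) V0 u') \<le> ennreal m"
      and ua': "admissible R u'" by (auto simp: deformations_def)
    have \<eta>0: "0 \<le> \<eta>" using order_trans[OF norm_ge_zero \<eta>] .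
    note reg' = curvature_boundD(2-5)[OF cb sets_transport um']
    note st = C(2)[OF u u' \<eta>]
    let ?h = "approx_mean_curvature \<psi> \<epsilon> (transport TYPE('d) V0 u)" and ?h' = "approx_mean_curvature \<psi> \<epsilon> (transport TYPE('d) V0 u')"
    let ?D = "curvature_deriv \<psi> \<epsilon> (transport TYPE('d) V0 u)" and ?D' = "curvature_deriv \<psi> \<epsilon> (transport TYPE('d) V0 u')"
    let ?y = "fst (u x)" and ?y' = "fst (u' x)" and ?A = "snd (u x)" and ?A' = "snd (u' x)"
    have dy: "norm (?y - ?y') \<le> \<eta>" using norm_fst_le'[of "u x - u' x"] \<eta>[of x] by simp
    have dA: "norm (?A - ?A') \<le> \<eta>" using norm_snd_le'[of "u x - u' x"] \<eta>[of x] by simp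
    have 1: "norm (?h ?y - ?h' ?y') \<le> (L + C) * \<eta>"
    proof -
      have "norm (?h ?y - ?h' ?y') \<le> norm (?h ?y - ?h ?y') + norm (?h ?y' - ?h' ?y')"
        by (rule norm_diff_triangle_ineq[of "?h ?y" "?h ?y'" "?h ?y'" "?h' ?y'", simplified, THEN order_trans]) simp
      also have "\<dots> \<le> L * \<eta> + C * \<eta>"
        using reg(3)[of ?y ?y'] mult_left_mono[OF dy L] st[of ?y'] by linarith
      finally show ?thesis by (simp add: distrib_right)
    qed
    have 2: "norm (?D ?y - ?D' ?y') \<le> (L + C) * \<eta>"
    proof -
      have "norm (?D ?y - ?D' ?y') \<le> norm (?D ?y - ?D ?y') + norm (?D ?y' - ?D' ?y')"
        by (rule norm_diff_triangle_ineq[of "?D ?y" "?D ?y'" "?D ?y'" "?D' ?y'", simplified, THEN order_trans]) simp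
      also have "\<dots> \<le> L * \<eta> + C * \<eta>"
        using reg(4)[of ?y ?y'] mult_left_mono[OF dy L] st[of ?y'] by linarith
      finally show ?thesis by (simp add: distrib_right)
    qed
    have 3: "norm ((?D ?y o\<^sub>L ?A) - (?D' ?y' o\<^sub>L ?A')) \<le> ((L + C) * R + L) * \<eta>"
    proof -
      have "(?D ?y o\<^sub>L ?A) - (?D' ?y' o\<^sub>L ?A') = ((?D ?y - ?D' ?y') o\<^sub>L ?A) + (?D' ?y' o\<^sub>L (?A - ?A'))"
        by (rule blinfun_eqI) (simp add: blinfun.bilinear_simps)
      also have "norm \<dots> \<le> ((L + C) * \<eta>) * R + L * \<eta>"
        using L C(1) \<eta>0
        by (intro norm_triangle_le add_mono norm_blinfun_compose[THEN order_trans] mult_mono 2 nu dA reg'(2)) auto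
      finally show ?thesis by (simp add: algebra_simps)
    qed
    have "norm (?H u x - ?H u' x) \<le> (L + C) * \<eta> + ((L + C) * R + L) * \<eta>"
      unfolding flow_field_def diff_Pair by (intro norm_Pair_le[THEN order_trans] add_mono 1 3)
    also have "\<dots> \<le> ((L + C) + ((L + C) * R + L) + L * R) * \<eta>"
      using L R \<eta>0 by (simp add: algebra_simps)
    finally show "norm (?H u x - ?H u' x) \<le> ((L + C) + ((L + C) * R + L) + L * R) * \<eta>" .
  qed
qed

section \<open>Convergence of Euler schemes\<close>

fun euler_at :: "(('x \<Rightarrow> 'b) \<Rightarrow> 'x \<Rightarrow> 'b) \<Rightarrow> real list \<Rightarrow> ('x \<Rightarrow> 'b) \<Rightarrow> nat \<Rightarrow> 'x \<Rightarrow> 'b::real_normed_vector" where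
  "euler_at H ts u0 0 = u0"
| "euler_at H ts u0 (Suc i) =
     (\<lambda>x. euler_at H ts u0 i x + (ts ! Suc i - ts ! i) *\<^sub>R H (euler_at H ts u0 i) x)"

text \<open>The index convention copies \<open>discrete_flow\<close>, so the two can be matched cell
  by cell.\<close>

definition euler :: "(('x \<Rightarrow> 'b) \<Rightarrow> 'x \<Rightarrow> 'b) \<Rightarrow> real list \<Rightarrow> ('x \<Rightarrow> 'b) \<Rightarrow> real \<Rightarrow> 'x \<Rightarrow> 'b::real_normed_vector" where
  "euler H ts u0 t =
     (if t \<le> 0 then u0
      else let i = (LEAST i. t \<le> ts ! Suc i); u = euler_at H ts u0 i
           in (\<lambda>x. u x + (t - ts ! i) *\<^sub>R H u x))"

section \<open>Subdivisions and their cells\<close>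

lemma subdivision_nth_mono:
  assumes "subdivision ts" "i < j" "j < length ts"
  shows "ts ! i < ts ! j"
  using assms by (simp add: subdivision_def sorted_wrt_nth_less)

lemma subdivision_ends:
  assumes "subdivision ts"
  shows "2 \<le> length ts" "ts ! 0 = 0" "ts ! (length ts - 1) = 1"
proof -
  have *: "ts \<noteq> []" "hd ts = 0" "last ts = 1" using assms by (auto simp: subdivision_def)
  then show "ts ! 0 = 0" "ts ! (length ts - 1) = 1"
    by (simp_all add: hd_conv_nth last_conv_nth)
  then show "2 \<le> length ts" using *(1) by (cases ts rule: remdups_adj.cases) auto
qed

lemma subdivision_nth_bounds:
  assumes ts: "subdivision ts" and "i < length ts"
  shows "0 \<le> ts ! i" "ts ! i \<le> 1"
proof -
  show "0 \<le> ts ! i"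
    using subdivision_nth_mono[OF ts, of 0 i] subdivision_ends[OF ts] assms(2) by (cases "i = 0") auto
  show "ts ! i \<le> 1"
    using subdivision_nth_mono[OF ts, of i "length ts - 1"] subdivision_ends[OF ts] assms(2)
    by (cases "i = length ts - 1") (auto simp: less_le)
qed

lemma mesh_ge:
  assumes "Suc i < length ts"
  shows "ts ! Suc i - ts ! i \<le> mesh ts"
proof -
  have "{ts ! Suc i - ts ! i | i. Suc i < length ts} = (\<lambda>i. ts ! Suc i - ts ! i) ` {i. Suc i < length ts}"
    by blast
  moreover have "finite {i. Suc i < length ts}"
    by (rule finite_subset[of _ "{..<length ts}"]) auto
  ultimately show ?thesis unfolding mesh_def using assms by (intro Max_ge) auto
qed

lemma mesh_nonneg: "subdivision ts \<Longrightarrow> 0 \<le> mesh ts"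
  using mesh_ge[of 0 ts] subdivision_nth_mono[of ts 0 1] subdivision_ends(1)[of ts] by force

lemma subdivision_index:
  assumes ts: "subdivision ts" and t: "0 < t" "t \<le> 1"
  defines "i \<equiv> (LEAST i. t \<le> ts ! Suc i)"
  shows "Suc i < length ts" "ts ! i < t" "t \<le> ts ! Suc i"
proof -
  have ex: "t \<le> ts ! Suc (length ts - 2)"
    using subdivision_ends[OF ts] t by (simp add: Suc_diff_Suc numeral_2_eq_2)
  show "t \<le> ts ! Suc i" unfolding i_def by (rule LeastI[of "\<lambda>i. t \<le> ts ! Suc i", OF ex])
  have "i \<le> length ts - 2" unfolding i_def by (rule Least_le[of "\<lambda>i. t \<le> ts ! Suc i", OF ex])
  then show "Suc i < length ts" using subdivision_ends(1)[OF ts] by linarith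
  show "ts ! i < t"
  proof (cases i)
    case 0
    then show ?thesis using subdivision_ends(2)[OF ts] t by simp
  next
    case (Suc k)
    have "\<not> t \<le> ts ! Suc k"
      by (rule not_less_Least) (use Suc in \<open>simp add: i_def\<close>)
    then show ?thesis using Suc by simp
  qed
qed

lemma subdivision_Least:
  assumes ts: "subdivision ts" and i: "Suc i < length ts" "ts ! i < t" "t \<le> ts ! Suc i"
  shows "(LEAST i. t \<le> ts ! Suc i) = i"
proof (rule Least_equality[of "\<lambda>i. t \<le> ts ! Suc i", OF i(3)])
  fix k assume k: "t \<le> ts ! Suc k"
  show "i \<le> k"
  proof (rule ccontr)
    assume "\<not> i \<le> k"
    then have "ts ! Suc k \<le> ts ! i"
      using subdivision_nth_mono[OF ts, of "Suc k" i] i(1) by (cases "Suc k = i") auto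
    then show False using k i(2) by simp
  qed
qed

text \<open>\<open>LEAST\<close> makes the cells open on the left. At the left end
  \<open>ts ! i\<close> the value is computed in the preceding cell, and the recursion of
  \<open>euler_at\<close> shows that it agrees, so the formula holds on the closed cell.\<close>

lemma euler_cell:
  assumes ts: "subdivision ts" and i: "Suc i < length ts" "ts ! i \<le> t" "t \<le> ts ! Suc i"
  shows "euler H ts u0 t = (\<lambda>x. euler_at H ts u0 i x + (t - ts ! i) *\<^sub>R H (euler_at H ts u0 i) x)"
proof (cases "ts ! i < t")
  case True
  moreover have "0 \<le> ts ! i" using subdivision_nth_bounds[OF ts, of i] i(1) by simp
  ultimately show ?thesis
    using subdivision_Least[OF ts i(1) True i(3)] by (simp add: euler_def Let_def)
next
  case False
  then have t: "t = ts ! i" using i by simp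
  show ?thesis
  proof (cases i)
    case 0
    then show ?thesis using t subdivision_ends(2)[OF ts] by (simp add: euler_def)
  next
    case (Suc k)
    have "ts ! k < ts ! i" using subdivision_nth_mono[OF ts, of k i] i(1) Suc by simp
    moreover have "0 \<le> ts ! k" using subdivision_nth_bounds[OF ts, of k] i(1) Suc by simp
    ultimately show ?thesis
      using subdivision_Least[OF ts, of k t] i(1) Suc t by (simp add: euler_def Let_def)
  qed
qed

lemma subdivision_cell:
  assumes ts: "subdivision ts" and st: "0 \<le> s" "s < t" "t \<le> 1" and no: "\<And>p. p \<in> set ts \<Longrightarrow> \<not> (s < p \<and> p < t)"
  obtains i where "Suc i < length ts" "ts ! i \<le> s" "t \<le> ts ! Suc i"
proof -
  define i where "i = (LEAST i. t \<le> ts ! Suc i)"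
  have i: "Suc i < length ts" "ts ! i < t" "t \<le> ts ! Suc i"
    using subdivision_index[OF ts, of t] st unfolding i_def by auto
  moreover have "ts ! i \<le> s" using no[of "ts ! i"] i by (auto simp: not_less)
  ultimately show ?thesis using that by blast
qed

text \<open>Both Euler polygons are affine between consecutive points of the common refinement, so Gronwall's
  inequality reduces to an induction over the refinement points.\<close>

lemma euler_compare:
  fixes H :: "('x \<Rightarrow> 'b::real_normed_vector) \<Rightarrow> 'x \<Rightarrow> 'b"
  assumes lip: "\<And>u v \<eta>. u \<in> \<Omega> \<Longrightarrow> v \<in> \<Omega> \<Longrightarrow> (\<And>x. norm (u x - v x) \<le> \<eta>) \<Longrightarrow> \<forall>x. norm (H u x - H v x) \<le> L * \<eta>"
    and bnd: "\<And>u x. u \<in> \<Omega> \<Longrightarrow> norm (H u x) \<le> B"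
    and L: "0 \<le> L" and B: "0 \<le> B"
    and ts: "subdivision ts" "\<And>i. i < length ts \<Longrightarrow> euler_at H ts u0 i \<in> \<Omega>"
    and ts': "subdivision ts'" "\<And>i. i < length ts' \<Longrightarrow> euler_at H ts' u0 i \<in> \<Omega>"
    and t: "0 \<le> t" "t \<le> 1"
  shows "norm (euler H ts u0 t x - euler H ts' u0 t x) \<le> B * (mesh ts + mesh ts') * exp L"
proof -
  let ?u = "euler H ts u0" and ?v = "euler H ts' u0"
  \<comment> \<open>The lag: since its last node each polygon has moved by at most \<open>B\<close>
    times its mesh. Adding \<open>b\<close> to the distance makes the recursion below
    homogeneous.\<close>
  define b where "b = B * (mesh ts + mesh ts')"
  have b: "0 \<le> b" using B mesh_nonneg[OF ts(1)] mesh_nonneg[OF ts'(1)] by (simp add: b_def)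
  have cell: "norm (euler H ts u0 s x - euler_at H ts u0 i x) \<le> B * mesh ts"
    if ts: "subdivision ts" "\<And>i. i < length ts \<Longrightarrow> euler_at H ts u0 i \<in> \<Omega>"
      and i: "Suc i < length ts" "ts ! i \<le> s" "s \<le> ts ! Suc i" for ts s i x
  proof -
    have "norm (euler H ts u0 s x - euler_at H ts u0 i x) = (s - ts ! i) * norm (H (euler_at H ts u0 i) x)"
      using i unfolding euler_cell[OF ts(1) i] by simp
    also have "\<dots> \<le> mesh ts * B"
      using bnd[OF ts(2), of i] mesh_ge[OF i(1)] i mesh_nonneg[OF ts(1)] by (intro mult_mono) auto
    finally show ?thesis by (simp add: mult.commute)
  qed
  have step: "norm (?u t x - ?v t x) + b \<le> exp (L * (t - s)) * (\<eta> + b)"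
    if st: "0 \<le> s" "s < t" "t \<le> 1" and no: "{p \<in> set ts \<union> set ts'. s < p \<and> p < t} = {}"
      and \<eta>: "\<And>x. norm (?u s x - ?v s x) \<le> \<eta>" for s t \<eta> x
  proof -
    obtain i where i: "Suc i < length ts" "ts ! i \<le> s" "t \<le> ts ! Suc i"
      using subdivision_cell[OF ts(1) st] no by blast
    obtain k where k: "Suc k < length ts'" "ts' ! k \<le> s" "t \<le> ts' ! Suc k"
      using subdivision_cell[OF ts'(1) st] no by blast
    let ?ui = "euler_at H ts u0 i" and ?vk = "euler_at H ts' u0 k"
    \<comment> \<open>The velocities are frozen at the last nodes, the only functions known to lie
      in \<open>\<Omega>\<close>; going back from time \<open>s\<close> to these nodes costs
      \<open>b\<close>.\<close>
    have "norm (?ui x - ?vk x) \<le> \<eta> + b" for x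
    proof -
      have "?ui x - ?vk x = (?u s x - ?v s x) - (?u s x - ?ui x) + (?v s x - ?vk x)" by simp
      then have "norm (?ui x - ?vk x) \<le> norm (?u s x - ?v s x) + norm (?u s x - ?ui x) + norm (?v s x - ?vk x)"
        by (metis (no_types, lifting) add_mono_thms_linordered_semiring(3) norm_triangle_ineq norm_triangle_ineq4 order_trans)
      also have "\<dots> \<le> \<eta> + B * mesh ts + B * mesh ts'"
        using \<eta>[of x] cell[OF ts i(1,2), of x] cell[OF ts' k(1,2), of x] i k st by linarith
      finally show ?thesis by (simp add: b_def distrib_left)
    qed
    then have H: "norm (H ?ui x - H ?vk x) \<le> L * (\<eta> + b)"
      using lip[OF ts(2) ts'(2)] i k by auto
    have "?u t x = ?u s x + (t - s) *\<^sub>R H ?ui x" "?v t x = ?v s x + (t - s) *\<^sub>R H ?vk x"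
      using euler_cell[OF ts(1) i(1), of t H u0] euler_cell[OF ts(1) i(1), of s H u0]
        euler_cell[OF ts'(1) k(1), of t H u0] euler_cell[OF ts'(1) k(1), of s H u0] i k st
      by (simp_all add: algebra_simps)
    then have "?u t x - ?v t x = (?u s x - ?v s x) + (t - s) *\<^sub>R (H ?ui x - H ?vk x)"
      by (simp add: scaleR_diff_right)
    then have "norm (?u t x - ?v t x) \<le> norm (?u s x - ?v s x) + (t - s) * norm (H ?ui x - H ?vk x)"
      using norm_triangle_ineq[of "?u s x - ?v s x" "(t - s) *\<^sub>R (H ?ui x - H ?vk x)"] st by simp
    also have "\<dots> \<le> \<eta> + (t - s) * (L * (\<eta> + b))"
      using \<eta>[of x] H st by (intro add_mono mult_left_mono) auto
    finally have "norm (?u t x - ?v t x) + b \<le> (1 + L * (t - s)) * (\<eta> + b)" by (simp add: algebra_simps)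
    also have "\<dots> \<le> exp (L * (t - s)) * (\<eta> + b)"
      using b order_trans[OF norm_ge_zero \<eta>] by (intro mult_right_mono exp_ge_add_one_self) auto
    finally show ?thesis .
  qed
  \<comment> \<open>Induction on the number of refinement points strictly between \<open>s\<close>
    and \<open>t\<close>, splitting at any of them; the exponential factors multiply.\<close>
  have main: "norm (?u t x - ?v t x) + b \<le> exp (L * (t - s)) * (\<eta> + b)"
    if "0 \<le> s" "s \<le> t" "t \<le> 1" "\<And>x. norm (?u s x - ?v s x) \<le> \<eta>"
      "card {p \<in> set ts \<union> set ts'. s < p \<and> p < t} = n" for n s t \<eta> x
    using that
  proof (induction n arbitrary: s t \<eta> x rule: less_induct)
    case (less n)
    let ?P = "\<lambda>s t. {p \<in> set ts \<union> set ts'. s < p \<and> p < t}"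
    show ?case
    proof (cases "s = t \<or> ?P s t = {}")
      case True
      then show ?thesis using less.prems step[of s t \<eta> x] by (cases "s = t") auto
    next
      case False
      then obtain p where p: "p \<in> set ts \<union> set ts'" "s < p" "p < t" by blast
      have fin: "finite (?P s t)" by simp
      have "?P s p \<subseteq> ?P s t" "?P p t \<subseteq> ?P s t" "p \<in> ?P s t" "p \<notin> ?P s p" "p \<notin> ?P p t"
        using p by auto
      then have c1: "card (?P s p) < n" and c2: "card (?P p t) < n"
        unfolding less.prems(5)[symmetric] by (blast intro: psubset_card_mono[OF fin])+
      have s1: "norm (?u p x - ?v p x) + b \<le> exp (L * (p - s)) * (\<eta> + b)" for x
        using less.IH[OF c1, of s p \<eta> x] less.prems p by auto
      \<comment> \<open>The new \<open>\<eta>\<close> is the bound at \<open>p\<close> with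
        \<open>b\<close> subtracted; adding \<open>b\<close> back recovers the accumulated
        factor.\<close>
      have "norm (?u t x - ?v t x) + b \<le> exp (L * (t - p)) * ((exp (L * (p - s)) * (\<eta> + b) - b) + b)"
        using less.prems p s1 by (intro less.IH[OF c2]) (auto simp: le_diff_eq)
      moreover have "exp (L * (t - p)) * exp (L * (p - s)) = exp (L * (t - s))"
        by (simp add: mult_exp_exp right_diff_distrib)
      ultimately show ?thesis by (simp add: mult.assoc[symmetric])
    qed
  qed
  have "norm (?u t x - ?v t x) + b \<le> exp (L * (t - 0)) * (0 + b)"
    by (rule main[OF _ _ _ _ refl]) (use t in \<open>auto simp: euler_def\<close>)
  also have "\<dots> \<le> exp L * b"
    using b L t mult_left_le[of t L] by (auto intro!: mult_right_mono)
  finally show ?thesis using b by (simp add: b_def mult_ac)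
qed

lemma subdivision_dyadic: "subdivision (dyadic_subdivision j)"
proof -
  have "sorted_wrt (<) (dyadic_subdivision j)"
    unfolding dyadic_subdivision_def
    by (auto simp: sorted_wrt_iff_nth_less divide_strict_right_mono simp del: upt_Suc)
  moreover have "hd (dyadic_subdivision j) = 0"
    by (simp add: dyadic_subdivision_def hd_map upt_conv_Cons)
  moreover have "last (dyadic_subdivision j) = 1" by (simp add: dyadic_subdivision_def)
  ultimately show ?thesis by (simp add: subdivision_def dyadic_subdivision_def)
qed

lemma mesh_dyadic: "mesh (dyadic_subdivision j) = 1 / 2 ^ j"
proof -
  have "dyadic_subdivision j ! Suc i - dyadic_subdivision j ! i = 1 / 2 ^ j"
    if "Suc i < length (dyadic_subdivision j)" for i
    using that by (simp add: dyadic_subdivision_def diff_divide_distrib[symmetric] del: upt_Suc)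
  moreover have "Suc 0 < length (dyadic_subdivision j)" by (simp add: dyadic_subdivision_def)
  ultimately have "{dyadic_subdivision j ! Suc i - dyadic_subdivision j ! i | i. Suc i < length (dyadic_subdivision j)} = {1 / 2 ^ j}"
    by (auto intro!: exI[of _ 0])
  then show ?thesis by (simp add: mesh_def)
qed

text \<open>The limit is constructed along dyadic subdivisions. Comparing an arbitrary subdivision
  with the dyadic ones and letting these get finer gives a rate linear in its own mesh; existence of
  the limit and its independence of the subdivisions are both contained in this estimate.\<close>

lemma euler_converges:
  fixes H :: "('x \<Rightarrow> 'b::banach) \<Rightarrow> 'x \<Rightarrow> 'b"
  assumes lip: "\<And>u v \<eta>. u \<in> \<Omega> \<Longrightarrow> v \<in> \<Omega> \<Longrightarrow> (\<And>x. norm (u x - v x) \<le> \<eta>) \<Longrightarrow> \<forall>x. norm (H u x - H v x) \<le> L * \<eta>"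
    and bnd: "\<And>u x. u \<in> \<Omega> \<Longrightarrow> norm (H u x) \<le> B"
    and L: "0 \<le> L" and B: "0 \<le> B" and "0 < \<delta>"
    and \<Omega>: "\<And>ts i. subdivision ts \<Longrightarrow> mesh ts \<le> \<delta> \<Longrightarrow> i < length ts \<Longrightarrow> euler_at H ts u0 i \<in> \<Omega>"
  obtains u C where "0 \<le> C"
    "\<And>ts t x. subdivision ts \<Longrightarrow> mesh ts \<le> \<delta> \<Longrightarrow> 0 \<le> t \<Longrightarrow> t \<le> 1 \<Longrightarrow>
      norm (euler H ts u0 t x - u t x) \<le> C * mesh ts"
proof -
  let ?e = "\<lambda>j. euler H (dyadic_subdivision j) u0"
  let ?m = "\<lambda>j. mesh (dyadic_subdivision j)"
  have m0: "?m \<longlonglongrightarrow> 0"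
    unfolding mesh_dyadic using LIMSEQ_power_zero[of "1/2::real"] by (simp add: power_one_over)
  have small: "\<forall>\<^sub>F j in sequentially. ?m j < e" if "0 < e" for e
    using order_tendstoD(2)[OF m0 that] .
  have cmp: "norm (euler H ts u0 t x - ?e j t x) \<le> B * (mesh ts + ?m j) * exp L"
    if "subdivision ts" "mesh ts \<le> \<delta>" "?m j \<le> \<delta>" "0 \<le> t" "t \<le> 1" for ts j t x
  proof (rule euler_compare[where \<Omega> = \<Omega>])
    show "\<forall>x. norm (H u x - H v x) \<le> L * \<eta>"
      if "u \<in> \<Omega>" "v \<in> \<Omega>" "\<And>x. norm (u x - v x) \<le> \<eta>" for u v \<eta>
      using lip that by blast
  qed (use that in \<open>auto intro: bnd L B \<Omega> subdivision_dyadic\<close>)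
  define u where "u t x = lim (\<lambda>j. ?e j t x)" for t x
  have conv: "(\<lambda>j. ?e j t x) \<longlonglongrightarrow> u t x" if t: "0 \<le> t" "t \<le> 1" for t x
  proof -
    have "Cauchy (\<lambda>j. ?e j t x)"
    proof (rule metric_CauchyI)
      fix e :: real assume "0 < e"
      \<comment> \<open>Two meshes below \<open>c\<close> give a distance of at most
        \<open>2 * (e / 3)\<close>; \<open>B + 1\<close> keeps the denominator positive when
        \<open>B\<close> is 0.\<close>
      define c where "c = min \<delta> (e / (3 * ((B + 1) * exp L)))"
      have "0 < c" using \<open>0 < e\<close> \<open>0 < \<delta>\<close> B by (simp add: c_def)
      then obtain N where N: "\<And>j. N \<le> j \<Longrightarrow> ?m j < c"
        using small[of c] by (auto simp: eventually_sequentially)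
      have "dist (?e i t x) (?e j t x) < e" if "N \<le> i" "N \<le> j" for i j
      proof -
        have ij: "?m i < c" "?m j < c" using N that by auto
        have "norm (?e i t x - ?e j t x) \<le> B * (?m i + ?m j) * exp L"
          using ij t by (intro cmp subdivision_dyadic) (auto simp: c_def)
        also have "\<dots> \<le> (B + 1) * (c + c) * exp L"
          using ij B mesh_nonneg[OF subdivision_dyadic] \<open>0 < c\<close>
          by (intro mult_right_mono mult_mono add_mono) (auto intro: add_nonneg_nonneg)
        also have "\<dots> = 2 * ((B + 1) * exp L * c)" by simp
        also have "\<dots> \<le> 2 * (e / 3)"
        proof -
          have "c \<le> e / (3 * ((B + 1) * exp L))" by (simp add: c_def)
          then have "(B + 1) * exp L * c \<le> (B + 1) * exp L * (e / (3 * ((B + 1) * exp L)))"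
            using B by (intro mult_left_mono) auto
          also have "\<dots> = e / 3"
          proof -
            have "k * (e / (3 * k)) = e / 3" if "k \<noteq> 0" for k using that by simp
            moreover have "(B + 1) * exp L \<noteq> 0" using B by simp
            ultimately show ?thesis by blast
          qed
          finally show ?thesis by (rule mult_left_mono) simp
        qed
        also have "\<dots> < e" using \<open>0 < e\<close> by simp
        finally show ?thesis by (simp add: dist_norm)
      qed
      then show "\<exists>M. \<forall>m\<ge>M. \<forall>n\<ge>M. dist (?e m t x) (?e n t x) < e" by blast
    qed
    then show ?thesis unfolding u_def by (simp add: Cauchy_convergent_iff convergent_LIMSEQ_iff)
  qed
  show ?thesis
  proof (rule that[of "B * exp L" u])
    show "0 \<le> B * exp L" using B by simp
    fix ts t x assume ts: "subdivision ts" "mesh ts \<le> \<delta>" and t: "0 \<le> t" "t \<le> (1::real)"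
    have 1: "(\<lambda>j. norm (euler H ts u0 t x - ?e j t x)) \<longlonglongrightarrow> norm (euler H ts u0 t x - u t x)"
      by (intro tendsto_intros conv t)
    have 2: "(\<lambda>j. B * (mesh ts + ?m j) * exp L) \<longlonglongrightarrow> B * (mesh ts + 0) * exp L"
      by (intro tendsto_intros m0)
    have "\<forall>\<^sub>F j in sequentially. norm (euler H ts u0 t x - ?e j t x) \<le> B * (mesh ts + ?m j) * exp L"
      using small[OF \<open>0 < \<delta>\<close>] by eventually_elim (use ts t in \<open>auto intro!: cmp\<close>)
    from tendsto_le[OF _ 2 1 this] show "norm (euler H ts u0 t x - u t x) \<le> B * exp L * mesh ts"
      by (simp add: mult_ac)
  qed
qed

section \<open>The time-discrete flow as an Euler scheme\<close>

lemma transport_id: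
  assumes V: "sets V = sets (bundle_borel TYPE('d::finite))"
  shows "transport TYPE('d) V (\<lambda>x. (x, id_blinfun)) = V"
proof -
  let ?u = "\<lambda>x :: real^'n. (x, id_blinfun :: (real^'n) \<Rightarrow>\<^sub>L (real^'n))"
  have sp: "space V = plane_bundle TYPE('d)"
    by (rule space_plane_bundle[OF V])
  have J: "ennreal (bundle_jac TYPE('d) ?u p) = 1" if "p \<in> space V" for p
    using that by (auto simp: sp bundle_jac_def lin_jac_id)
  have "density V (\<lambda>p. ennreal (bundle_jac TYPE('d) ?u p)) = density V (\<lambda>p. 1)"
  proof (rule density_cong)
    show "(\<lambda>p. ennreal (bundle_jac TYPE('d) ?u p)) \<in> borel_measurable V"
      by (rule measurable_cong[THEN iffD2, OF J]) auto
    show "AE p in V. ennreal (bundle_jac TYPE('d) ?u p) = 1" by (rule AE_I2) (rule J)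
  qed auto
  then have "transport TYPE('d) V ?u = distr V (bundle_borel TYPE('d)) (bundle_map ?u)"
    by (simp add: transport_def density_1)
  also have "\<dots> = distr V (bundle_borel TYPE('d)) (\<lambda>p. p)"
    by (rule distr_cong) (auto simp: sp bundle_map_def image_proj_id)
  also have "\<dots> = V" by (rule distr_id2) (simp add: V)
  finally show ?thesis .
qed

text \<open>The bounds on DF and on its inverse at time \<open>s\<close>, in exponential form so
  that a step of length \<tau> multiplies them by a factor depending on \<tau> only and they add up
  to the elapsed time. The exponent 2 in the inverse bound is the price of replacing
  \<open>1 / (1 - z)\<close> by an exponential, valid for \<open>z\<close> up to 1/2.\<close>

definition tame :: "real \<Rightarrow> real \<Rightarrow> 'n::finite deformation \<Rightarrow> bool" where
  "tame L s u \<longleftrightarrow> continuous_on UNIV u \<and> (\<forall>x. norm (snd (u x)) \<le> exp (L * s)) \<and>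
    (\<forall>x v. norm v \<le> exp (2 * (L * s)) * norm (blinfun_apply (snd (u x)) v))"

lemma tame_admissible:
  assumes "tame L s u" "0 \<le> L" "0 \<le> s" "s \<le> 1"
  shows "admissible (exp (2 * L)) u"
  unfolding admissible_def bilipschitz_def
proof (intro conjI allI)
  have Ls: "0 \<le> L * s" "L * s \<le> L" using assms mult_left_le[of s L] by auto
  show "continuous_on UNIV u" using assms(1) by (simp add: tame_def)
  fix x v
  have "norm (snd (u x)) \<le> exp (L * s)" using assms(1) by (simp add: tame_def)
  also have "\<dots> \<le> exp (2 * L)" using Ls by simp
  finally show "norm (snd (u x)) \<le> exp (2 * L)" .
  have "norm v \<le> exp (2 * (L * s)) * norm (blinfun_apply (snd (u x)) v)" using assms(1) by (simp add: tame_def)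
  also have "\<dots> \<le> exp (2 * L) * norm (blinfun_apply (snd (u x)) v)" using Ls by (intro mult_right_mono) auto
  finally show "norm v \<le> exp (2 * L) * norm (blinfun_apply (snd (u x)) v)" .
qed

lemma exp_double_ge: "0 \<le> z \<Longrightarrow> z \<le> 1/2 \<Longrightarrow> 1 \<le> exp (2 * z) * (1 - z :: real)"
proof -
  assume z: "0 \<le> z" "z \<le> 1/2"
  have "0 \<le> z * (1 - 2 * z)" using z by simp
  then have "1 \<le> (1 + 2 * z) * (1 - z)" by (simp add: algebra_simps)
  also have "\<dots> \<le> exp (2 * z) * (1 - z)" using z by (intro mult_right_mono exp_ge_add_one_self) auto
  finally show ?thesis .
qed

context
  fixes D :: "(real^'n) \<Rightarrow>\<^sub>L (real^'n)" and \<tau> L :: real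
  assumes D: "norm D \<le> L" and \<tau>: "0 \<le> \<tau>" "\<tau> * L \<le> 1/2"
begin

lemma perturbed_identity_upper: "norm (id_blinfun + \<tau> *\<^sub>R D) \<le> 1 + \<tau> * L"
proof -
  have "norm (id_blinfun + \<tau> *\<^sub>R D) \<le> norm (id_blinfun :: (real^'n) \<Rightarrow>\<^sub>L (real^'n)) + norm (\<tau> *\<^sub>R D)"
    by (rule norm_triangle_ineq)
  also have "\<dots> \<le> 1 + \<tau> * L"
    using mult_left_mono[OF D \<tau>(1)] \<tau>(1) by (simp add: norm_blinfun_id)
  finally show ?thesis .
qed

lemma perturbed_identity_lower: "(1 - \<tau> * L) * norm v \<le> norm (blinfun_apply (id_blinfun + \<tau> *\<^sub>R D) v)"
proof -
  have "norm (blinfun_apply D v) \<le> L * norm v" by (rule norm_blinfun_le[OF D])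
  then have "\<tau> * norm (blinfun_apply D v) \<le> \<tau> * (L * norm v)" by (rule mult_left_mono[OF _ \<tau>(1)])
  moreover have "norm v \<le> norm (v + \<tau> *\<^sub>R blinfun_apply D v) + norm (\<tau> *\<^sub>R blinfun_apply D v)"
    using norm_triangle_ineq4[of "v + \<tau> *\<^sub>R blinfun_apply D v" "\<tau> *\<^sub>R blinfun_apply D v"] by simp
  ultimately show ?thesis using \<tau>(1) by (simp add: blinfun.bilinear_simps algebra_simps)
qed

text \<open>A crude constant for one step, used only to make the step an admissible deformation that
  can be composed. Iterating it would give a power of 2; the bounds along the flow come from
  \<open>tame_step\<close>.\<close>

lemma perturbed_identity_bilipschitz: "bilipschitz 2 (id_blinfun + \<tau> *\<^sub>R D)"
  unfolding bilipschitz_def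
proof (intro conjI allI)
  show "norm (id_blinfun + \<tau> *\<^sub>R D) \<le> 2" using perturbed_identity_upper \<tau> by simp
  fix v :: "real^'n"
  have "(1/2) * norm v \<le> (1 - \<tau> * L) * norm v" using \<tau> by (intro mult_right_mono) auto
  then show "norm v \<le> 2 * norm (blinfun_apply (id_blinfun + \<tau> *\<^sub>R D) v)"
    using perturbed_identity_lower[of v] by simp
qed

lemma norm_le_perturbed_identity: "norm v \<le> exp (2 * (\<tau> * L)) * norm (blinfun_apply (id_blinfun + \<tau> *\<^sub>R D) v)"
proof -
  have "0 \<le> L" using D norm_ge_zero order_trans by blast
  then have "1 \<le> exp (2 * (\<tau> * L)) * (1 - \<tau> * L)" using \<tau> by (intro exp_double_ge) auto
  from mult_right_mono[OF this norm_ge_zero[of v]]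
  have "norm v \<le> exp (2 * (\<tau> * L)) * ((1 - \<tau> * L) * norm v)" by (simp add: mult.assoc)
  also have "\<dots> \<le> exp (2 * (\<tau> * L)) * norm (blinfun_apply (id_blinfun + \<tau> *\<^sub>R D) v)"
    by (intro mult_left_mono perturbed_identity_lower) auto
  finally show ?thesis .
qed

end

context
  fixes \<psi> :: "real^'n \<Rightarrow> real" and \<epsilon> m L \<tau> s :: real and V0 :: "((real^'n) \<times> (real^'n^'n)) measure" and u
    and D :: "'d::finite itself"
  assumes V0: "sets V0 = sets (bundle_borel TYPE('d))"
    and cb: "curvature_bound TYPE('d) \<psi> \<epsilon> m L"
    and m: "total_mass (transport TYPE('d) V0 u) \<le> ennreal m"
    and \<tau>: "0 \<le> \<tau>" "\<tau> * L \<le> 1/2"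
    and u: "tame L s u"
begin

lemmas reg = curvature_boundD[OF cb sets_transport m]

lemma L0: "0 \<le> L" using cb by (simp add: curvature_bound_def)

lemma curvature_continuous:
  "continuous_on UNIV (approx_mean_curvature \<psi> \<epsilon> (transport TYPE('d) V0 u))"
  "continuous_on UNIV (curvature_deriv \<psi> \<epsilon> (transport TYPE('d) V0 u))"
  using has_derivative_continuous_on[OF reg(1)] lipschitz_imp_continuous_on[OF reg(5) L0] by auto

text \<open>By the chain rule the composed derivative is
  \<open>(id + \<tau> Dh(F)) DF = DF + \<tau> Dh(F) DF\<close>, so composing with the step map is
  one explicit Euler step in the pair (F, DF).\<close>

lemma push_forward_step:
  assumes R: "admissible R u"
  shows "push_forward TYPE('d) (step_map \<psi> \<epsilon> \<tau> (transport TYPE('d) V0 u)) (transport TYPE('d) V0 u)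
    = transport TYPE('d) V0 (\<lambda>x. u x + \<tau> *\<^sub>R flow_field TYPE('d) \<psi> \<epsilon> V0 u x)"
proof -
  let ?V = "transport TYPE('d) V0 u"
  let ?f = "step_map \<psi> \<epsilon> \<tau> ?V" and ?A = "\<lambda>x. id_blinfun + \<tau> *\<^sub>R curvature_deriv \<psi> \<epsilon> ?V x"
  have d: "(?f has_derivative blinfun_apply (?A x)) (at x)" for x
    unfolding step_map_def[abs_def]
    by (rule has_derivative_eq_rhs[OF has_derivative_add[OF has_derivative_ident has_derivative_scaleR_right[OF reg(1)]]])
      (simp add: fun_eq_iff blinfun.bilinear_simps)
  have adm: "admissible 2 (\<lambda>x. (?f x, ?A x))"
    unfolding admissible_def
  proof (intro conjI allI)
    show "continuous_on UNIV (\<lambda>x. (?f x, ?A x))"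
      unfolding step_map_def[abs_def] by (intro continuous_intros curvature_continuous)
    show "bilipschitz 2 (snd (?f x, ?A x))" for x
      using perturbed_identity_bilipschitz[OF reg(3) \<tau>] by simp
  qed
  have "push_forward TYPE('d) ?f ?V = transport TYPE('d) ?V (\<lambda>x. (?f x, ?A x))"
    by (rule push_forward_eq_transport[OF d])
  also have "\<dots> = transport TYPE('d) V0 (\<lambda>x. (?f (fst (u x)), ?A (fst (u x)) o\<^sub>L snd (u x)))"
    using transport_transport[OF V0 R adm] by simp
  also have "(\<lambda>x. (?f (fst (u x)), ?A (fst (u x)) o\<^sub>L snd (u x))) = (\<lambda>x. u x + \<tau> *\<^sub>R flow_field TYPE('d) \<psi> \<epsilon> V0 u x)"
    by (rule ext, rule prod_eqI)
      (simp add: step_map_def flow_field_def, rule blinfun_eqI, simp add: flow_field_def blinfun.bilinear_simps)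
  finally show ?thesis .
qed

lemma tame_step: "tame L (s + \<tau>) (\<lambda>x. u x + \<tau> *\<^sub>R flow_field TYPE('d) \<psi> \<epsilon> V0 u x)"
  unfolding tame_def
proof (intro conjI allI)
  let ?V = "transport TYPE('d) V0 u"
  let ?A = "\<lambda>x. id_blinfun + \<tau> *\<^sub>R curvature_deriv \<psi> \<epsilon> ?V x"
  have cu: "continuous_on UNIV u" using u by (simp add: tame_def)
  have "continuous_on UNIV (\<lambda>x. approx_mean_curvature \<psi> \<epsilon> ?V (fst (u x)))"
    "continuous_on UNIV (\<lambda>x. curvature_deriv \<psi> \<epsilon> ?V (fst (u x)))"
    using continuous_on_compose2[OF curvature_continuous(1) continuous_on_fst[OF cu]]
      continuous_on_compose2[OF curvature_continuous(2) continuous_on_fst[OF cu]] by auto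
  then show "continuous_on UNIV (\<lambda>x. u x + \<tau> *\<^sub>R flow_field TYPE('d) \<psi> \<epsilon> V0 u x)"
    unfolding flow_field_def
    by (intro continuous_intros cu bounded_bilinear.continuous_on[OF bounded_bilinear_blinfun_compose])
  fix x v
  have eq: "snd (u x + \<tau> *\<^sub>R flow_field TYPE('d) \<psi> \<epsilon> V0 u x) = ?A (fst (u x)) o\<^sub>L snd (u x)"
    by (rule blinfun_eqI) (simp add: flow_field_def blinfun.bilinear_simps)
  have 1: "norm (snd (u x)) \<le> exp (L * s)" and 2: "norm v \<le> exp (2 * (L * s)) * norm (blinfun_apply (snd (u x)) v)"
    using u by (auto simp: tame_def)
  have "norm (?A (fst (u x)) o\<^sub>L snd (u x)) \<le> norm (?A (fst (u x))) * norm (snd (u x))"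
    by (rule norm_blinfun_compose)
  also have "\<dots> \<le> exp (\<tau> * L) * exp (L * s)"
    using order_trans[OF perturbed_identity_upper[OF reg(3) \<tau>, of "fst (u x)"] exp_ge_add_one_self] 1
    by (intro mult_mono) auto
  finally show "norm (snd (u x + \<tau> *\<^sub>R flow_field TYPE('d) \<psi> \<epsilon> V0 u x)) \<le> exp (L * (s + \<tau>))"
    unfolding eq by (simp add: mult_exp_exp algebra_simps)
  note 2
  also have "exp (2 * (L * s)) * norm (blinfun_apply (snd (u x)) v)
      \<le> exp (2 * (L * s)) * (exp (2 * (\<tau> * L)) * norm (blinfun_apply (?A (fst (u x))) (blinfun_apply (snd (u x)) v)))"
    by (intro mult_left_mono norm_le_perturbed_identity[OF reg(3) \<tau>]) auto
  also have "\<dots> = exp (2 * (L * (s + \<tau>))) * norm (blinfun_apply (?A (fst (u x)) o\<^sub>L snd (u x)) v)"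
    unfolding mult.assoc[symmetric] mult_exp_exp by (simp add: algebra_simps)
  finally show "norm v \<le> exp (2 * (L * (s + \<tau>))) * norm (blinfun_apply (snd (u x + \<tau> *\<^sub>R flow_field TYPE('d) \<psi> \<epsilon> V0 u x)) v)"
    unfolding eq .
qed

end

lemma discrete_flow_cell:
  assumes ts: "subdivision ts" and i: "Suc i < length ts" "ts ! i < t" "t \<le> ts ! Suc i"
  shows "discrete_flow D \<psi> \<epsilon> ts V0 t =
    push_forward D (step_map \<psi> \<epsilon> (t - ts ! i) (discrete_flow_at D \<psi> \<epsilon> ts V0 i)) (discrete_flow_at D \<psi> \<epsilon> ts V0 i)"
proof -
  have "0 \<le> ts ! i" using subdivision_nth_bounds[OF ts, of i] i(1) by simp
  then show ?thesis using subdivision_Least[OF ts i] i(2) by (simp add: discrete_flow_def Let_def)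
qed

lemma discrete_flow_node:
  assumes ts: "subdivision ts" and i: "i < length ts"
  shows "discrete_flow D \<psi> \<epsilon> ts V0 (ts ! i) = discrete_flow_at D \<psi> \<epsilon> ts V0 i"
proof (cases i)
  case 0
  then show ?thesis using subdivision_ends(2)[OF ts] by (simp add: discrete_flow_def)
next
  case (Suc k)
  then show ?thesis
    using discrete_flow_cell[OF ts, of k "ts ! i"] subdivision_nth_mono[OF ts, of k i] i by (simp add: Let_def)
qed

text \<open>The induction over nodes carries \<open>tame\<close> at time \<open>ts ! i\<close>, not
  \<open>admissible\<close> with a fixed constant, since the latter is not reproduced by a step. The
  mass hypothesis enters at every node, where it makes the curvature bounds available for the next
  step.\<close>

lemma discrete_flow_eq_transport:
  fixes \<psi> :: "real^'n \<Rightarrow> real"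
  assumes V0: "sets V0 = sets (bundle_borel TYPE('d::finite))"
    and cb: "curvature_bound TYPE('d) \<psi> \<epsilon> m L"
    and ts: "subdivision ts" "mesh ts * L \<le> 1/2"
    and mass: "\<And>t. 0 \<le> t \<Longrightarrow> t \<le> 1 \<Longrightarrow> emeasure (mass_measure (discrete_flow TYPE('d) \<psi> \<epsilon> ts V0 t)) UNIV \<le> ennreal m"
  defines "u0 \<equiv> \<lambda>x. (x, id_blinfun)" and "H \<equiv> flow_field TYPE('d) \<psi> \<epsilon> V0"
  shows "i < length ts \<Longrightarrow> euler_at H ts u0 i \<in> deformations TYPE('d) V0 (exp (2 * L)) m"
    and "0 \<le> t \<Longrightarrow> t \<le> 1 \<Longrightarrow> discrete_flow TYPE('d) \<psi> \<epsilon> ts V0 t = transport TYPE('d) V0 (euler H ts u0 t)"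
    and "0 \<le> t \<Longrightarrow> t \<le> 1 \<Longrightarrow> admissible (exp (2 * L)) (euler H ts u0 t)"
proof -
  let ?e = "euler_at H ts u0" and ?F = "discrete_flow_at TYPE('d) \<psi> \<epsilon> ts V0"
  have L0: "0 \<le> L" using cb by (simp add: curvature_bound_def)
  \<comment> \<open>The mass is controlled along the flow in time; \<open>discrete_flow_node\<close>
    hands this bound to the recursion over indices.\<close>
  have massI: "total_mass (transport TYPE('d) V0 w) \<le> ennreal m"
    if "?F i = transport TYPE('d) V0 w" "i < length ts" for i w
    using mass[of "ts ! i"] subdivision_nth_bounds[OF ts(1) that(2)] discrete_flow_node[OF ts(1) that(2), of "TYPE('d)" \<psi> \<epsilon> V0] that(1)
      emeasure_mass_measure[OF sets_transport[of "TYPE('d)" V0 w]] by simp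
  have small: "\<tau> * L \<le> 1/2" if "\<tau> \<le> mesh ts" for \<tau>
    using mult_right_mono[OF that L0] ts(2) by linarith
  have inv: "?F i = transport TYPE('d) V0 (?e i) \<and> tame L (ts ! i) (?e i)" if "i < length ts" for i
    using that
  proof (induction i)
    case 0
    have "tame L (ts ! 0) u0"
      unfolding tame_def u0_def subdivision_ends(2)[OF ts(1)] by (auto intro!: continuous_intros simp: norm_blinfun_id)
    then show ?case using transport_id[OF V0] by (simp add: u0_def)
  next
    case (Suc i)
    then have IH: "?F i = transport TYPE('d) V0 (?e i)" "tame L (ts ! i) (?e i)" and i: "i < length ts" by auto
    note m = massI[OF IH(1) i]
    have \<tau>: "0 \<le> ts ! Suc i - ts ! i" "(ts ! Suc i - ts ! i) * L \<le> 1/2"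
      using subdivision_nth_mono[OF ts(1), of i "Suc i"] Suc.prems small[OF mesh_ge[OF Suc.prems]] by auto
    note step = V0 cb m \<tau> IH(2)
    have adm: "admissible (exp (2 * L)) (?e i)"
      by (rule tame_admissible[OF IH(2) L0 subdivision_nth_bounds[OF ts(1) i]])
    show ?case
      using push_forward_step[OF step adm] tame_step[OF step] by (simp add: IH(1) Let_def H_def)
  qed
  have adm: "admissible (exp (2 * L)) (?e i)" if "i < length ts" for i
    using inv[OF that] tame_admissible L0 subdivision_nth_bounds[OF ts(1) that] by blast
  show "?e i \<in> deformations TYPE('d) V0 (exp (2 * L)) m" if "i < length ts"
    unfolding deformations_def using adm[OF that] massI[of i "?e i"] inv[OF that] that by blast
  have both: "discrete_flow TYPE('d) \<psi> \<epsilon> ts V0 t = transport TYPE('d) V0 (euler H ts u0 t) \<and>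
      admissible (exp (2 * L)) (euler H ts u0 t)" if t: "0 \<le> t" "t \<le> 1"
  proof (cases "t = 0")
    case True
    have "0 < length ts" using subdivision_ends(1)[OF ts(1)] by linarith
    then show ?thesis using True inv[of 0] adm[of 0] by (simp add: discrete_flow_def euler_def)
  next
    case False
    define i where "i = (LEAST i. t \<le> ts ! Suc i)"
    have i: "Suc i < length ts" "ts ! i < t" "t \<le> ts ! Suc i"
      using subdivision_index[OF ts(1), of t] t False unfolding i_def by auto
    then have il: "i < length ts" by simp
    note IH = inv[OF il, THEN conjunct1] inv[OF il, THEN conjunct2]
    note m = massI[OF IH(1) il]
    have \<tau>: "0 \<le> t - ts ! i" "(t - ts ! i) * L \<le> 1/2"
      using i small[of "t - ts ! i"] mesh_ge[OF i(1)] by auto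
    note step = V0 cb m \<tau> IH(2)
    have e: "euler H ts u0 t = (\<lambda>x. ?e i x + (t - ts ! i) *\<^sub>R H (?e i) x)"
      using i by (intro euler_cell[OF ts(1)]) auto
    have "tame L t (euler H ts u0 t)" using tame_step[OF step] by (simp add: e[unfolded H_def] H_def)
    then have "admissible (exp (2 * L)) (euler H ts u0 t)" using tame_admissible L0 t by blast
    moreover have "discrete_flow TYPE('d) \<psi> \<epsilon> ts V0 t = transport TYPE('d) V0 (euler H ts u0 t)"
      using discrete_flow_cell[OF ts(1) i, of "TYPE('d)" \<psi> \<epsilon> V0] push_forward_step[OF step adm[OF il]]
      by (simp add: IH(1)[unfolded H_def] e[unfolded H_def] H_def)
    ultimately show ?thesis by blast
  qed
  show "0 \<le> t \<Longrightarrow> t \<le> 1 \<Longrightarrow> discrete_flow TYPE('d) \<psi> \<epsilon> ts V0 t = transport TYPE('d) V0 (euler H ts u0 t)"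
    and "0 \<le> t \<Longrightarrow> t \<le> 1 \<Longrightarrow> admissible (exp (2 * L)) (euler H ts u0 t)"
    using both by auto
qed

section \<open>Limits of transported varifolds\<close>

lemma transport_tendsto:
  fixes \<phi> :: "(real^'n) \<times> (real^'n^'n) \<Rightarrow> real"
  assumes V: "sets V = sets (bundle_borel TYPE('d::finite))" "total_mass V \<le> ennreal m"
    and u: "\<And>j. admissible R (u j)" "admissible R v" "\<And>x. (\<lambda>j. u j x) \<longlonglongrightarrow> v x"
    and \<phi>: "continuous_on (plane_bundle TYPE('d)) \<phi>" "\<And>p. p \<in> plane_bundle TYPE('d) \<Longrightarrow> \<bar>\<phi> p\<bar> \<le> b"
  shows "(\<lambda>j. \<integral>p. \<phi> p \<partial>transport TYPE('d) V (u j)) \<longlonglongrightarrow> (\<integral>p. \<phi> p \<partial>transport TYPE('d) V v)"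
proof -
  let ?g = "\<lambda>w p. bundle_jac TYPE('d) w p *\<^sub>R \<phi> (bundle_map w p)"
  obtain K where K: "0 \<le> K"
    "\<And>u p. admissible R u \<Longrightarrow> p \<in> plane_bundle TYPE('d) \<Longrightarrow> bundle_jac TYPE('d) (u :: real^'n \<Rightarrow> _) p \<le> K"
    using bundle_jac_bounded[of R] by blast
  have sp: "space V = plane_bundle TYPE('d)"
    by (rule space_plane_bundle[OF V(1)])
  have \<phi>m: "\<phi> \<in> borel_measurable (bundle_borel TYPE('d))" by (rule bundle_measurable_continuous[OF \<phi>(1)])
  have meas: "?g w \<in> borel_measurable V" if w: "admissible R w" for w
  proof -
    have "bundle_jac TYPE('d) w \<in> borel_measurable V"
      using bundle_jac_measurable[OF w] measurable_cong_sets[OF V(1) refl] by blast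
    moreover have "(\<lambda>p. \<phi> (bundle_map w p)) \<in> borel_measurable V"
      using measurable_compose[OF bundle_map_measurable[OF w] \<phi>m] measurable_cong_sets[OF V(1) refl] by blast
    ultimately show ?thesis by auto
  qed
  interpret finite_measure V
    by (rule finite_measureI) (use V(2) in \<open>auto simp: top_unique dest: order_trans\<close>)
  have "(\<lambda>j. \<integral>p. ?g (u j) p \<partial>V) \<longlonglongrightarrow> (\<integral>p. ?g v p \<partial>V)"
  proof (rule integral_dominated_convergence[where w = "\<lambda>_. K * b"])
    show "integrable V (\<lambda>_. K * b)" by simp
    show "AE p in V. norm (?g (u j) p) \<le> K * b" for j
    proof (rule AE_I2)
      fix p assume "p \<in> space V"
      then have p: "p \<in> plane_bundle TYPE('d)" by (simp add: sp)
      show "norm (?g (u j) p) \<le> K * b"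
        using mult_mono[OF K(2)[OF u(1) p] \<phi>(2)[OF bundle_map_in[OF u(1) p]] K(1) abs_ge_zero, of j]
        by (simp add: abs_mult bundle_jac_nonneg)
    qed
    show "AE p in V. (\<lambda>j. ?g (u j) p) \<longlonglongrightarrow> ?g v p"
    proof (rule AE_I2)
      fix p assume "p \<in> space V"
      then have p: "p \<in> plane_bundle TYPE('d)" by (simp add: sp)
      have up: "(\<lambda>j. u j (fst p)) \<longlonglongrightarrow> v (fst p)" by (rule u(3))
      have "(\<lambda>j. (snd (u j (fst p)), snd p)) \<longlonglongrightarrow> (snd (v (fst p)), snd p)"
        by (intro tendsto_intros up)
      from continuous_on_tendsto_compose[OF lin_jac_continuous[where 'd = 'd] this] p
      have J: "(\<lambda>j. bundle_jac TYPE('d) (u j) p) \<longlonglongrightarrow> bundle_jac TYPE('d) v p"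
        by (auto simp: bundle_jac_def)
      let ?d = "\<lambda>j. (real CARD('n))\<^sup>2 * (2 * (R * norm (snd (u j (fst p)) - snd (v (fst p))) + R\<^sup>2 * norm (snd p - snd p)))"
      have "?d \<longlonglongrightarrow> (real CARD('n))\<^sup>2 * (2 * (R * norm (snd (v (fst p)) - snd (v (fst p))) + R\<^sup>2 * norm (snd p - snd p)))"
        by (intro tendsto_intros up)
      then have d0: "?d \<longlonglongrightarrow> 0" by simp
      have "norm (image_proj (snd (u j (fst p))) (snd p) - image_proj (snd (v (fst p))) (snd p)) \<le> ?d j" for j
        using u p by (intro image_proj_dist_le[where 'd = 'd]) (auto simp: admissible_def)
      then have "(\<lambda>j. image_proj (snd (u j (fst p))) (snd p) - image_proj (snd (v (fst p))) (snd p)) \<longlonglongrightarrow> 0"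
        by (intro Lim_null_comparison[OF _ d0] always_eventually) simp
      then have "(\<lambda>j. image_proj (snd (u j (fst p))) (snd p)) \<longlonglongrightarrow> image_proj (snd (v (fst p))) (snd p)"
        by (rule LIM_zero_cancel)
      then have B: "(\<lambda>j. bundle_map (u j) p) \<longlonglongrightarrow> bundle_map v p"
        unfolding bundle_map_def by (intro tendsto_intros up)
      have "(\<lambda>j. \<phi> (bundle_map (u j) p)) \<longlonglongrightarrow> \<phi> (bundle_map v p)"
        by (rule continuous_on_tendsto_compose[OF \<phi>(1) B bundle_map_in[OF u(2) p]])
          (intro always_eventually allI bundle_map_in[OF u(1) p])
      with J show "(\<lambda>j. ?g (u j) p) \<longlonglongrightarrow> ?g v p" by (intro tendsto_intros)
    qed
  qed (use meas u in auto)
  then show ?thesis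
    unfolding integral_transport[OF V(1) u(1) \<phi>m] integral_transport[OF V(1) u(2) \<phi>m] .
qed

lemma finite_measure_transport:
  fixes V :: "((real^'n) \<times> (real^'n^'n)) measure"
  assumes V: "sets V = sets (bundle_borel TYPE('d::finite))" "total_mass V \<le> ennreal m"
    and u: "admissible R u"
  shows "finite_measure (transport TYPE('d) V u)"
proof (rule finite_measureI)
  obtain K where K: "0 \<le> K"
    "\<And>u p. admissible R u \<Longrightarrow> p \<in> plane_bundle TYPE('d) \<Longrightarrow> bundle_jac TYPE('d) (u :: real^'n \<Rightarrow> _) p \<le> K"
    using bundle_jac_bounded[of R] by blast
  have sp: "space V = plane_bundle TYPE('d)"
    by (rule space_plane_bundle[OF V(1)])
  have "(\<integral>\<^sup>+p. ennreal (bundle_jac TYPE('d) u p) \<partial>V) \<le> (\<integral>\<^sup>+p. ennreal K \<partial>V)"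
    by (rule nn_integral_mono) (use K(2)[OF u] sp in \<open>auto intro!: ennreal_leI\<close>)
  also have "\<dots> = ennreal K * total_mass V" by simp
  also have "\<dots> \<le> ennreal K * ennreal m" by (rule mult_left_mono[OF V(2)]) simp
  also have "\<dots> < \<infinity>" by (simp add: ennreal_mult_less_top)
  finally show "total_mass (transport TYPE('d) V u) \<noteq> \<infinity>"
    unfolding emeasure_transport[OF V(1) u] by simp
qed

lemma onorm_matrix_le: "onorm (\<lambda>v. (M :: real^'n^'m) *v v) \<le> norm M"
  by (rule onorm_bound) (auto intro: norm_matrix_vector_mult_le)

text \<open>Every function in the supremum is \<open>bundle_lipschitz\<close> with constant 1, so
  \<open>integral_transport_lipschitz\<close> bounds all the differences at once.\<close>

lemma varifold_dist_transport_le: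
  fixes V :: "((real^'n) \<times> (real^'n^'n)) measure"
  assumes V: "sets V = sets (bundle_borel TYPE('d::finite))" "total_mass V \<le> ennreal m" "0 \<le> m"
  obtains C where "0 \<le> C"
    "\<And>u u' \<eta>. admissible R u \<Longrightarrow> admissible R u' \<Longrightarrow> (\<And>x. norm (u x - u' x) \<le> \<eta>) \<Longrightarrow>
      \<bar>varifold_dist TYPE('d) (transport TYPE('d) V u) (transport TYPE('d) V u')\<bar> \<le> C * \<eta>"
proof -
  obtain C where C: "0 \<le> C"
    "\<And>V m u u' (f :: (real^'n) \<times> (real^'n^'n) \<Rightarrow> real) b \<eta>.
       sets V = sets (bundle_borel TYPE('d)) \<Longrightarrow> total_mass V \<le> ennreal m \<Longrightarrow> 0 \<le> m \<Longrightarrow>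
       admissible R u \<Longrightarrow> admissible R u' \<Longrightarrow> bundle_lipschitz TYPE('d) b f \<Longrightarrow> (\<And>x. norm (u x - u' x) \<le> \<eta>) \<Longrightarrow>
       norm ((\<integral>p. f p \<partial>transport TYPE('d) V u) - (\<integral>p. f p \<partial>transport TYPE('d) V u')) \<le> m * (C * b * \<eta>)"
    by (rule integral_transport_lipschitz[of R, where 'd = 'd and 'n = 'n and 'b = real]) blast
  show ?thesis
  proof (rule that[of "m * C"])
    show "0 \<le> m * C" using C(1) V(3) by simp
    fix u u' :: "'n::finite deformation" and \<eta>
    assume u: "admissible R u" and u': "admissible R u'" and \<eta>: "\<And>x. norm (u x - u' x) \<le> \<eta>"
    let ?c = "m * C * \<eta>"
    let ?A = "{\<bar>(\<integral>x. \<phi> x \<partial>transport TYPE('d) V u) - (\<integral>x. \<phi> x \<partial>transport TYPE('d) V u')\<bar> | \<phi> :: (real^'n) \<times> (real^'n^'n) \<Rightarrow> real.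
       continuous_on (plane_bundle TYPE('d)) \<phi> \<and> (\<forall>x\<in>plane_bundle TYPE('d). 0 \<le> \<phi> x \<and> \<phi> x \<le> 1) \<and>
       (\<forall>x\<in>plane_bundle TYPE('d). \<forall>y\<in>plane_bundle TYPE('d). \<bar>\<phi> x - \<phi> y\<bar> \<le> bundle_dist x y)}"
    have le: "a \<le> ?c" if "a \<in> ?A" for a
    proof -
      from that obtain \<phi> :: "(real^'n) \<times> (real^'n^'n) \<Rightarrow> real" where
        a: "a = \<bar>(\<integral>x. \<phi> x \<partial>transport TYPE('d) V u) - (\<integral>x. \<phi> x \<partial>transport TYPE('d) V u')\<bar>"
        and \<phi>: "continuous_on (plane_bundle TYPE('d)) \<phi>" "\<forall>x\<in>plane_bundle TYPE('d). 0 \<le> \<phi> x \<and> \<phi> x \<le> 1"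
          "\<forall>x\<in>plane_bundle TYPE('d). \<forall>y\<in>plane_bundle TYPE('d). \<bar>\<phi> x - \<phi> y\<bar> \<le> bundle_dist x y"
        by blast
      have "norm ((\<integral>p. \<phi> p \<partial>transport TYPE('d) V u) - (\<integral>p. \<phi> p \<partial>transport TYPE('d) V u')) \<le> m * (C * 1 * \<eta>)"
      proof (rule C(2)[OF V u u' _ \<eta>], unfold bundle_lipschitz_def, intro conjI ballI)
        show "norm (\<phi> p) \<le> 1" if "p \<in> plane_bundle TYPE('d)" for p
          using bspec[OF \<phi>(2) that] by simp
        show "norm (\<phi> p - \<phi> q) \<le> 1 * (norm (fst p - fst q) + norm (snd p - snd q))"
          if "p \<in> plane_bundle TYPE('d)" "q \<in> plane_bundle TYPE('d)" for p q
        proof -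
          have "\<bar>\<phi> p - \<phi> q\<bar> \<le> bundle_dist p q" using \<phi>(3) that by blast
          then show ?thesis using onorm_matrix_le[of "snd p - snd q"] by (simp add: bundle_dist_def)
        qed
      qed (use \<phi>(1) in auto)
      then show ?thesis by (simp add: a mult.assoc)
    qed
    have bd: "0 \<le> bundle_dist p q" for p q :: "(real^'n) \<times> (real^'n^'n)"
      unfolding bundle_dist_def by (intro add_nonneg_nonneg onorm_pos_le matrix_vector_mul_bounded_linear) auto
    \<comment> \<open>The zero test function shows that the set is nonempty, so that
      \<open>Sup\<close> has its usual meaning, and that the supremum is nonnegative, as the
      absolute value requires.\<close>
    have 0: "0 \<in> ?A"
      by (rule CollectI, rule exI[of _ "\<lambda>_. 0"]) (simp add: bd)
    have "0 \<le> Sup ?A" by (rule cSup_upper[OF 0]) (use le in \<open>auto intro!: bdd_aboveI\<close>)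
    moreover have "Sup ?A \<le> ?c" by (rule cSup_least) (use 0 le in auto)
    ultimately show "\<bar>varifold_dist TYPE('d) (transport TYPE('d) V u) (transport TYPE('d) V u')\<bar> \<le> ?c"
      unfolding bounded_lipschitz_dist_def by linarith
  qed
qed

text \<open>A frame determines its plane through \<open>S v = \<Sum>\<^sub>i (v \<bullet> s\<^sub>i) s\<^sub>i\<close>, which exhibits the
  Grassmannian as a continuous image of the compact set of orthonormal frames.\<close>

lemma compact_grassmannian: "compact (grassmannian TYPE('d::finite) :: (real^'n^'n) set)"
proof -
  define P :: "(real^'n)^'d \<Rightarrow> real^'n^'n" where "P s = (\<chi> a b. \<Sum>i\<in>UNIV. s $ i $ a * s $ i $ b)" for s
  define F :: "((real^'n)^'d) set" where "F = {s. \<forall>i j. s $ i \<bullet> s $ j = (if i = j then 1 else 0)}"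
  have Pv: "P s *v x = (\<Sum>i\<in>UNIV. (x \<bullet> s $ i) *\<^sub>R s $ i)" for s x
    by (simp add: P_def vec_eq_iff matrix_vector_mult_def inner_vec_def sum_distrib_right sum_distrib_left mult_ac)
      (intro allI, subst sum.swap, rule refl)
  have Pproj: "P s = proj_onto (span (range (($) s)))" if s: "s \<in> F" for s
  proof (rule matrix_eq[THEN iffD2], rule allI, rule sym, rule proj_onto_unique)
    fix x
    show "subspace (span (range (($) s)))" by simp
    show "P s *v x \<in> span (range (($) s))"
      unfolding Pv by (intro span_sum span_scale span_base) auto
    have orth: "s $ i \<bullet> s $ j = (if i = j then 1 else 0)" for i j using s by (simp add: F_def)
    have "(x - P s *v x) \<bullet> s $ j = 0" for j
      unfolding Pv inner_diff_left inner_sum_left inner_scaleR_left orth by (simp add: if_distrib cong: if_cong)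
    then have "orthogonal (x - P s *v x) y" if "y \<in> range (($) s)" for y
      using that by (auto simp: orthogonal_def)
    then show "(x - P s *v x) \<bullet> z = 0" if "z \<in> span (range (($) s))" for z
      using orthogonal_to_span[OF that] by (simp add: orthogonal_def)
  qed
  have "grassmannian TYPE('d) = P ` F"
  proof (intro equalityI subsetI)
    fix S :: "real^'n^'n" assume S: "S \<in> grassmannian TYPE('d)"
    obtain s :: "'d \<Rightarrow> real^'n" where s: "orthonormal_frame (plane S) s"
      using orthonormal_frame_exists[OF grassmannianD(1,2)[OF S]] by blast
    have F: "(\<chi> i. s i) \<in> F" using s by (simp add: F_def orthonormal_frame_def)
    have "range (($) (\<chi> i. s i)) = range s" by (auto simp: image_def)
    then have "P (\<chi> i. s i) = S"
      using Pproj[OF F] s grassmannianD(3)[OF S] by (simp add: orthonormal_frame_def)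
    then show "S \<in> P ` F" using F by blast
  next
    fix S assume "S \<in> P ` F"
    then obtain s where s: "s \<in> F" "S = proj_onto (span (range (($) s)))" using Pproj by blast
    have o: "s $ i \<bullet> s $ j = (if i = j then 1 else 0)" for i j using s(1) by (simp add: F_def)
    have inj: "inj (($) s)"
    proof (rule injI)
      fix i j assume "s $ i = s $ j"
      then show "i = j" using o[of i j] o[of j j] by (auto split: if_splits)
    qed
    have "independent (range (($) s))"
    proof (rule pairwise_orthogonal_independent)
      show "pairwise orthogonal (range (($) s))" using o by (auto simp: pairwise_def orthogonal_def)
      show "0 \<notin> range (($) s)"
      proof
        assume "0 \<in> range (($) s)"
        then obtain i where "s $ i = 0" by (metis rangeE)
        then show False using o[of i i] by simp
      qed
    qed
    then have "dim (span (range (($) s))) = card (range (($) s))"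
      by (simp add: dim_span dim_eq_card_independent)
    then have "dim (span (range (($) s))) = CARD('d)" using card_image[OF inj] by simp
    then show "S \<in> grassmannian TYPE('d)" unfolding grassmannian_def s(2) by (intro imageI) auto
  qed
  moreover have "compact F"
    unfolding compact_eq_bounded_closed
  proof
    have "norm s \<le> (\<Sum>i\<in>(UNIV::'d set). 1)" if "s \<in> F" for s
    proof -
      have "norm (s $ i) = 1" for i using that by (simp add: F_def norm_eq_1)
      then show ?thesis using L2_set_le_sum[of UNIV "\<lambda>i. norm (s $ i)"] by (simp add: norm_vec_def)
    qed
    then show "bounded F" unfolding bounded_iff by blast
    show "closed F" unfolding F_def
      by (intro closed_Collect_all closed_Collect_eq continuous_intros)
  qed
  moreover have "continuous_on F P" unfolding P_def[abs_def]
    by (intro continuous_intros)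
  ultimately show ?thesis by (simp add: compact_continuous_image)
qed

section \<open>Test functions determine a varifold\<close>

lemma borel_eq_sigma_compact: "sets (borel :: 'a::euclidean_space measure) = sigma_sets UNIV (Collect compact)"
proof (rule equalityI)
  show "sigma_sets UNIV (Collect compact) \<subseteq> sets (borel :: 'a measure)"
    using sets.sigma_sets_subset[of "Collect compact" "borel :: 'a measure"] borel_compact by auto
  have "S \<in> sigma_sets UNIV (Collect compact)" if "closed S" for S :: "'a set"
  proof -
    have "S = (\<Union>k::nat. S \<inter> cball 0 (real k))"
    proof -
      have "\<exists>k::nat. norm x \<le> real k" for x :: 'a using real_arch_simple by blast
      then show ?thesis by auto
    qed
    moreover have "(\<Union>k::nat. S \<inter> cball 0 (real k)) \<in> sigma_sets UNIV (Collect compact)"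
      by (rule sigma_sets.Union) (auto intro!: sigma_sets.Basic closed_Int_compact that)
    ultimately show ?thesis by simp
  qed
  then have "sigma_sets UNIV (Collect closed) \<subseteq> sigma_sets UNIV (Collect compact :: 'a set set)"
    by (intro sigma_sets_mono) auto
  then show "sets (borel :: 'a measure) \<subseteq> sigma_sets UNIV (Collect compact)"
    unfolding borel_eq_closed by simp
qed

text \<open>Tent functions around a compact set \<open>K\<close> converge to its indicator, so equal
  integrals force equal measure of \<open>K\<close>; compact sets are stable under intersection and
  generate the Borel sets, and balls exhaust the space with finite measure.\<close>

lemma varifold_eqI:
  fixes V W :: "((real^'n) \<times> (real^'n^'n)) measure"
  assumes V: "varifold TYPE('d::finite) V" and W: "varifold TYPE('d) W"
    and eq: "\<And>\<phi> :: (real^'n) \<times> (real^'n^'n) \<Rightarrow> real. continuous_on (plane_bundle TYPE('d)) \<phi> \<Longrightarrow>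
      (\<exists>K. compact K \<and> K \<subseteq> plane_bundle TYPE('d) \<and> (\<forall>x\<in>plane_bundle TYPE('d) - K. \<phi> x = 0)) \<Longrightarrow>
      (\<integral>x. \<phi> x \<partial>V) = (\<integral>x. \<phi> x \<partial>W)"
  shows "V = W"
proof -
  let ?X = "plane_bundle TYPE('d) :: ((real^'n) \<times> (real^'n^'n)) set"
  have closedX: "closed ?X" by (intro closed_Times closed_UNIV compact_imp_closed compact_grassmannian)
  have sV: "sets V = sets (bundle_borel TYPE('d))" and sW: "sets W = sets (bundle_borel TYPE('d))"
    and fV: "\<And>K. compact K \<Longrightarrow> K \<subseteq> ?X \<Longrightarrow> emeasure V K < \<infinity>" and fW: "\<And>K. compact K \<Longrightarrow> K \<subseteq> ?X \<Longrightarrow> emeasure W K < \<infinity>"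
    using V W by (auto simp: varifold_def)
  have sp: "space U = ?X" if "sets U = sets (bundle_borel TYPE('d))" for U :: "((real^'n) \<times> (real^'n^'n)) measure"
    by (rule space_plane_bundle[OF that])
  have setsI: "A \<in> sets (bundle_borel TYPE('d))" if "A \<in> sets borel" "A \<subseteq> ?X" for A
    using that closedX borel_closed by (auto simp: bundle_borel_def sets_restrict_space_iff)
  have compact_eq: "emeasure V K = emeasure W K" if K: "compact K" "K \<subseteq> ?X" for K
  proof (cases "K = {}")
    case False
    \<comment> \<open>A common compact set outside which all the tent functions vanish: it gives the
      compact support required of a test function and the integrable majorant. It is closed because
      the Grassmannian is compact.\<close>
    define N where "N = {p. infdist p K \<le> 1} \<inter> ?X"
    have bK: "bounded {p. infdist p K \<le> 1}"
    proof -
      obtain r where r: "\<And>q. q \<in> K \<Longrightarrow> norm q \<le> r"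
        using compact_imp_bounded[OF K(1)] unfolding bounded_iff by blast
      have "norm p \<le> r + 1" if "infdist p K \<le> 1" for p
      proof -
        obtain q where q: "q \<in> K" "infdist p K = dist p q"
          using infdist_attains_inf[OF compact_imp_closed[OF K(1)] False] by metis
        have "norm p \<le> norm q + dist p q" by (metis dist_norm norm_triangle_sub)
        then show ?thesis using r[OF q(1)] q(2) that by linarith
      qed
      then show ?thesis unfolding bounded_iff by blast
    qed
    have cN: "compact N" unfolding N_def compact_eq_bounded_closed
      by (intro conjI bounded_Int closed_Int closedX closed_Collect_le continuous_intros) (use bK in auto)
    have KN: "K \<subseteq> N" using K(2) by (auto simp: N_def)
    \<comment> \<open>Only the indices \<open>Suc k\<close> are used: for index 0 this is the
      constant 1, while from index 1 on it vanishes outside \<open>N\<close>.\<close>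
    define \<phi> where "\<phi> k p = max 0 (1 - real k * infdist p K)" for k :: nat and p
    have c\<phi>: "continuous_on S (\<phi> k)" for k S unfolding \<phi>_def by (intro continuous_intros)
    have \<phi>0: "\<phi> (Suc k) p = 0" if "p \<in> ?X - N" for k p
    proof -
      have "1 < infdist p K" using that by (auto simp: N_def)
      then have "1 \<le> real (Suc k) * infdist p K" using mult_mono[of 1 "real (Suc k)" 1 "infdist p K"] by simp
      then show ?thesis by (simp add: \<phi>_def)
    qed
    have \<phi>1: "0 \<le> \<phi> k p" "\<phi> k p \<le> 1" for k p by (auto simp: \<phi>_def infdist_nonneg)
    have lim: "(\<lambda>k. \<phi> (Suc k) p) \<longlonglongrightarrow> indicator K p" for p
    proof (cases "p \<in> K")
      case True
      then show ?thesis by (simp add: \<phi>_def)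
    next
      case F: False
      have pos: "0 < infdist p K"
        using infdist_pos_not_in_closed[OF compact_imp_closed[OF K(1)] False F] .
      obtain k0 :: nat where k0: "1 / infdist p K \<le> real k0" using real_arch_simple by blast
      have "\<phi> (Suc k) p = 0" if "k0 \<le> k" for k
      proof -
        have "1 / infdist p K \<le> real (Suc k)" using k0 that by linarith
        then have "1 \<le> real (Suc k) * infdist p K" using pos by (simp only: pos_divide_le_eq)
        then show ?thesis by (simp add: \<phi>_def)
      qed
      then have "\<forall>\<^sub>F k in sequentially. \<phi> (Suc k) p = 0" by (auto simp: eventually_sequentially)
      then show ?thesis using F tendsto_eventually by fastforce
    qed
    have conv: "(\<lambda>k. \<integral>p. \<phi> (Suc k) p \<partial>U) \<longlonglongrightarrow> measure U K"
      if sU: "sets U = sets (bundle_borel TYPE('d))" and fU: "emeasure U N < \<infinity>"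
      for U :: "((real^'n) \<times> (real^'n^'n)) measure"
    proof -
      have NU: "N \<in> sets U" "K \<in> sets U"
        using setsI[of N] setsI[of K] cN K borel_compact N_def sU by auto
      have "(\<lambda>k. \<integral>p. \<phi> (Suc k) p \<partial>U) \<longlonglongrightarrow> (\<integral>p. indicator K p \<partial>U)"
      proof (rule integral_dominated_convergence[where w = "indicator N"])
        show "integrable U (indicator N :: _ \<Rightarrow> real)" using NU fU by (intro integrable_real_indicator)
        show "\<phi> (Suc k) \<in> borel_measurable U" for k
          using bundle_measurable_continuous[OF c\<phi>] measurable_cong_sets[OF sU refl] by blast
        show "indicator K \<in> borel_measurable U" using NU by simp
        show "AE p in U. (\<lambda>k. \<phi> (Suc k) p) \<longlonglongrightarrow> indicator K p" by (rule AE_I2) (rule lim)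
        show "AE p in U. norm (\<phi> (Suc k) p) \<le> indicator N p" for k
        proof (rule AE_I2)
          fix p assume "p \<in> space U"
          then show "norm (\<phi> (Suc k) p) \<le> indicator N p"
            using \<phi>0[of p k] \<phi>1[of "Suc k" p] sp[OF sU] by (auto simp: indicator_def)
        qed
      qed
      moreover have "K \<inter> space U = K" using K(2) sp[OF sU] by auto
      ultimately show ?thesis by simp
    qed
    have NX: "N \<subseteq> ?X" by (simp add: N_def)
    have "(\<integral>p. \<phi> (Suc k) p \<partial>V) = (\<integral>p. \<phi> (Suc k) p \<partial>W)" for k
      by (rule eq[OF c\<phi>]) (use cN NX \<phi>0 in blast)
    then have "measure V K = measure W K"
      using LIMSEQ_unique[OF conv[OF sV fV[OF cN NX]]] conv[OF sW fW[OF cN NX]] by simp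
    moreover have "emeasure V K = ennreal (measure V K)" "emeasure W K = ennreal (measure W K)"
      using fV[OF K] fW[OF K] by (auto intro!: emeasure_eq_ennreal_measure)
    ultimately show ?thesis by simp
  qed simp
  \<comment> \<open>Extension by zero to the whole Euclidean space, where the compact sets are a
    generator in the form just proved.\<close>
  define E where "E U = distr U borel (\<lambda>p. p)" for U :: "((real^'n) \<times> (real^'n^'n)) measure"
  have Em: "(\<lambda>p. p) \<in> borel_measurable U" if "sets U = sets (bundle_borel TYPE('d))" for U :: "((real^'n) \<times> (real^'n^'n)) measure"
    using bundle_measurable_continuous[of "TYPE('d)" "\<lambda>p. p"] measurable_cong_sets[OF that refl] continuous_on_id by blast
  have Ee: "emeasure (E U) A = emeasure U (A \<inter> ?X)" if "sets U = sets (bundle_borel TYPE('d))" "A \<in> sets borel" for U A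
    unfolding E_def using Em[OF that(1)] that sp[OF that(1)] by (subst emeasure_distr) auto
  have "E V = E W"
  proof (rule measure_eqI_generator_eq[where \<Omega> = UNIV and E = "Collect compact" and A = "\<lambda>k::nat. cball 0 (real k)"])
    show "Int_stable (Collect compact :: ((real^'n) \<times> (real^'n^'n)) set set)"
      by (auto simp: Int_stable_def intro: compact_Int)
    have cI: "compact (K \<inter> ?X)" if "compact K" for K using that closedX by (rule compact_Int_closed)
    show "emeasure (E V) K = emeasure (E W) K" if "K \<in> Collect compact" for K
    proof -
      have K: "compact K" using that by simp
      have Kb: "K \<in> sets borel" by (rule borel_compact[OF K])
      have "emeasure V (K \<inter> ?X) = emeasure W (K \<inter> ?X)" by (rule compact_eq[OF cI[OF K] Int_lower2])
      then show ?thesis by (simp only: Ee[OF sV Kb] Ee[OF sW Kb])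
    qed
    show "sets (E V) = sigma_sets UNIV (Collect compact)" "sets (E W) = sigma_sets UNIV (Collect compact)"
      by (simp_all add: E_def borel_eq_sigma_compact)
    have "\<exists>k::nat. norm x \<le> real k" for x :: "(real^'n) \<times> (real^'n^'n)" using real_arch_simple by blast
    then show "(\<Union>k::nat. cball 0 (real k)) = (UNIV :: ((real^'n) \<times> (real^'n^'n)) set)" by auto
    show "emeasure (E V) (cball 0 (real k)) \<noteq> \<infinity>" for k
      using fV[OF cI[OF compact_cball[of 0 "real k"]] Int_lower2] Ee[OF sV, of "cball 0 (real k)"] by simp
  qed auto
  show ?thesis
  proof (rule measure_eqI)
    show "sets V = sets W" using sV sW by simp
    fix A assume "A \<in> sets V"
    then have "A \<in> sets (restrict_space borel ?X)" using sV by (simp add: bundle_borel_def)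
    then have "A \<in> sets borel" "A \<subseteq> ?X"
      using closedX borel_closed by (auto simp: sets_restrict_space_iff)
    then show "emeasure V A = emeasure W A"
      using Ee[OF sV, of A] Ee[OF sW, of A] \<open>E V = E W\<close> by (simp add: Int_absorb2)
  qed
qed

section \<open>The limit flow\<close>

text \<open>Total mass is the integral of the constant 1, a test function that
  \<open>transport_tendsto\<close> accepts. Finiteness of the transported measures is what lets the
  real-valued inequality be read back for \<open>emeasure\<close>.\<close>

lemma mass_transport_limit:
  fixes V :: "((real^'n) \<times> (real^'n^'n)) measure"
  assumes V: "sets V = sets (bundle_borel TYPE('d::finite))" "total_mass V \<le> ennreal m"
    and u: "\<And>j. admissible R (u j)" "admissible R v" "\<And>x. (\<lambda>j. u j x) \<longlonglongrightarrow> v x"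
    and c: "\<And>j. total_mass (transport TYPE('d) V (u j)) \<le> ennreal c" "0 \<le> c"
  shows "total_mass (transport TYPE('d) V v) \<le> ennreal c"
proof -
  have int: "(\<integral>p. (1::real) \<partial>transport TYPE('d) V w) = measure (transport TYPE('d) V w) (space (transport TYPE('d) V w))" for w
    by simp
  have "(\<lambda>j. \<integral>p. (1::real) \<partial>transport TYPE('d) V (u j)) \<longlonglongrightarrow> (\<integral>p. (1::real) \<partial>transport TYPE('d) V v)"
    by (rule transport_tendsto[OF V u, where b = 1]) auto
  moreover have "(\<integral>p. (1::real) \<partial>transport TYPE('d) V (u j)) \<le> c" for j
    unfolding int
    using c finite_measure.emeasure_eq_measure[OF finite_measure_transport[OF V u(1)[of j]], of "space (transport TYPE('d) V (u j))"]
    by (metis ennreal_le_iff)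
  ultimately have "(\<integral>p. (1::real) \<partial>transport TYPE('d) V v) \<le> c" by (intro LIMSEQ_le_const2) auto
  then show ?thesis
    unfolding int finite_measure.emeasure_eq_measure[OF finite_measure_transport[OF V u(2)]] by (rule ennreal_leI)
qed

lemma LIMSEQ_norm_diff_le:
  fixes a :: "nat \<Rightarrow> 'a::real_normed_vector"
  assumes "\<And>j. norm (a j - l) \<le> r j" "r \<longlonglongrightarrow> 0"
  shows "a \<longlonglongrightarrow> l"
  by (rule LIM_zero_cancel) (rule Lim_null_comparison[OF always_eventually assms(2)], use assms(1) in auto)

text \<open>Both inequalities in \<open>bilipschitz\<close> are closed conditions and survive
  pointwise limits; continuity is where the uniform rate \<open>e\<close> is used.\<close>

lemma admissible_limit:
  assumes u: "\<And>j. admissible R (u j)" and lim: "\<And>j x. norm (u j x - v x) \<le> e j" and e: "e \<longlonglongrightarrow> 0"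
  shows "admissible R v"
  unfolding admissible_def bilipschitz_def
proof (intro conjI allI)
  have p: "(\<lambda>j. u j x) \<longlonglongrightarrow> v x" for x
    by (rule LIMSEQ_norm_diff_le[OF lim e])
  have b: "norm (snd (u j x)) \<le> R" "norm w \<le> R * norm (blinfun_apply (snd (u j x)) w)" for j x w
    using u[of j] by (auto simp: admissible_def bilipschitz_def)
  show "continuous_on UNIV v"
  proof (rule uniform_limit_theorem[where F = sequentially and f = u])
    show "\<forall>\<^sub>F j in sequentially. continuous_on UNIV (u j)"
      using u by (intro always_eventually) (auto simp: admissible_def)
    show "uniform_limit UNIV u v sequentially"
    proof (rule uniform_limitI)
      fix r :: real assume "0 < r"
      then have "\<forall>\<^sub>F j in sequentially. e j < r" using order_tendstoD(2)[OF e] by blast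
      then show "\<forall>\<^sub>F j in sequentially. \<forall>x\<in>UNIV. dist (u j x) (v x) < r"
        by eventually_elim (use lim in \<open>auto simp: dist_norm intro: le_less_trans\<close>)
    qed
  qed simp
  fix x w
  show "norm (snd (v x)) \<le> R"
    by (rule LIMSEQ_le_const2[of "\<lambda>j. norm (snd (u j x))"]) (use b in \<open>auto intro!: tendsto_intros p\<close>)
  have "(\<lambda>j. R * norm (blinfun_apply (snd (u j x)) w)) \<longlonglongrightarrow> R * norm (blinfun_apply (snd (v x)) w)"
    by (intro tendsto_intros p)
  then show "norm w \<le> R * norm (blinfun_apply (snd (v x)) w)"
    by (rule LIMSEQ_le_const) (use b in auto)
qed

lemma varifold_transport:
  fixes V :: "((real^'n) \<times> (real^'n^'n)) measure"
  assumes V: "sets V = sets (bundle_borel TYPE('d::finite))" "total_mass V \<le> ennreal m"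
    and u: "admissible R u"
  shows "varifold TYPE('d) (transport TYPE('d) V u)"
proof -
  interpret finite_measure "transport TYPE('d) V u" by (rule finite_measure_transport[OF V u])
  show ?thesis unfolding varifold_def by (simp add: emeasure_eq_measure)
qed

lemma test_function_bounded:
  fixes \<phi> :: "'a::topological_space \<Rightarrow> real"
  assumes "continuous_on X \<phi>" "compact K" "K \<subseteq> X" "\<forall>x\<in>X - K. \<phi> x = 0"
  obtains b where "\<And>x. x \<in> X \<Longrightarrow> \<bar>\<phi> x\<bar> \<le> b"
proof -
  have "compact (\<phi> ` K)" using assms by (intro compact_continuous_image) (auto intro: continuous_on_subset)
  then have "bounded (\<phi> ` K)" by (rule compact_imp_bounded)
  then obtain b where b: "0 < b" "\<forall>y\<in>\<phi> ` K. norm y \<le> b" unfolding bounded_pos by blast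
  have "\<bar>\<phi> x\<bar> \<le> b" if "x \<in> X" for x
    using b assms(4) that by (cases "x \<in> K") auto
  then show ?thesis using that by blast
qed

text \<open>Since \<open>discrete_flow\<close> is total, full sequences can be stated; the finitely
  many indices with too coarse a mesh do not affect any limit. The last clause expresses uniqueness:
  a family of varifolds that is the weak limit along any sequence of vanishing mesh is the family
  \<open>V\<close>.\<close>

theorem theorem4p1:
  fixes \<psi> :: "real^'n::finite \<Rightarrow> real"
    and c3 \<epsilon> M :: real
    and V0 :: "((real^'n) \<times> (real^'n^'n)) measure"
  assumes "2 \<le> CARD('n)"
    and "CARD('d::finite) \<le> CARD('n)"
    and "cutoff \<psi>"
    and "flow_constant TYPE('d) \<psi> c3"
    and "0 < \<epsilon>" and "\<epsilon> < 1"
    and "1 \<le> M"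
    and "varifold TYPE('d) V0"
    and "compact (msupport V0)"
    and "emeasure (mass_measure V0) UNIV \<le> ennreal M"
  shows "\<exists>V :: real \<Rightarrow> ((real^'n) \<times> (real^'n^'n)) measure.
    (\<forall>t\<in>{0..1}.
       varifold TYPE('d) (V t) \<and>
       emeasure (mass_measure (V t)) UNIV \<le> ennreal (M + 1) \<and>
       varifold_tendsto TYPE('d)
         (\<lambda>j. discrete_flow TYPE('d) \<psi> \<epsilon> (dyadic_subdivision j) V0 t) (V t) \<and>
       (\<lambda>j. varifold_dist TYPE('d)
          (discrete_flow TYPE('d) \<psi> \<epsilon> (dyadic_subdivision j) V0 t) (V t)) \<longlonglongrightarrow> 0) \<and>
    (\<forall>\<T> :: nat \<Rightarrow> real list.
       (\<forall>j. subdivision (\<T> j)) \<and> (\<lambda>j. mesh (\<T> j)) \<longlonglongrightarrow> 0 \<longrightarrow>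
       (\<forall>t\<in>{0..1}.
          varifold_tendsto TYPE('d) (\<lambda>j. discrete_flow TYPE('d) \<psi> \<epsilon> (\<T> j) V0 t) (V t) \<and>
          (\<lambda>j. varifold_dist TYPE('d)
             (discrete_flow TYPE('d) \<psi> \<epsilon> (\<T> j) V0 t) (V t)) \<longlonglongrightarrow> 0)) \<and>
    (\<forall>V' :: real \<Rightarrow> ((real^'n) \<times> (real^'n^'n)) measure. \<forall>\<T> :: nat \<Rightarrow> real list.
       (\<forall>t\<in>{0..1}. varifold TYPE('d) (V' t)) \<and>
       (\<forall>j. subdivision (\<T> j)) \<and> (\<lambda>j. mesh (\<T> j)) \<longlonglongrightarrow> 0 \<and>
       (\<forall>t\<in>{0..1}.
          varifold_tendsto TYPE('d) (\<lambda>j. discrete_flow TYPE('d) \<psi> \<epsilon> (\<T> j) V0 t) (V' t)) \<longrightarrow>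
       (\<forall>t\<in>{0..1}. V' t = V t))"
proof -
  have V0: "sets V0 = sets (bundle_borel TYPE('d))" using assms(8) by (simp add: varifold_def)
  have V0M: "total_mass V0 \<le> ennreal M" using assms(10) emeasure_mass_measure[OF V0] by simp
  have M0: "0 \<le> M" "0 \<le> M + 1" using assms(7) by auto
  obtain L where cb: "curvature_bound TYPE('d) \<psi> \<epsilon> (M + 1) L"
    by (rule curvature_bound_exists[OF assms(3,5) M0(2)])
  then have L: "0 \<le> L" by (simp add: curvature_bound_def)
  define R where "R = exp (2 * L)"
  have R: "0 \<le> R" by (simp add: R_def)
  define u0 :: "'n::finite deformation" where "u0 = (\<lambda>x. (x, id_blinfun))"
  let ?H = "flow_field TYPE('d) \<psi> \<epsilon> V0"
  let ?T = "transport TYPE('d) V0"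
  let ?F = "\<lambda>ts. discrete_flow TYPE('d) \<psi> \<epsilon> ts V0"
  let ?e = "\<lambda>ts. euler ?H ts u0"
  have c3: "0 < c3" using assms(4) by (simp add: flow_constant_def)
  \<comment> \<open>The first entry is the threshold at which \<open>c3\<close> guarantees the mass
    bound M + 1; the second ensures that mesh times \<open>L\<close> is at most 1/2, with
    \<open>L + 1\<close> excluding a division by 0.\<close>
  define \<delta> where "\<delta> = min (\<epsilon> ^ 8 / (M + 1) ^ 3 / c3) (1 / (2 * (L + 1)))"
  have \<delta>: "0 < \<delta>" using assms(5,7) L c3 by (simp add: \<delta>_def)
  have mass: "emeasure (mass_measure (?F ts t)) UNIV \<le> ennreal (M + 1)"
    if ts: "subdivision ts" "mesh ts \<le> \<delta>" and t: "0 \<le> t" "t \<le> 1" for ts t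
  proof -
    have "mesh ts \<le> \<epsilon> ^ 8 / (M + 1) ^ 3 / c3" using ts(2) by (simp add: \<delta>_def)
    then have "c3 * mesh ts \<le> \<epsilon> ^ 8 / (M + 1) ^ 3" unfolding pos_le_divide_eq[OF c3] by (simp only: mult.commute)
    then show ?thesis
      using assms(4-8,10) ts(1) t unfolding flow_constant_def by blast
  qed
  have small: "mesh ts * L \<le> 1/2" if "subdivision ts" "mesh ts \<le> \<delta>" for ts
  proof -
    have "mesh ts \<le> 1 / (2 * (L + 1))" using that(2) by (simp add: \<delta>_def)
    then have "mesh ts * (2 * (L + 1)) \<le> 1" using L by (simp add: pos_le_divide_eq)
    then show ?thesis using mesh_nonneg[OF that(1)] by (simp add: algebra_simps)
  qed
  note flow = discrete_flow_eq_transport[OF V0 cb _ small mass, folded u0_def R_def]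
  obtain C where C: "0 \<le> C"
    "\<And>u x. u \<in> deformations TYPE('d) V0 R (M + 1) \<Longrightarrow> norm (?H u x) \<le> C"
    "\<And>u u' \<eta> x. u \<in> deformations TYPE('d) V0 R (M + 1) \<Longrightarrow> u' \<in> deformations TYPE('d) V0 R (M + 1) \<Longrightarrow>
      (\<And>x. norm (u x - u' x) \<le> \<eta>) \<Longrightarrow> norm (?H u x - ?H u' x) \<le> C * \<eta>"
    by (rule flow_field_lipschitz[OF assms(3,5) M0(2) R V0 V0M M0(1)]) blast
  have \<Omega>: "euler_at ?H ts u0 i \<in> deformations TYPE('d) V0 R (M + 1)"
    if "subdivision ts" "mesh ts \<le> \<delta>" "i < length ts" for ts i
    using flow(1) that by blast
  have Hlip: "\<forall>x. norm (?H u x - ?H v x) \<le> C * \<eta>"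
    if "u \<in> deformations TYPE('d) V0 R (M + 1)" "v \<in> deformations TYPE('d) V0 R (M + 1)" "\<And>x. norm (u x - v x) \<le> \<eta>" for u v \<eta>
    using C(3)[OF that] by blast
  obtain u E where E: "0 \<le> E"
    "\<And>ts t x. subdivision ts \<Longrightarrow> mesh ts \<le> \<delta> \<Longrightarrow> 0 \<le> t \<Longrightarrow> t \<le> 1 \<Longrightarrow>
      norm (?e ts t x - u t x) \<le> E * mesh ts"
  proof (rule euler_converges[where \<Omega> = "deformations TYPE('d) V0 R (M + 1)" and H = ?H and ?u0.0 = u0,
        OF Hlip C(2) C(1) C(1) \<delta> \<Omega>])
    fix u E assume "0 \<le> E" "\<And>ts t x. subdivision ts \<Longrightarrow> mesh ts \<le> \<delta> \<Longrightarrow> 0 \<le> t \<Longrightarrow> t \<le> 1 \<Longrightarrow>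
      norm (?e ts t x - u t x) \<le> E * mesh ts"
    then show thesis by (rule that[of E u])
  qed
  have Fe: "?F ts t = ?T (?e ts t)" and ae: "admissible R (?e ts t)"
    if "subdivision ts" "mesh ts \<le> \<delta>" "0 \<le> t" "t \<le> 1" for ts t
    using flow(2,3) that by blast+
  have m0: "(\<lambda>j. mesh (dyadic_subdivision j)) \<longlonglongrightarrow> 0"
    unfolding mesh_dyadic using LIMSEQ_power_zero[of "1/2::real"] by (simp add: power_one_over)
  then obtain N where N: "\<And>j. N \<le> j \<Longrightarrow> mesh (dyadic_subdivision j) \<le> \<delta>"
    using order_tendstoD(2)[OF m0 \<delta>] unfolding eventually_sequentially by (auto intro: less_imp_le)
  \<comment> \<open>Shifted so that every member, and not just almost every one, has mesh at most
    \<open>\<delta>\<close>: the limit lemmas ask for their bounds at all indices.\<close>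
  let ?d = "\<lambda>j. dyadic_subdivision (j + N)"
  have d: "subdivision (?d j)" "mesh (?d j) \<le> \<delta>" for j using N by (auto intro: subdivision_dyadic)
  have ed: "(\<lambda>j. E * mesh (?d j)) \<longlonglongrightarrow> 0"
    using tendsto_mult_right_zero[OF LIMSEQ_ignore_initial_segment[OF m0, of N]] .
  have au: "admissible R (u t)" if t: "0 \<le> t" "t \<le> 1" for t
    by (rule admissible_limit[OF ae[OF d t] E(2)[OF d t] ed])
  define V where "V t = ?T (u t)" for t
  obtain G where G: "0 \<le> G"
    "\<And>u u' \<eta>. admissible R u \<Longrightarrow> admissible R u' \<Longrightarrow> (\<And>x. norm (u x - u' x) \<le> \<eta>) \<Longrightarrow>
      \<bar>varifold_dist TYPE('d) (?T u) (?T u')\<bar> \<le> G * \<eta>"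
    by (rule varifold_dist_transport_le[OF V0 V0M M0(1), of R]) blast
  have conv: "varifold_tendsto TYPE('d) (\<lambda>j. ?F (ts j) t) (V t) \<and>
      (\<lambda>j. varifold_dist TYPE('d) (?F (ts j) t) (V t)) \<longlonglongrightarrow> 0"
    if ts: "\<And>j. subdivision (ts j)" "(\<lambda>j. mesh (ts j)) \<longlonglongrightarrow> 0" and t: "0 \<le> t" "t \<le> 1" for ts t
  proof
    have ev: "\<forall>\<^sub>F j in sequentially. mesh (ts j) \<le> \<delta>"
      using order_tendstoD(2)[OF ts(2) \<delta>] by eventually_elim simp
    \<comment> \<open>For the indices with too coarse a mesh the limit itself is substituted, so
      that admissibility and the rate hold for all \<open>j\<close>; eventually \<open>w j\<close>
      is the Euler polygon.\<close>
    define w where "w j = (if mesh (ts j) \<le> \<delta> then ?e (ts j) t else u t)" for j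
    have aw: "admissible R (w j)" for j using ae[OF ts(1) _ t] au[OF t] by (simp add: w_def)
    have wu: "norm (w j x - u t x) \<le> E * mesh (ts j)" for j x
      using E(2)[OF ts(1) _ t] E(1) mesh_nonneg[OF ts(1)] by (simp add: w_def)
    have E0: "(\<lambda>j. E * mesh (ts j)) \<longlonglongrightarrow> 0" using tendsto_mult_right_zero[OF ts(2)] .
    have pw: "(\<lambda>j. w j x) \<longlonglongrightarrow> u t x" for x
      by (rule LIMSEQ_norm_diff_le[OF wu E0])
    have evF: "\<forall>\<^sub>F j in sequentially. ?T (w j) = ?F (ts j) t"
      using ev by eventually_elim (simp add: w_def Fe[OF ts(1) _ t])
    show "varifold_tendsto TYPE('d) (\<lambda>j. ?F (ts j) t) (V t)"
      unfolding weak_star_tendsto_def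
    proof (intro allI impI, elim conjE exE)
      fix \<phi> :: "(real^'n) \<times> (real^'n^'n) \<Rightarrow> real" and K
      assume \<phi>: "continuous_on (plane_bundle TYPE('d)) \<phi>" "compact K" "K \<subseteq> plane_bundle TYPE('d)"
        "\<forall>x\<in>plane_bundle TYPE('d) - K. \<phi> x = 0"
      obtain b where b: "\<And>x. x \<in> plane_bundle TYPE('d) \<Longrightarrow> \<bar>\<phi> x\<bar> \<le> b"
        using test_function_bounded[OF \<phi>] by blast
      have "(\<lambda>j. \<integral>x. \<phi> x \<partial>?T (w j)) \<longlonglongrightarrow> (\<integral>x. \<phi> x \<partial>?T (u t))"
        by (rule transport_tendsto[OF V0 V0M aw au[OF t] pw \<phi>(1) b])
      moreover have "\<forall>\<^sub>F j in sequentially. (\<integral>x. \<phi> x \<partial>?T (w j)) = (\<integral>x. \<phi> x \<partial>?F (ts j) t)"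
        using evF by eventually_elim simp
      ultimately show "(\<lambda>j. \<integral>x. \<phi> x \<partial>?F (ts j) t) \<longlonglongrightarrow> (\<integral>x. \<phi> x \<partial>V t)"
        unfolding V_def by (rule Lim_transform_eventually)
    qed
    have "(\<lambda>j. varifold_dist TYPE('d) (?T (w j)) (?T (u t))) \<longlonglongrightarrow> 0"
    proof (rule Lim_null_comparison[OF always_eventually])
      show "\<forall>j. norm (varifold_dist TYPE('d) (?T (w j)) (?T (u t))) \<le> G * (E * mesh (ts j))"
        using G(2)[OF aw au[OF t] wu] by simp
      show "(\<lambda>j. G * (E * mesh (ts j))) \<longlonglongrightarrow> 0" using tendsto_mult_right_zero[OF E0] .
    qed
    moreover have "\<forall>\<^sub>F j in sequentially. varifold_dist TYPE('d) (?T (w j)) (?T (u t)) = varifold_dist TYPE('d) (?F (ts j) t) (?T (u t))"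
      using evF by eventually_elim simp
    ultimately show "(\<lambda>j. varifold_dist TYPE('d) (?F (ts j) t) (V t)) \<longlonglongrightarrow> 0"
      unfolding V_def by (rule Lim_transform_eventually)
  qed
  have var: "varifold TYPE('d) (V t)" if "0 \<le> t" "t \<le> 1" for t
    unfolding V_def by (rule varifold_transport[OF V0 V0M au[OF that]])
  have massV: "emeasure (mass_measure (V t)) UNIV \<le> ennreal (M + 1)" if t: "0 \<le> t" "t \<le> 1" for t
  proof -
    have pe: "(\<lambda>j. ?e (?d j) t x) \<longlonglongrightarrow> u t x" for x
      by (rule LIMSEQ_norm_diff_le[OF E(2)[OF d t] ed])
    have "emeasure (?T (?e (?d j) t)) (space (?T (?e (?d j) t))) \<le> ennreal (M + 1)" for j
      using mass[OF d t] unfolding Fe[OF d t] emeasure_mass_measure[OF sets_transport] .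
    then show ?thesis
      unfolding V_def emeasure_mass_measure[OF sets_transport]
      by (intro mass_transport_limit[OF V0 V0M ae[OF d t] au[OF t] pe _ M0(2)])
  qed
  have uniq: "V' t = V t"
    if "\<forall>t\<in>{0..1}. varifold TYPE('d) (V' t)" and ts: "\<forall>j. subdivision (ts j)" "(\<lambda>j. mesh (ts j)) \<longlonglongrightarrow> 0"
      and lim: "\<forall>t\<in>{0..1}. varifold_tendsto TYPE('d) (\<lambda>j. ?F (ts j) t) (V' t)" and t: "t \<in> {0..1}" for V' ts t
  proof (rule varifold_eqI)
    show "varifold TYPE('d) (V' t)" "varifold TYPE('d) (V t)" using that var by auto
    fix \<phi> :: "(real^'n) \<times> (real^'n^'n) \<Rightarrow> real"
    assume \<phi>: "continuous_on (plane_bundle TYPE('d)) \<phi>"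
      "\<exists>K. compact K \<and> K \<subseteq> plane_bundle TYPE('d) \<and> (\<forall>x\<in>plane_bundle TYPE('d) - K. \<phi> x = 0)"
    have "(\<lambda>j. \<integral>x. \<phi> x \<partial>?F (ts j) t) \<longlonglongrightarrow> (\<integral>x. \<phi> x \<partial>V' t)"
      using bspec[OF lim t] \<phi> unfolding weak_star_tendsto_def by blast
    moreover have "varifold_tendsto TYPE('d) (\<lambda>j. ?F (ts j) t) (V t)"
      using conv[of ts t] ts t by auto
    then have "(\<lambda>j. \<integral>x. \<phi> x \<partial>?F (ts j) t) \<longlonglongrightarrow> (\<integral>x. \<phi> x \<partial>V t)"
      using \<phi> unfolding weak_star_tendsto_def by blast
    ultimately show "(\<integral>x. \<phi> x \<partial>V' t) = (\<integral>x. \<phi> x \<partial>V t)" by (rule LIMSEQ_unique)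
  qed
  show ?thesis
  proof (rule exI[of _ V], intro conjI allI impI ballI)
    fix t :: real assume "t \<in> {0..1}"
    then have t: "0 \<le> t" "t \<le> 1" by auto
    show "varifold TYPE('d) (V t)" by (rule var[OF t])
    show "emeasure (mass_measure (V t)) UNIV \<le> ennreal (M + 1)" by (rule massV[OF t])
    show "varifold_tendsto TYPE('d) (\<lambda>j. ?F (dyadic_subdivision j) t) (V t)"
      by (rule conv[OF subdivision_dyadic m0 t, THEN conjunct1])
    show "(\<lambda>j. varifold_dist TYPE('d) (?F (dyadic_subdivision j) t) (V t)) \<longlonglongrightarrow> 0"
      by (rule conv[OF subdivision_dyadic m0 t, THEN conjunct2])
  next
    fix ts :: "nat \<Rightarrow> real list" and t :: real
    assume "(\<forall>j. subdivision (ts j)) \<and> (\<lambda>j. mesh (ts j)) \<longlonglongrightarrow> 0" "t \<in> {0..1}"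
    then have *: "\<And>j. subdivision (ts j)" "(\<lambda>j. mesh (ts j)) \<longlonglongrightarrow> 0" "0 \<le> t" "t \<le> 1" by auto
    show "varifold_tendsto TYPE('d) (\<lambda>j. ?F (ts j) t) (V t)" by (rule conv[OF *, THEN conjunct1])
    show "(\<lambda>j. varifold_dist TYPE('d) (?F (ts j) t) (V t)) \<longlonglongrightarrow> 0" by (rule conv[OF *, THEN conjunct2])
  next
    fix V' :: "real \<Rightarrow> ((real^'n) \<times> (real^'n^'n)) measure" and ts :: "nat \<Rightarrow> real list" and t :: real
    assume "(\<forall>t\<in>{0..1}. varifold TYPE('d) (V' t)) \<and> (\<forall>j. subdivision (ts j)) \<and> (\<lambda>j. mesh (ts j)) \<longlonglongrightarrow> 0 \<and>
       (\<forall>t\<in>{0..1}. varifold_tendsto TYPE('d) (\<lambda>j. ?F (ts j) t) (V' t))" "t \<in> {0..1}"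
    then show "V' t = V t" using uniq by blast
  qed
qed

end
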